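(* Let $(W,T)$ be a (finite real) abstract reflection group, $(L,R)$ a chromatic pair, $S:=L\cup R$ and $c:=c_{L,R}$. Let $\mathbf{B}(W,S)$ be the Artin group of $(W,S)$ and $\mathbf T\subset \mathbf B(W,S)$ the set of conjugates of the standard generators by powers of $\mathbf c$. The bijection $T\to\mathbf T$ (inverse of the restriction to $\mathbf T$ of the canonical morphism $\mathbf B(W,S)\to W$) extends to a group isomorphism $$\mathbf G(P_c)\;\xrightarrow{\ \sim\ }\;\mathbf B(W,S).$$
   Context: An abstract (finite real) reflection group is a pair $(W,T)$ where $W$ is a finite group, $T\subset W$ generates $W$, and there is a faithful representation $\rho:W\hookrightarrow \mathrm{GL}(V_{\mathbb R})$, $V_{\mathbb R}$ a finite-dimensional real vector space, such that for all $w\in W$: $\operatorname{codim}\ker(\rho(w)-\mathrm{Id})=1 \Leftrightarrow w\in T$. For $w\in W$, $l_T(w)$ is the minimal length of an expression of $w$ as a product of elements of $T$. Write $w\prec_T w'$ if $l_T(w)+l_T(w^{-1}w')=l_T(w')$. A chromatic pair is an ordered pair $(L,R)$ of disjoint subsets of $T$ such that $\langle L\rangle$ and $\langle R\rangle$ are abelian and $(W,L\cup R)$ is a Coxeter system. Put $c_{L,R}=s_Ls_R$ where $s_L=\prod_{s\in L}s$, $s_R=\prod_{s\in R}s$. $P_c:=\{w\in W\mid w\prec_T c\}$, with the partial product: $ww'$ is defined for $w,w'\in P_c$ exactly when the product $ww'$ in $W$ lies in $P_c$ and $l_T(ww')=l_T(w)+l_T(w')$, and then it is the product in $W$. $\mathbf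 G(P_c)$ is the group presented by the generating set $P_c$ and relations $p\cdot q=r$ whenever $pq$ is defined in $P_c$ and equals $r$. (One has $T\subset P_c$, and $T$ generates $\mathbf G(P_c)$.) Artin group: let $\mathbf S$ be a formal copy of $S$ (with $\mathbf s\in\mathbf S$ corresponding to $s\in S$), $m_{s,t}$ the order of $st$, and $$\mathbf B(W,S)=\langle \mathbf S\mid \underbrace{\mathbf s\mathbf t\mathbf s\cdots}_{m_{s,t}}=\underbrace{\mathbf t\mathbf s\mathbf t\cdots}_{m_{s,t}},\ \mathbf s,\mathbf t\in\mathbf S\rangle_{\text{group}}.$$ The map $\mathbf s\mapsto s$ extends to the canonical morphism $\mathbf B(W,S)\to W$. Put $\mathbf c=\prod_{s\in L}\mathbf s\prod_{s\in R}\mathbf s$ and $\mathbf T:=\{\mathbf c^k\mathbf s\mathbf c^{-k}\mid k\in\mathbb Z,\ \mathbf s\in\mathbf S\}$. The canonical morphism restricts to a bijection $\mathbf T\to T$. *)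

theory Defs
  imports Complex_Main "HOL-Algebra.Generated_Groups" "HOL-Algebra.Multiplicative_Group"
begin

datatype 'g letter = Pos 'g | Neg 'g

type_synonym 'g word = "'g letter list"

fun letter_gen :: "'g letter \<Rightarrow> 'g" where
  "letter_gen (Pos x) = x"
| "letter_gen (Neg x) = x"

definition words :: "'g set \<Rightarrow> 'g word set" where
  "words X = {u. letter_gen ` set u \<subseteq> X}"

text \<open>The least congruence on words over \<open>X\<close> that contains the relations \<open>R\<close> and makes
  \<open>Neg x\<close> the inverse of \<open>Pos x\<close>.\<close>

inductive_set pres_cong :: "'g set \<Rightarrow> ('g word \<times> 'g word) set \<Rightarrow> ('g word \<times> 'g word) set"
  for X :: "'g set" and R :: "('g word \<times> 'g word) set" where
  refl: "u \<in> words X \<Longrightarrow> (u, u) \<in> pres_cong X R"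
| sym: "(u, v) \<in> pres_cong X R \<Longrightarrow> (v, u) \<in> pres_cong X R"
| trans: "(u, v) \<in> pres_cong X R \<Longrightarrow> (v, w) \<in> pres_cong X R \<Longrightarrow> (u, w) \<in> pres_cong X R"
| app: "(u, v) \<in> pres_cong X R \<Longrightarrow> (u', v') \<in> pres_cong X R
    \<Longrightarrow> (u @ u', v @ v') \<in> pres_cong X R"
| inv_right: "x \<in> X \<Longrightarrow> ([Pos x, Neg x], []) \<in> pres_cong X R"
| inv_left: "x \<in> X \<Longrightarrow> ([Neg x, Pos x], []) \<in> pres_cong X R"
| rel: "(u, v) \<in> R \<Longrightarrow> u \<in> words X \<Longrightarrow> v \<in> words X \<Longrightarrow> (u, v) \<in> pres_cong X R"

definition presented_group :: "'g set \<Rightarrow> ('g word \<times> 'g word) set \<Rightarrow> 'g word set monoid" where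
  "presented_group X R =
    \<lparr>carrier = words X // pres_cong X R,
     mult = (\<lambda>A B. \<Union>a\<in>A. \<Union>b\<in>B. pres_cong X R `` {a @ b}),
     one = pres_cong X R `` {[]}\<rparr>"

definition pres_gen :: "'g set \<Rightarrow> ('g word \<times> 'g word) set \<Rightarrow> 'g \<Rightarrow> 'g word set" where
  "pres_gen X R x = pres_cong X R `` {[Pos x]}"

fun eval_letter :: "('a, 'b) monoid_scheme \<Rightarrow> ('g \<Rightarrow> 'a) \<Rightarrow> 'g letter \<Rightarrow> 'a" where
  "eval_letter G f (Pos x) = f x"
| "eval_letter G f (Neg x) = inv\<^bsub>G\<^esub> (f x)"

definition list_prod :: "('a, 'b) monoid_scheme \<Rightarrow> 'a list \<Rightarrow> 'a" where
  "list_prod G xs = foldr (\<lambda>x y. x \<otimes>\<^bsub>G\<^esub> y) xs \<one>\<^bsub>G\<^esub>"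

definition eval_word :: "('a, 'b) monoid_scheme \<Rightarrow> ('g \<Rightarrow> 'a) \<Rightarrow> 'g word \<Rightarrow> 'a" where
  "eval_word G f u = list_prod G (map (eval_letter G f) u)"

text \<open>The morphism from a presented group to \<open>G\<close> that sends each generator \<open>x\<close> to \<open>f x\<close>;
  see \<open>pres_lift_hom\<close> and \<open>pres_lift_gen\<close> below.\<close>

definition pres_lift :: "('a, 'b) monoid_scheme \<Rightarrow> ('g \<Rightarrow> 'a) \<Rightarrow> 'g word set \<Rightarrow> 'a" where
  "pres_lift G f A = the_elem (eval_word G f ` A)"

lemma words_simps [simp]:
  "[] \<in> words X"
  "a # u \<in> words X \<longleftrightarrow> letter_gen a \<in> X \<and> u \<in> words X"
  "u @ v \<in> words X \<longleftrightarrow> u \<in> words X \<and> v \<in> words X"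
  by (auto simp: words_def)

lemma pres_cong_words: "(u, v) \<in> pres_cong X R \<Longrightarrow> u \<in> words X \<and> v \<in> words X"
  by (induction rule: pres_cong.induct) auto

lemma equiv_pres_cong: "equiv (words X) (pres_cong X R)"
proof (rule equivI)
  show "pres_cong X R \<subseteq> words X \<times> words X"
    using pres_cong_words by fastforce
  show "refl_on (words X) (pres_cong X R)"
    by (rule refl_onI) (rule pres_cong.refl)
  show "sym (pres_cong X R)"
    by (rule symI) (rule pres_cong.sym)
  show "trans (pres_cong X R)"
    by (rule transI) (rule pres_cong.trans)
qed

lemma pres_cong_class_eq:
  "(u, v) \<in> pres_cong X R \<Longrightarrow> pres_cong X R `` {u} = pres_cong X R `` {v}"
  by (rule equiv_class_eq[OF equiv_pres_cong])

lemma presented_group_mult: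
  assumes "u \<in> words X" "v \<in> words X"
  shows "pres_cong X R `` {u} \<otimes>\<^bsub>presented_group X R\<^esub> pres_cong X R `` {v}
    = pres_cong X R `` {u @ v}"
proof -
  have "pres_cong X R `` {a @ b} = pres_cong X R `` {u @ v}"
    if "(u, a) \<in> pres_cong X R" "(v, b) \<in> pres_cong X R" for a b
    using pres_cong_class_eq[OF pres_cong.app[OF that]] by simp
  moreover have "(u, u) \<in> pres_cong X R" "(v, v) \<in> pres_cong X R"
    using assms by (auto intro: pres_cong.refl)
  ultimately have "(\<Union>a\<in>pres_cong X R `` {u}. \<Union>b\<in>pres_cong X R `` {v}. pres_cong X R `` {a @ b})
      = pres_cong X R `` {u @ v}"
    by blast
  then show ?thesis
    by (simp add: presented_group_def)
qed

fun letter_inv :: "'g letter \<Rightarrow> 'g letter" where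
  "letter_inv (Pos x) = Neg x"
| "letter_inv (Neg x) = Pos x"

lemma pres_cong_inverse:
  assumes "u \<in> words X"
  shows "rev (map letter_inv u) \<in> words X
    \<and> (rev (map letter_inv u) @ u, []) \<in> pres_cong X R"
  using assms
proof (induction u)
  case Nil
  then show ?case by (auto intro: pres_cong.refl)
next
  case (Cons a u)
  let ?v = "rev (map letter_inv u)"
  have u: "u \<in> words X" and v: "?v \<in> words X" and IH: "(?v @ u, []) \<in> pres_cong X R"
    using Cons by auto
  have "([letter_inv a, a], []) \<in> pres_cong X R"
    using Cons.prems by (cases a) (simp_all add: pres_cong.inv_left pres_cong.inv_right)
  from pres_cong.app[OF pres_cong.app[OF pres_cong.refl[OF v] this] pres_cong.refl[OF u]]
  have "(?v @ [letter_inv a, a] @ u, ?v @ u) \<in> pres_cong X R"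
    by simp
  from pres_cong.trans[OF this IH] v show ?case
    using Cons.prems by (cases a) auto
qed

lemma group_presented_group: "group (presented_group X R)"
proof (rule groupI)
  let ?G = "presented_group X R" and ?E = "pres_cong X R"
  have cl: "\<exists>u\<in>words X. A = ?E `` {u}" if "A \<in> carrier ?G" for A
    using that by (auto simp: presented_group_def elim: quotientE)
  have inC: "?E `` {u} \<in> carrier ?G" if "u \<in> words X" for u
    using that by (auto simp: presented_group_def intro: quotientI)
  have one: "\<one>\<^bsub>?G\<^esub> = ?E `` {[]}"
    by (simp add: presented_group_def)
  show "\<one>\<^bsub>?G\<^esub> \<in> carrier ?G"
    by (simp add: one inC)
  fix A assume "A \<in> carrier ?G"
  then obtain a where a: "a \<in> words X" "A = ?E `` {a}"
    using cl by blast
  show "\<one>\<^bsub>?G\<^esub> \<otimes>\<^bsub>?G\<^esub> A = A"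
    using presented_group_mult[of "[]" X a R] a by (simp add: one)
  show "\<exists>B\<in>carrier ?G. B \<otimes>\<^bsub>?G\<^esub> A = \<one>\<^bsub>?G\<^esub>"
  proof
    let ?b = "rev (map letter_inv a)"
    have b: "?b \<in> words X" and ba: "(?b @ a, []) \<in> ?E"
      using pres_cong_inverse[OF a(1), of R] by auto
    show "?E `` {?b} \<in> carrier ?G"
      by (rule inC[OF b])
    show "?E `` {?b} \<otimes>\<^bsub>?G\<^esub> A = \<one>\<^bsub>?G\<^esub>"
      unfolding a(2) presented_group_mult[OF b a(1)] one by (rule pres_cong_class_eq[OF ba])
  qed
  fix B assume "B \<in> carrier ?G"
  then obtain b where b: "b \<in> words X" "B = ?E `` {b}"
    using cl by blast
  show "A \<otimes>\<^bsub>?G\<^esub> B \<in> carrier ?G"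
    using a b by (simp add: presented_group_mult inC)
  fix C assume "C \<in> carrier ?G"
  then obtain c where c: "c \<in> words X" "C = ?E `` {c}"
    using cl by blast
  show "A \<otimes>\<^bsub>?G\<^esub> B \<otimes>\<^bsub>?G\<^esub> C = A \<otimes>\<^bsub>?G\<^esub> (B \<otimes>\<^bsub>?G\<^esub> C)"
    using a b c by (simp add: presented_group_mult)
qed

lemma pres_gen_closed: "x \<in> X \<Longrightarrow> pres_gen X R x \<in> carrier (presented_group X R)"
  by (auto simp: pres_gen_def presented_group_def intro: quotientI)

context group
begin

lemma list_prod_closed: "set xs \<subseteq> carrier G \<Longrightarrow> list_prod G xs \<in> carrier G"
  by (induction xs) (auto simp: list_prod_def)

lemma list_prod_append:
  "set xs \<subseteq> carrier G \<Longrightarrow> set ys \<subseteq> carrier G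
    \<Longrightarrow> list_prod G (xs @ ys) = list_prod G xs \<otimes> list_prod G ys"
proof (induction xs)
  case Nil
  then show ?case using list_prod_closed[of ys] by (simp add: list_prod_def)
next
  case (Cons x xs)
  then show ?case
    using list_prod_closed[of xs] list_prod_closed[of ys]
    by (simp add: list_prod_def m_assoc)
qed

lemma eval_letters_closed:
  assumes f: "f ` X \<subseteq> carrier G" and u: "u \<in> words X"
  shows "set (map (eval_letter G f) u) \<subseteq> carrier G"
proof -
  have "eval_letter G f a \<in> carrier G" if "a \<in> set u" for a
  proof -
    have "letter_gen a \<in> X" using u that by (auto simp: words_def)
    then show ?thesis using f by (cases a) auto
  qed
  then show ?thesis by auto
qed

lemma eval_word_closed:
  "f ` X \<subseteq> carrier G \<Longrightarrow> u \<in> words X \<Longrightarrow> eval_word G f u \<in> carrier G"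
  unfolding eval_word_def by (intro list_prod_closed eval_letters_closed)

lemma eval_word_append:
  "f ` X \<subseteq> carrier G \<Longrightarrow> u \<in> words X \<Longrightarrow> v \<in> words X
    \<Longrightarrow> eval_word G f (u @ v) = eval_word G f u \<otimes> eval_word G f v"
  unfolding eval_word_def
  using list_prod_append[OF eval_letters_closed eval_letters_closed] by simp

lemma eval_word_cong:
  assumes f: "f ` X \<subseteq> carrier G"
    and R: "\<And>u v. (u, v) \<in> R \<Longrightarrow> u \<in> words X \<Longrightarrow> v \<in> words X \<Longrightarrow> eval_word G f u = eval_word G f v"
    and uv: "(u, v) \<in> pres_cong X R"
  shows "eval_word G f u = eval_word G f v"
  using uv
proof (induction rule: pres_cong.induct)
  case (app u v u' v')
  then show ?case
    using pres_cong_words[OF app(1)] pres_cong_words[OF app(2)]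
    by (simp add: eval_word_append[OF f])
next
  case (inv_right x)
  then have "f x \<in> carrier G" using f by blast
  then show ?case by (simp add: eval_word_def list_prod_def)
next
  case (inv_left x)
  then have "f x \<in> carrier G" using f by blast
  then show ?case by (simp add: eval_word_def list_prod_def)
next
  case (rel u v)
  then show ?case by (rule R)
qed simp_all

lemma pres_lift_class:
  assumes f: "f ` X \<subseteq> carrier G"
    and R: "\<And>u v. (u, v) \<in> R \<Longrightarrow> u \<in> words X \<Longrightarrow> v \<in> words X \<Longrightarrow> eval_word G f u = eval_word G f v"
    and u: "u \<in> words X"
  shows "pres_lift G f (pres_cong X R `` {u}) = eval_word G f u"
proof -
  have "eval_word G f v = eval_word G f u" if "(u, v) \<in> pres_cong X R" for v
    by (rule eval_word_cong[OF f _ that, symmetric]) (rule R)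
  moreover have "(u, u) \<in> pres_cong X R"
    by (rule pres_cong.refl[OF u])
  ultimately have "eval_word G f ` (pres_cong X R `` {u}) = {eval_word G f u}"
    by blast
  then show ?thesis by (simp add: pres_lift_def)
qed

lemma pres_lift_hom:
  assumes f: "f ` X \<subseteq> carrier G"
    and R: "\<And>u v. (u, v) \<in> R \<Longrightarrow> u \<in> words X \<Longrightarrow> v \<in> words X \<Longrightarrow> eval_word G f u = eval_word G f v"
  shows "pres_lift G f \<in> hom (presented_group X R) G"
proof (rule homI)
  have lift: "pres_lift G f (pres_cong X R `` {u}) = eval_word G f u" if "u \<in> words X" for u
    by (rule pres_lift_class[OF f _ that]) (rule R)
  fix A assume "A \<in> carrier (presented_group X R)"
  then obtain a where a: "a \<in> words X" "A = pres_cong X R `` {a}"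
    by (auto simp: presented_group_def elim: quotientE)
  show "pres_lift G f A \<in> carrier G"
    using a eval_word_closed[OF f] by (simp add: lift)
  fix B assume "B \<in> carrier (presented_group X R)"
  then obtain b where b: "b \<in> words X" "B = pres_cong X R `` {b}"
    by (auto simp: presented_group_def elim: quotientE)
  show "pres_lift G f (A \<otimes>\<^bsub>presented_group X R\<^esub> B) = pres_lift G f A \<otimes> pres_lift G f B"
    using a b by (simp add: lift presented_group_mult eval_word_append[OF f])
qed

lemma pres_lift_gen:
  assumes f: "f ` X \<subseteq> carrier G"
    and R: "\<And>u v. (u, v) \<in> R \<Longrightarrow> u \<in> words X \<Longrightarrow> v \<in> words X \<Longrightarrow> eval_word G f u = eval_word G f v"
    and x: "x \<in> X"
  shows "pres_lift G f (pres_gen X R x) = f x"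
proof -
  have "pres_lift G f (pres_cong X R `` {[Pos x]}) = eval_word G f [Pos x]"
    by (rule pres_lift_class[OF f]) (use R x in simp_all)
  moreover have "f x \<in> carrier G"
    using f x by blast
  ultimately show ?thesis
    by (simp add: pres_gen_def eval_word_def list_prod_def)
qed

end

definition GL :: "('v::real_vector \<Rightarrow> 'v) monoid" where
  "GL = \<lparr>carrier = {f. linear f \<and> bij f}, mult = (\<circ>), one = id\<rparr>"

definition codim :: "'v::real_vector set \<Rightarrow> nat" where
  "codim U = dim (UNIV :: 'v set) - dim U"

text \<open>The representation space is the type \<open>'v\<close>: an existential quantifier over types is not
  available, so the type is passed as an argument, and a theorem that assumes this predicate for
  a type variable \<open>'v\<close> covers every representation space.\<close>

definition abstract_reflection_group ::
    "'v::real_vector itself \<Rightarrow> ('a, 'b) monoid_scheme \<Rightarrow> 'a set \<Rightarrow> bool" where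
  "abstract_reflection_group (_ :: 'v itself) W T \<longleftrightarrow>
    group W \<and> finite (carrier W) \<and> T \<subseteq> carrier W \<and> generate W T = carrier W \<and>
    (\<exists>B :: 'v set. finite B \<and> span B = UNIV) \<and>
    (\<exists>\<rho> :: 'a \<Rightarrow> 'v \<Rightarrow> 'v. \<rho> \<in> hom W GL \<and> inj_on \<rho> (carrier W) \<and>
      (\<forall>w\<in>carrier W. codim {v. \<rho> w v - v = 0} = 1 \<longleftrightarrow> w \<in> T))"

definition refl_length :: "('a, 'b) monoid_scheme \<Rightarrow> 'a set \<Rightarrow> 'a \<Rightarrow> nat" where
  "refl_length W T w = (LEAST n. \<exists>ts. set ts \<subseteq> T \<and> length ts = n \<and> list_prod W ts = w)"

definition refl_prec :: "('a, 'b) monoid_scheme \<Rightarrow> 'a set \<Rightarrow> 'a \<Rightarrow> 'a \<Rightarrow> bool" where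
  "refl_prec W T w w' \<longleftrightarrow>
    refl_length W T w + refl_length W T (inv\<^bsub>W\<^esub> w \<otimes>\<^bsub>W\<^esub> w') = refl_length W T w'"

text \<open>If \<open>s \<otimes> t\<close> has infinite order, then \<open>group.ord\<close> is \<open>0\<close>, and both the Coxeter and the braid
  relation of \<open>s\<close> and \<open>t\<close> are trivial. For \<open>s = t\<close> of order two the Coxeter relation is
  \<open>s s = 1\<close>.\<close>

definition coxeter_relations ::
    "('a, 'b) monoid_scheme \<Rightarrow> 'a set \<Rightarrow> ('a word \<times> 'a word) set" where
  "coxeter_relations W S =
    {(concat (replicate (group.ord W (s \<otimes>\<^bsub>W\<^esub> t)) [Pos s, Pos t]), []) | s t. s \<in> S \<and> t \<in> S}"

definition coxeter_system :: "('a, 'b) monoid_scheme \<Rightarrow> 'a set \<Rightarrow> bool" where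
  "coxeter_system W S \<longleftrightarrow>
    group W \<and> S \<subseteq> carrier W \<and> (\<forall>s\<in>S. group.ord W s = 2) \<and>
    pres_lift W (\<lambda>s. s) \<in> iso (presented_group S (coxeter_relations W S)) W"

fun alternating :: "nat \<Rightarrow> 'g \<Rightarrow> 'g \<Rightarrow> 'g word" where
  "alternating 0 s t = []"
| "alternating (Suc n) s t = Pos s # alternating n t s"

definition braid_relations ::
    "('a, 'b) monoid_scheme \<Rightarrow> 'a set \<Rightarrow> ('a word \<times> 'a word) set" where
  "braid_relations W S =
    {(alternating (group.ord W (s \<otimes>\<^bsub>W\<^esub> t)) s t, alternating (group.ord W (s \<otimes>\<^bsub>W\<^esub> t)) t s)
      | s t. s \<in> S \<and> t \<in> S}"

definition artin_group :: "('a, 'b) monoid_scheme \<Rightarrow> 'a set \<Rightarrow> 'a word set monoid" where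
  "artin_group W S = presented_group S (braid_relations W S)"

definition artin_gen :: "('a, 'b) monoid_scheme \<Rightarrow> 'a set \<Rightarrow> 'a \<Rightarrow> 'a word set" where
  "artin_gen W S = pres_gen S (braid_relations W S)"

definition artin_proj :: "('a, 'b) monoid_scheme \<Rightarrow> 'a word set \<Rightarrow> 'a" where
  "artin_proj W = pres_lift W (\<lambda>s. s)"

text \<open>The product of the pairwise commuting elements \<open>f s\<close>, formed in the commutative subgroup
  that they generate.\<close>

definition commuting_prod :: "('a, 'b) monoid_scheme \<Rightarrow> ('s \<Rightarrow> 'a) \<Rightarrow> 's set \<Rightarrow> 'a" where
  "commuting_prod G f A = finprod (G\<lparr>carrier := generate G (f ` A)\<rparr>) f A"

definition chromatic_pair ::
    "('a, 'b) monoid_scheme \<Rightarrow> 'a set \<Rightarrow> 'a set \<Rightarrow> 'a set \<Rightarrow> bool" where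
  "chromatic_pair W T L R \<longleftrightarrow>
    L \<subseteq> T \<and> R \<subseteq> T \<and> L \<inter> R = {} \<and>
    comm_group (W\<lparr>carrier := generate W L\<rparr>) \<and> comm_group (W\<lparr>carrier := generate W R\<rparr>) \<and>
    coxeter_system W (L \<union> R)"

definition coxeter_elt :: "('a, 'b) monoid_scheme \<Rightarrow> 'a set \<Rightarrow> 'a set \<Rightarrow> 'a" where
  "coxeter_elt W L R = commuting_prod W (\<lambda>s. s) L \<otimes>\<^bsub>W\<^esub> commuting_prod W (\<lambda>s. s) R"

definition artin_coxeter_elt ::
    "('a, 'b) monoid_scheme \<Rightarrow> 'a set \<Rightarrow> 'a set \<Rightarrow> 'a word set" where
  "artin_coxeter_elt W L R =
    commuting_prod (artin_group W (L \<union> R)) (artin_gen W (L \<union> R)) L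
      \<otimes>\<^bsub>artin_group W (L \<union> R)\<^esub>
    commuting_prod (artin_group W (L \<union> R)) (artin_gen W (L \<union> R)) R"

definition artin_reflections ::
    "('a, 'b) monoid_scheme \<Rightarrow> 'a set \<Rightarrow> 'a set \<Rightarrow> 'a word set set" where
  "artin_reflections W L R =
    {artin_coxeter_elt W L R [^]\<^bsub>artin_group W (L \<union> R)\<^esub> k
        \<otimes>\<^bsub>artin_group W (L \<union> R)\<^esub> artin_gen W (L \<union> R) s
        \<otimes>\<^bsub>artin_group W (L \<union> R)\<^esub> artin_coxeter_elt W L R [^]\<^bsub>artin_group W (L \<union> R)\<^esub> (- k)
      | (k :: int) s. s \<in> L \<union> R}"

lemma (in group) eval_word_braid:
  assumes s: "s \<in> carrier G" "s \<otimes> s = \<one>" and t: "t \<in> carrier G" "t \<otimes> t = \<one>"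
    and ord: "(s \<otimes> t) [^] m = \<one>"
  shows "eval_word G (\<lambda>s. s) (alternating m s t) = eval_word G (\<lambda>s. s) (alternating m t s)"
proof -
  let ?e = "eval_word G (\<lambda>s. s)"
  have suc: "?e (alternating (Suc n) x y) = x \<otimes> ?e (alternating n y x)" for n x y
    by (simp add: eval_word_def list_prod_def)
  have cl: "?e (alternating n x y) \<in> carrier G" if "x \<in> carrier G" "y \<in> carrier G" for n x y
    using that
  proof (induction n arbitrary: x y)
    case 0
    then show ?case by (simp add: eval_word_def list_prod_def)
  next
    case (Suc n)
    then show ?case by (simp only: suc m_closed)
  qed
  have ss: "s \<otimes> (s \<otimes> x) = x" and tt: "t \<otimes> (t \<otimes> x) = x" if "x \<in> carrier G" for x
    using s t that by (simp_all flip: m_assoc)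
  have sts: "(s \<otimes> t) [^] Suc n \<otimes> (t \<otimes> (s \<otimes> t) [^] n) = s" for n :: nat
  proof (induction n)
    case 0
    then show ?case using s t by (simp add: m_assoc)
  next
    case (Suc n)
    let ?p = "(s \<otimes> t) [^] Suc n" and ?q = "(s \<otimes> t) [^] n"
    have p: "?p \<in> carrier G" and q: "?q \<in> carrier G"
      using s t by simp_all
    have c: "?p = s \<otimes> t \<otimes> ?q"
      using s t by (intro nat_pow_Suc2) simp
    have "(s \<otimes> t) [^] Suc (Suc n) \<otimes> (t \<otimes> ?p)
        = ?p \<otimes> (s \<otimes> t) \<otimes> (t \<otimes> (s \<otimes> t \<otimes> ?q))"
      unfolding nat_pow_Suc[of _ "Suc n"] using c by simp
    also have "\<dots> = ?p \<otimes> (s \<otimes> (t \<otimes> (t \<otimes> (s \<otimes> (t \<otimes> ?q)))))"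
      using s(1) t(1) p q by (simp only: m_assoc m_closed)
    also have "\<dots> = ?p \<otimes> (t \<otimes> ?q)"
      using s(1) t(1) q by (simp only: ss tt m_closed)
    also have "\<dots> = s"
      by (rule Suc.IH)
    finally show ?case .
  qed
  have "?e (alternating n s t) = (s \<otimes> t) [^] n \<otimes> ?e (alternating n t s)" for n
  proof (induction n)
    case 0
    then show ?case by (simp add: eval_word_def list_prod_def)
  next
    case (Suc n)
    let ?a = "?e (alternating n t s)"
    have a: "?a \<in> carrier G" and p: "(s \<otimes> t) [^] k \<in> carrier G" for k :: nat
      using cl s t by auto
    have "(s \<otimes> t) [^] Suc n \<otimes> ?e (alternating (Suc n) t s)
        = (s \<otimes> t) [^] Suc n \<otimes> (t \<otimes> (s \<otimes> t) [^] n) \<otimes> ?a"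
      unfolding suc Suc.IH using s(1) t(1) a p by (simp only: m_assoc m_closed)
    also have "\<dots> = ?e (alternating (Suc n) s t)"
      unfolding sts suc ..
    finally show ?case ..
  qed
  from this[of m] show ?thesis
    using cl s t by (simp add: ord)
qed

lemma
  assumes "coxeter_system W S"
  shows artin_proj_hom: "artin_proj W \<in> hom (artin_group W S) W"
    and artin_proj_gen: "s \<in> S \<Longrightarrow> artin_proj W (artin_gen W S s) = s"
proof -
  interpret W: group W
    using assms by (simp add: coxeter_system_def)
  have f: "(\<lambda>s. s) ` S \<subseteq> carrier W"
    using assms by (auto simp: coxeter_system_def)
  have inv: "s \<in> carrier W" "s \<otimes>\<^bsub>W\<^esub> s = \<one>\<^bsub>W\<^esub>" if "s \<in> S" for s
  proof -
    show s: "s \<in> carrier W"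
      using assms that by (auto simp: coxeter_system_def)
    have "W.ord s = 2"
      using assms that by (auto simp: coxeter_system_def)
    then show "s \<otimes>\<^bsub>W\<^esub> s = \<one>\<^bsub>W\<^esub>"
      using W.pow_ord_eq_1[OF s] s by (simp add: numeral_2_eq_2)
  qed
  have R: "eval_word W (\<lambda>s. s) u = eval_word W (\<lambda>s. s) v" if uv: "(u, v) \<in> braid_relations W S" for u v
  proof -
    obtain s t where st: "s \<in> S" "t \<in> S"
      and "u = alternating (W.ord (s \<otimes>\<^bsub>W\<^esub> t)) s t" "v = alternating (W.ord (s \<otimes>\<^bsub>W\<^esub> t)) t s"
      using uv by (auto simp: braid_relations_def)
    then show ?thesis
      using W.eval_word_braid[OF inv[OF st(1)] inv[OF st(2)]
          W.pow_ord_eq_1[OF W.m_closed[OF inv(1)[OF st(1)] inv(1)[OF st(2)]]]] by simp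
  qed
  show "artin_proj W \<in> hom (artin_group W S) W"
    unfolding artin_proj_def artin_group_def by (rule W.pres_lift_hom[OF f R])
  show "artin_proj W (artin_gen W S s) = s" if "s \<in> S"
    unfolding artin_proj_def artin_gen_def by (rule W.pres_lift_gen[OF f R that])
qed

definition interval :: "('a, 'b) monoid_scheme \<Rightarrow> 'a set \<Rightarrow> 'a \<Rightarrow> 'a set" where
  "interval W T c = {w \<in> carrier W. refl_prec W T w c}"

definition interval_relations ::
    "('a, 'b) monoid_scheme \<Rightarrow> 'a set \<Rightarrow> 'a \<Rightarrow> ('a word \<times> 'a word) set" where
  "interval_relations W T c =
    {([Pos p, Pos q], [Pos (p \<otimes>\<^bsub>W\<^esub> q)]) | p q.
      p \<in> interval W T c \<and> q \<in> interval W T c \<and> p \<otimes>\<^bsub>W\<^esub> q \<in> interval W T c \<and>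
      refl_length W T (p \<otimes>\<^bsub>W\<^esub> q) = refl_length W T p + refl_length W T q}"

definition interval_group ::
    "('a, 'b) monoid_scheme \<Rightarrow> 'a set \<Rightarrow> 'a \<Rightarrow> 'a word set monoid" where
  "interval_group W T c = presented_group (interval W T c) (interval_relations W T c)"

definition interval_gen ::
    "('a, 'b) monoid_scheme \<Rightarrow> 'a set \<Rightarrow> 'a \<Rightarrow> 'a \<Rightarrow> 'a word set" where
  "interval_gen W T c = pres_gen (interval W T c) (interval_relations W T c)"

end

theory Submission
  imports Defs "HOL-Library.Function_Algebras"
begin

text \<open>Both groups are compared on generators. In the direction \<open>B(W,S) \<rightarrow> G(P\<^sub>c)\<close> a braid relation
  follows from \<open>[u][p] = [u p u\<^sup>-\<^sup>1][u]\<close> for \<open>p \<prec> u \<prec> c\<close>, applied to \<open>u = s t\<close>.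

  For the inverse, the reflections are lifted to the Artin group without using the classification. A
  bipartite Coxeter element orients the Coxeter graph and so defines a skew form on the root space.
  Let \<open>\<beta> = x \<alpha>\<^sub>s\<close> be a positive root such that a root not orthogonal to \<open>\<beta>\<close> is an inversion of
  \<open>x\<close> exactly if its skew product with \<open>\<beta>\<close> is positive. Then the conjugate of the Artin generator
  \<open>s\<close> by the positive lift of \<open>x\<close> depends on \<open>\<beta>\<close> only. This defines a lift of the reflections
  which fixes the generators, commutes with restriction to standard parabolic subgroups, and is
  equivariant under conjugation by the Coxeter element, and also by the Coxeter element of each
  standard parabolic subgroup on the reflections of that subgroup.

  By induction on the rank, each shortest factorization of \<open>c\<close> into reflections lifts to a
  factorization of the Coxeter element of the Artin group: conjugation by a power of \<open>c\<close> makes the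
  last factor simple, and the remaining factors multiply to a Coxeter element of smaller rank.
  Hence the lift extends to \<open>P\<^sub>c\<close>.\<close>

text \<open>The bijection forces the image of a reflection that is written as the conjugate of a
  simple reflection by a power of \<open>c\<close>. Such an expression is not unique, and the
  obstacle is to show that all of them give one element of the Artin group. Indexing the lift by
  positive roots removes the choice. For a simply laced graph the skew form is, up to a scalar, the
  antisymmetrized Euler form of a quiver, and the calculus of sources imitates reflection functors:
  firing a source reverses its arrows, and the simple reflection carries one form to the other.
  Firing every vertex once shifts the height by a constant and leaves the form unchanged; this is
  the origin of the equivariance under the Coxeter element. Parabolic subgroups are carried along
  because the induction on the rank rotates by their Coxeter elements while the lift is defined in
  the whole group. A second obstacle is that \<open>T\<close> comes from an arbitrary faithful
  representation, which need not be the geometric one. Only after \<open>T\<close> has been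
  identified with the conjugates of \<open>S\<close> do root arguments apply to it; the finite order
  of the elements replaces an inner product there.\<close>

instantiation "fun" :: (type, real_vector) real_vector
begin

definition scaleR_fun :: "real \<Rightarrow> ('a \<Rightarrow> 'b) \<Rightarrow> 'a \<Rightarrow> 'b" where
  "scaleR_fun r f = (\<lambda>x. r *\<^sub>R f x)"

instance
  by standard (simp_all add: scaleR_fun_def fun_eq_iff scaleR_add_right scaleR_add_left)

end

lemma scaleR_fun_apply [simp]: "(r *\<^sub>R f) x = r *\<^sub>R f x"
  by (simp add: scaleR_fun_def)

subsection \<open>Word length in groups generated by involutions\<close>

lemma list_prod_simps [simp]:
  "list_prod G [] = \<one>\<^bsub>G\<^esub>"
  "list_prod G (x # xs) = x \<otimes>\<^bsub>G\<^esub> list_prod G xs"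
  by (simp_all add: list_prod_def)

fun alt_prod :: "('a, 'b) monoid_scheme \<Rightarrow> nat \<Rightarrow> 'a \<Rightarrow> 'a \<Rightarrow> 'a" where
  "alt_prod G 0 s t = \<one>\<^bsub>G\<^esub>"
| "alt_prod G (Suc n) s t = s \<otimes>\<^bsub>G\<^esub> alt_prod G n t s"

lemma eval_word_alternating: "eval_word G f (alternating n s t) = alt_prod G n (f s) (f t)"
  by (induction n arbitrary: s t) (simp_all add: eval_word_def)

context group
begin

lemma alt_prod_closed [simp, intro]:
  "s \<in> carrier G \<Longrightarrow> t \<in> carrier G \<Longrightarrow> alt_prod G n s t \<in> carrier G"
  by (induction n arbitrary: s t) auto

lemma alt_prod_add:
  assumes "s \<in> carrier G" "t \<in> carrier G"
  shows "alt_prod G (a + b) s t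
    = alt_prod G a s t \<otimes> (if even a then alt_prod G b s t else alt_prod G b t s)"
  using assms by (induction a arbitrary: s t) (auto simp: m_assoc)

lemma alt_prod_Suc_right:
  assumes "s \<in> carrier G" "t \<in> carrier G"
  shows "alt_prod G (Suc n) s t = alt_prod G n s t \<otimes> (if even n then s else t)"
  using alt_prod_add[OF assms, of n 1] assms by auto

lemma alt_prod_double:
  assumes "s \<in> carrier G" "t \<in> carrier G"
  shows "alt_prod G (2 * k) s t = (s \<otimes> t) [^] k"
proof (induction k)
  case (Suc k)
  have "alt_prod G (2 * Suc k) s t = (s \<otimes> t) \<otimes> alt_prod G (2 * k) s t"
    using assms by (simp add: m_assoc)
  then show ?case using assms Suc by (metis m_closed nat_pow_Suc2)
qed simp

lemma involution_inv: "x \<in> carrier G \<Longrightarrow> x \<otimes> x = \<one> \<Longrightarrow> inv x = x"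
  by (rule inv_equality)

lemma involution_cancel:
  assumes "x \<in> carrier G" "x \<otimes> x = \<one>" "y \<in> carrier G"
  shows "x \<otimes> (x \<otimes> y) = y" "y \<otimes> x \<otimes> x = y"
  using assms by (metis m_assoc l_one, metis m_assoc r_one)

lemma list_prod_conj:
  assumes "g \<in> carrier G" "set xs \<subseteq> carrier G"
  shows "list_prod G (map (\<lambda>x. g \<otimes> x \<otimes> inv g) xs) = g \<otimes> list_prod G xs \<otimes> inv g"
  using assms(2)
proof (induction xs)
  case Nil
  then show ?case using assms by simp
next
  case (Cons x xs)
  have c: "x \<in> carrier G" "list_prod G xs \<in> carrier G"
    using Cons.prems list_prod_closed by auto
  have "list_prod G (map (\<lambda>x. g \<otimes> x \<otimes> inv g) (x # xs))
    = (g \<otimes> x \<otimes> inv g) \<otimes> (g \<otimes> list_prod G xs \<otimes> inv g)"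
    using Cons by simp
  also have "\<dots> = g \<otimes> x \<otimes> (inv g \<otimes> g) \<otimes> list_prod G xs \<otimes> inv g"
    using c assms(1) by (simp only: m_assoc inv_closed m_closed)
  also have "\<dots> = g \<otimes> list_prod G (x # xs) \<otimes> inv g"
    using c assms(1) by (simp add: m_assoc)
  finally show ?case .
qed

lemma list_prod_conj':
  assumes "g \<in> carrier G" "set ts \<subseteq> carrier G"
  shows "list_prod G (map (\<lambda>t. inv g \<otimes> t \<otimes> g) ts) = inv g \<otimes> list_prod G ts \<otimes> g"
  using list_prod_conj[of "inv g" ts] assms by simp

lemma conj_by_commuting:
  assumes "l \<in> carrier G" "a \<in> carrier G" "t \<in> carrier G" "a \<otimes> t = t \<otimes> a"
  shows "(l \<otimes> a) \<otimes> t \<otimes> inv (l \<otimes> a) = l \<otimes> t \<otimes> inv l"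
proof -
  have "(l \<otimes> a) \<otimes> t \<otimes> inv (l \<otimes> a) = l \<otimes> (a \<otimes> t) \<otimes> inv a \<otimes> inv l"
    using assms(1-3) by (simp add: inv_mult_group m_assoc)
  also have "\<dots> = l \<otimes> t \<otimes> (a \<otimes> inv a) \<otimes> inv l"
    unfolding assms(4) using assms(1-3) by (simp only: m_assoc m_closed inv_closed)
  also have "\<dots> = l \<otimes> t \<otimes> inv l" using assms(1-3) by simp
  finally show ?thesis .
qed

lemma list_prod_in_generate: "set xs \<subseteq> generate G X \<Longrightarrow> list_prod G xs \<in> generate G X"
  by (induction xs) (auto intro: generate.intros)

end

text \<open>Used for two generating sets: \<open>S\<close>, where \<open>len\<close> is the Coxeter
  length, and the set of all reflections, where it is the reflection length. As the generators are
  involutions, words can do without inverses.\<close>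

locale involution_generated = group W for W (structure) +
  fixes X
  assumes X_carrier: "X \<subseteq> carrier W"
    and X_invol: "\<And>x. x \<in> X \<Longrightarrow> x \<otimes> x = \<one>"
    and X_generate: "generate W X = carrier W"
begin

abbreviation len where "len \<equiv> refl_length W X"

lemma X_closed [simp]: "x \<in> X \<Longrightarrow> x \<in> carrier W"
  using X_carrier by blast

lemma X_inv [simp]: "x \<in> X \<Longrightarrow> inv x = x"
  by (rule involution_inv) (simp_all add: X_invol)

lemma X_cancel [simp]:
  assumes "x \<in> X" "w \<in> carrier W"
  shows "x \<otimes> (x \<otimes> w) = w" "w \<otimes> x \<otimes> x = w"
  using involution_cancel[OF _ X_invol] assms by auto

lemma X_words_closed [simp]: "set xs \<subseteq> X \<Longrightarrow> list_prod W xs \<in> carrier W"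
  by (meson list_prod_closed order_trans X_carrier)

lemma X_words_append:
  "set xs \<subseteq> X \<Longrightarrow> set ys \<subseteq> X
    \<Longrightarrow> list_prod W (xs @ ys) = list_prod W xs \<otimes> list_prod W ys"
  using X_carrier by (intro list_prod_append) auto

lemma generate_words:
  assumes "Y \<subseteq> X" "w \<in> generate W Y"
  shows "\<exists>xs. set xs \<subseteq> Y \<and> list_prod W xs = w"
  using assms(2)
proof (induction rule: generate.induct)
  case one
  then show ?case by (intro exI[of _ "[]"]) simp
next
  case (incl h)
  then show ?case using assms by (intro exI[of _ "[h]"]) auto
next
  case (inv h)
  then show ?case using assms by (intro exI[of _ "[h]"]) auto
next
  case (eng h1 h2)
  then obtain a b where "set a \<subseteq> Y" "list_prod W a = h1" "set b \<subseteq> Y" "list_prod W b = h2"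
    by blast
  then show ?case using assms by (intro exI[of _ "a @ b"]) (simp add: X_words_append)
qed

lemma len_word:
  assumes "w \<in> carrier W"
  shows "\<exists>xs. set xs \<subseteq> X \<and> length xs = len w \<and> list_prod W xs = w"
proof -
  have "\<exists>n xs. set xs \<subseteq> X \<and> length xs = n \<and> list_prod W xs = w"
    using generate_words[of X w] X_generate assms by auto
  then show ?thesis unfolding refl_length_def by (rule LeastI_ex)
qed

lemma len_le: "set xs \<subseteq> X \<Longrightarrow> len (list_prod W xs) \<le> length xs"
  unfolding refl_length_def by (rule Least_le) blast

lemma len_mult:
  assumes "v \<in> carrier W" "w \<in> carrier W"
  shows "len (v \<otimes> w) \<le> len v + len w"
proof -
  obtain a b where "set a \<subseteq> X" "length a = len v" "list_prod W a = v"
    "set b \<subseteq> X" "length b = len w" "list_prod W b = w"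
    using len_word assms by meson
  then show ?thesis using len_le[of "a @ b"] by (simp add: X_words_append)
qed

lemma len_one [simp]: "len \<one> = 0"
  using len_le[of "[]"] by simp

lemma len_gen_le: "x \<in> X \<Longrightarrow> len x \<le> 1"
  using len_le[of "[x]"] by simp

lemma len_step:
  assumes "x \<in> X" "w \<in> carrier W"
  shows "len (w \<otimes> x) \<le> Suc (len w)" "len w \<le> Suc (len (w \<otimes> x))"
    "len (x \<otimes> w) \<le> Suc (len w)" "len w \<le> Suc (len (x \<otimes> w))"
  using assms len_mult[of w x] len_mult[of "w \<otimes> x" x] len_mult[of x w] len_mult[of x "x \<otimes> w"]
    len_gen_le[of x] by auto

lemma len_inv_le: "w \<in> carrier W \<Longrightarrow> len (inv w) \<le> len w"
proof -
  assume w: "w \<in> carrier W"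
  have *: "set xs \<subseteq> X \<Longrightarrow> inv (list_prod W xs) = list_prod W (rev xs)" for xs
    by (induction xs) (auto simp: X_words_append inv_mult_group)
  obtain xs where "set xs \<subseteq> X" "length xs = len w" "list_prod W xs = w"
    using len_word[OF w] by blast
  then show ?thesis using len_le[of "rev xs"] * by auto
qed

lemma len_inv: "w \<in> carrier W \<Longrightarrow> len (inv w) = len w"
  using len_inv_le[of w] len_inv_le[of "inv w"] by simp

lemma len_bounded: "finite (carrier W) \<Longrightarrow> \<exists>M. \<forall>w\<in>carrier W. len w \<le> M"
  by (meson finite_imageI finite_nat_set_iff_bounded_le image_eqI)

lemma len_last:
  assumes "w \<in> carrier W" "w \<noteq> \<one>"
  obtains x where "x \<in> X" "len (w \<otimes> x) < len w"
proof -
  obtain xs where xs: "set xs \<subseteq> X" "length xs = len w" "list_prod W xs = w"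
    using len_word[OF assms(1)] by blast
  have ne: "xs \<noteq> []" using xs assms by auto
  have sub: "set (butlast xs) \<subseteq> X" using xs by (meson in_set_butlastD subset_iff)
  have l: "last xs \<in> X" using ne xs by auto
  have "w = list_prod W (butlast xs) \<otimes> last xs"
    using X_words_append[of "butlast xs" "[last xs]"] ne xs sub l by simp
  then have "w \<otimes> last xs = list_prod W (butlast xs)"
    using sub l by simp
  then have "len (w \<otimes> last xs) < len w"
    using len_le[OF sub] xs ne by (cases xs) auto
  then show thesis using that l by blast
qed

text \<open>A shortest word is conjugated letter by letter. Applied to the set of all reflections,
  with \<open>g\<close> and with its inverse, this makes the reflection length a class
  function.\<close>

lemma len_conj_le:
  assumes g: "g \<in> carrier W" and X: "\<And>x. x \<in> X \<Longrightarrow> g \<otimes> x \<otimes> inv g \<in> X" and w: "w \<in> carrier W"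
  shows "len (g \<otimes> w \<otimes> inv g) \<le> len w"
proof -
  obtain xs where xs: "set xs \<subseteq> X" "length xs = len w" "list_prod W xs = w"
    using len_word[OF w] by blast
  have "list_prod W (map (\<lambda>x. g \<otimes> x \<otimes> inv g) xs) = g \<otimes> w \<otimes> inv g"
    using list_prod_conj[OF g, of xs] xs X_carrier by auto
  moreover have "set (map (\<lambda>x. g \<otimes> x \<otimes> inv g) xs) \<subseteq> X"
    using xs X by auto
  ultimately show ?thesis using len_le[of "map (\<lambda>x. g \<otimes> x \<otimes> inv g) xs"] xs(2) by simp
qed

end

subsection \<open>The geometric representation\<close>

lemma GL_simps [simp]:
  "f \<in> carrier GL \<longleftrightarrow> linear f \<and> bij f" "f \<otimes>\<^bsub>GL\<^esub> g = f \<circ> g" "\<one>\<^bsub>GL\<^esub> = id"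
  by (simp_all add: GL_def)

lemma linear_inv_bij:
  fixes f :: "'v::real_vector \<Rightarrow> 'v"
  assumes "linear f" "bij f"
  shows "linear (inv_into UNIV f)"
proof -
  have *: "f (inv_into UNIV f x) = x" for x
    using assms(2) by (simp add: bij_is_surj surj_f_inv_f)
  show ?thesis
    by (intro linearI; rule injD[OF bij_is_inj[OF assms(2)]])
      (simp_all add: * linear_add[OF assms(1)] linear_scale[OF assms(1)])
qed

lemma group_GL: "group (GL :: ('v::real_vector \<Rightarrow> 'v) monoid)"
proof (rule groupI)
  fix f :: "'v \<Rightarrow> 'v" assume f: "f \<in> carrier GL"
  then have "inv_into UNIV f \<circ> f = id" by (simp add: bij_is_inj)
  then show "\<exists>g\<in>carrier GL. g \<otimes>\<^bsub>GL\<^esub> f = \<one>\<^bsub>GL\<^esub>"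
    using f by (intro bexI[of _ "inv_into UNIV f"]) (auto simp: linear_inv_bij bij_imp_bij_inv)
qed (auto simp: linear_compose bij_comp comp_assoc linear_id)

definition nonneg :: "('a \<Rightarrow> real) \<Rightarrow> bool" where
  "nonneg v \<longleftrightarrow> (\<forall>x. 0 \<le> v x)"

text \<open>The geometric representation lives on all functions on the type of group elements, with
  the simple roots as unit vectors at the points of \<open>S\<close>. A type depending on
  \<open>S\<close> is thereby avoided; the action never changes a coordinate outside
  \<open>S\<close>.\<close>

definition simple_root :: "'a \<Rightarrow> 'a \<Rightarrow> real" where
  "simple_root s = (\<lambda>x. if x = s then 1 else 0)"

lemma simple_root_apply [simp]: "simple_root s x = (if x = s then 1 else 0)"
  by (simp add: simple_root_def)

lemma simple_root_eq [simp]: "simple_root s = simple_root t \<longleftrightarrow> s = t"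
  by (metis simple_root_apply zero_neq_one)

locale finite_coxeter = group W for W (structure) +
  fixes S
  assumes coxeter: "coxeter_system W S"
    and finite_W: "finite (carrier W)"
begin

lemma S_carrier: "S \<subseteq> carrier W"
  using coxeter by (simp add: coxeter_system_def)

lemma finite_S [simp]: "finite S"
  using S_carrier finite_W finite_subset by blast

lemma ord_S: "s \<in> S \<Longrightarrow> ord s = 2"
  using coxeter by (simp add: coxeter_system_def)

lemma S_square: assumes "s \<in> S" shows "s \<otimes> s = \<one>"
proof -
  have "s \<in> carrier W" using assms S_carrier by blast
  then show ?thesis using pow_ord_eq_1[of s] ord_S[OF assms] by (simp add: numeral_2_eq_2)
qed

lemma presentation_iso: "pres_lift W (\<lambda>s. s) \<in> iso (presented_group S (coxeter_relations W S)) W"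
  using coxeter by (simp add: coxeter_system_def)

lemma presentation_rel:
  assumes "(u, v) \<in> coxeter_relations W S"
  shows "eval_word W (\<lambda>s. s) u = eval_word W (\<lambda>s. s) v"
proof -
  obtain s t where st: "s \<in> S" "t \<in> S"
    and u: "u = concat (replicate (ord (s \<otimes> t)) [Pos s, Pos t])" and v: "v = []"
    using assms by (auto simp: coxeter_relations_def)
  have cl: "s \<in> carrier W" "t \<in> carrier W" using st S_carrier by auto
  have "eval_word W (\<lambda>s. s) (concat (replicate n [Pos s, Pos t])) = (s \<otimes> t) [^] n" for n :: nat
  proof (induction n)
    case (Suc n)
    then show ?case using cl
      by (subst nat_pow_Suc2) (simp_all add: eval_word_def m_assoc)
  qed (simp add: eval_word_def)
  then show ?thesis using u v cl by (simp add: pow_ord_eq_1) (simp add: eval_word_def)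
qed

lemma presentation_class:
  assumes "u \<in> words S"
  shows "pres_lift W (\<lambda>s. s) (pres_cong S (coxeter_relations W S) `` {u}) = eval_word W (\<lambda>s. s) u"
  by (rule pres_lift_class) (use S_carrier presentation_rel assms in auto)

lemma generate_S: "generate W S = carrier W"
proof
  show "generate W S \<subseteq> carrier W" using generate_incl[OF S_carrier] .
  show "carrier W \<subseteq> generate W S"
  proof
    fix w assume "w \<in> carrier W"
    then obtain A where A: "A \<in> carrier (presented_group S (coxeter_relations W S))"
      and w: "w = pres_lift W (\<lambda>s. s) A"
      using presentation_iso by (auto simp: iso_def bij_betw_def)
    then obtain u where u: "u \<in> words S" "A = pres_cong S (coxeter_relations W S) `` {u}"
      by (auto simp: presented_group_def elim: quotientE)
    have "set (map (eval_letter W (\<lambda>s. s)) u) \<subseteq> generate W S"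
    proof
      fix x assume "x \<in> set (map (eval_letter W (\<lambda>s. s)) u)"
      then obtain a where "a \<in> set u" "x = eval_letter W (\<lambda>s. s) a" by auto
      then have "letter_gen a \<in> S" "x = eval_letter W (\<lambda>s. s) a" using u(1) by (auto simp: words_def)
      then show "x \<in> generate W S"
        by (cases a) (auto intro: generate.incl generate.inv)
    qed
    then show "w \<in> generate W S"
      unfolding w u(2) presentation_class[OF u(1)] eval_word_def by (rule list_prod_in_generate)
  qed
qed

sublocale involution_generated W S
  by unfold_locales (use S_carrier S_square generate_S in auto)

text \<open>The universal property of the Coxeter presentation, moved to \<open>W\<close> itself:
  the inverse of the isomorphism in \<open>presentation_iso\<close>, followed by the lift of
  \<open>f\<close>.\<close>

lemma hom_extend:
  fixes G :: "('c, 'd) monoid_scheme"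
  assumes G: "group G" and f: "f ` S \<subseteq> carrier G"
    and rel: "\<And>s t. s \<in> S \<Longrightarrow> t \<in> S \<Longrightarrow> (f s \<otimes>\<^bsub>G\<^esub> f t) [^]\<^bsub>G\<^esub> ord (s \<otimes> t) = \<one>\<^bsub>G\<^esub>"
  obtains h where "h \<in> hom W G" "\<And>s. s \<in> S \<Longrightarrow> h s = f s"
proof -
  interpret G: group G by (rule G)
  let ?P = "presented_group S (coxeter_relations W S)"
  have R: "eval_word G f u = eval_word G f v" if uv: "(u, v) \<in> coxeter_relations W S" for u v
  proof -
    obtain s t where st: "s \<in> S" "t \<in> S"
      and u: "u = concat (replicate (ord (s \<otimes> t)) [Pos s, Pos t])" and v: "v = []"
      using uv by (auto simp: coxeter_relations_def)
    have cl: "f s \<in> carrier G" "f t \<in> carrier G" using st f by auto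
    have "eval_word G f (concat (replicate n [Pos s, Pos t])) = (f s \<otimes>\<^bsub>G\<^esub> f t) [^]\<^bsub>G\<^esub> n"
      for n :: nat
    proof (induction n)
      case (Suc n)
      then show ?case using cl
        by (subst G.nat_pow_Suc2) (simp_all add: eval_word_def G.m_assoc)
    qed (simp add: eval_word_def)
    then show ?thesis using u v rel[OF st] by simp (simp add: eval_word_def)
  qed
  let ?h = "pres_lift G f \<circ> inv_into (carrier ?P) (pres_lift W (\<lambda>s. s))"
  have "pres_lift G f \<in> hom ?P G" by (rule G.pres_lift_hom[OF f R])
  moreover have "inv_into (carrier ?P) (pres_lift W (\<lambda>s. s)) \<in> hom W ?P"
    using group.iso_set_sym[OF group_presented_group presentation_iso] by (simp add: iso_def)
  ultimately have "?h \<in> hom W G"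
    by (auto simp: hom_def Pi_iff)
  moreover have "?h s = f s" if s: "s \<in> S" for s
  proof -
    have g: "pres_gen S (coxeter_relations W S) s \<in> carrier ?P"
      by (rule pres_gen_closed[OF s])
    have "pres_lift W (\<lambda>s. s) (pres_gen S (coxeter_relations W S) s) = s"
      by (rule pres_lift_gen) (use S_carrier presentation_rel s in auto)
    then have "inv_into (carrier ?P) (pres_lift W (\<lambda>s. s)) s = pres_gen S (coxeter_relations W S) s"
      using presentation_iso g by (intro inv_into_f_eq) (auto simp: iso_def bij_betw_def)
    then show ?thesis using G.pres_lift_gen[OF f R s] by simp
  qed
  ultimately show thesis using that by blast
qed

text \<open>The Gram matrix of the Tits form, scaled so that simple roots have norm 1. The diagonal
  needs no clause of its own: \<open>s \<otimes> s\<close> has order 1, and \<open>- cos pi\<close>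
  is 1. Orders are positive because the group is finite, so no division by zero occurs.\<close>

definition cox_b :: "'a \<Rightarrow> 'a \<Rightarrow> real" where
  "cox_b s t = - cos (pi / real (ord (s \<otimes> t)))"

definition pair :: "'a \<Rightarrow> ('a \<Rightarrow> real) \<Rightarrow> real" where
  "pair s v = (\<Sum>t\<in>S. cox_b s t * v t)"

definition refl :: "'a \<Rightarrow> ('a \<Rightarrow> real) \<Rightarrow> 'a \<Rightarrow> real" where
  "refl s v = v - (2 * pair s v) *\<^sub>R simple_root s"

lemma ord_pos: "x \<in> carrier W \<Longrightarrow> ord x > 0"
  using ord_ge_1[OF finite_W] by fastforce

lemma ord_swap: assumes "s \<in> S" "t \<in> S" shows "ord (s \<otimes> t) = ord (t \<otimes> s)"
proof -
  have "inv (s \<otimes> t) = t \<otimes> s" using assms by (simp add: inv_mult_group)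
  then show ?thesis using ord_inv[of "s \<otimes> t"] assms by simp
qed

lemma ord_ge_2:
  assumes "s \<in> S" "t \<in> S" "s \<noteq> t"
  shows "2 \<le> ord (s \<otimes> t)"
proof -
  have "s \<otimes> t \<noteq> \<one>"
    using assms by (metis S_carrier X_cancel(2) X_closed l_one)
  then have "ord (s \<otimes> t) \<noteq> 1" using ord_eq_1[of "s \<otimes> t"] assms by auto
  then show ?thesis using ord_pos[of "s \<otimes> t"] assms by auto
qed

lemma cox_b_sym: "s \<in> S \<Longrightarrow> t \<in> S \<Longrightarrow> cox_b s t = cox_b t s"
  by (simp add: cox_b_def ord_swap)

lemma cox_b_diag [simp]: "s \<in> S \<Longrightarrow> cox_b s s = 1"
  by (simp add: cox_b_def S_square)

lemma cox_b_nonpos: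
  assumes "s \<in> S" "t \<in> S" "s \<noteq> t"
  shows "cox_b s t \<le> 0"
proof -
  have "real (ord (s \<otimes> t)) \<ge> 2" using ord_ge_2[OF assms] by simp
  then have "pi / real (ord (s \<otimes> t)) \<le> pi / 2" by (intro divide_left_mono) auto
  then have "cos (pi / real (ord (s \<otimes> t))) \<ge> 0"
    by (intro cos_ge_zero) (auto intro: order_trans[of _ 0])
  then show ?thesis by (simp add: cox_b_def)
qed

lemma S_commute_iff:
  assumes "s \<in> S" "t \<in> S"
  shows "s \<otimes> t = t \<otimes> s \<longleftrightarrow> (s \<otimes> t) [^] (2::nat) = \<one>"
proof -
  have "(s \<otimes> t) [^] (2::nat) = s \<otimes> t \<otimes> inv (t \<otimes> s)"
    using assms by (simp add: numeral_2_eq_2 inv_mult_group m_assoc)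
  also have "\<dots> = \<one> \<longleftrightarrow> s \<otimes> t = t \<otimes> s"
    using assms
    by (metis X_closed inv_closed inv_solve_right' l_one m_closed one_closed)
  finally show ?thesis by simp
qed

lemma cox_b_eq_0_iff:
  assumes "s \<in> S" "t \<in> S" "s \<noteq> t"
  shows "cox_b s t = 0 \<longleftrightarrow> s \<otimes> t = t \<otimes> s"
proof -
  let ?m = "ord (s \<otimes> t)"
  have m: "?m \<ge> 2" using ord_ge_2[OF assms] .
  have "cos (pi / real ?m) = 0 \<longleftrightarrow> ?m = 2"
  proof
    assume c: "cos (pi / real ?m) = 0"
    show "?m = 2"
    proof (rule ccontr)
      assume "?m \<noteq> 2"
      then have "pi / real ?m < pi / 2" using m by (intro divide_strict_left_mono) auto
      then have "cos (pi / real ?m) > 0"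
        by (intro cos_gt_zero_pi) (auto intro: less_le_trans[of _ 0])
      then show False using c by simp
    qed
  qed simp
  moreover have "?m = 2 \<longleftrightarrow> (s \<otimes> t) [^] (2::nat) = \<one>"
  proof
    assume "(s \<otimes> t) [^] (2::nat) = \<one>"
    then have "?m dvd 2" using assms pow_eq_id[of "s \<otimes> t" 2] by simp
    then show "?m = 2" using m by (auto dest: dvd_imp_le)
  next
    assume "?m = 2"
    then show "(s \<otimes> t) [^] (2::nat) = \<one>"
      using assms pow_ord_eq_1[of "s \<otimes> t"] by simp
  qed
  ultimately show ?thesis using S_commute_iff[OF assms(1,2)] by (simp add: cox_b_def)
qed

lemma linear_pair: "linear (pair s)"
  by (intro linearI) (simp_all add: pair_def distrib_left sum.distrib sum_distrib_left mult.left_commute)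

lemma pair_simps [simp]:
  "pair s (u + v) = pair s u + pair s v" "pair s (u - v) = pair s u - pair s v"
  "pair s (r *\<^sub>R v) = r * pair s v" "pair s (- v) = - pair s v" "pair s 0 = 0"
  using linear_add[OF linear_pair] linear_diff[OF linear_pair] linear_scale[OF linear_pair]
    linear_neg[OF linear_pair] linear_0[OF linear_pair] by auto

lemma pair_simple [simp]: "t \<in> S \<Longrightarrow> pair s (simple_root t) = cox_b s t"
  by (simp add: pair_def if_distrib sum.If_cases cong: if_cong)

lemma linear_refl: "linear (refl s)"
  by (intro linearI) (simp_all add: refl_def algebra_simps)

lemma refl_add: "refl s (u + v) = refl s u + refl s v"
  and refl_scale: "refl s (r *\<^sub>R v) = r *\<^sub>R refl s v"
  using linear_add[OF linear_refl] linear_scale[OF linear_refl] by auto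

lemma refl_refl: "s \<in> S \<Longrightarrow> refl s (refl s v) = v"
  by (simp add: refl_def fun_eq_iff)

lemma refl_self: "s \<in> S \<Longrightarrow> refl s (simple_root s) = - simple_root s"
  by (simp add: refl_def fun_eq_iff)

lemma bij_refl: "s \<in> S \<Longrightarrow> bij (refl s)"
  by (rule o_bij[of "refl s"]) (auto simp: refl_refl fun_eq_iff)

lemma refl_GL: "s \<in> S \<Longrightarrow> refl s \<in> carrier GL"
  using linear_refl bij_refl by simp

text \<open>The dihedral computation in the plane of two simple roots. For positive \<open>k\<close>
  the parity selects the root that does not belong to the last letter of the alternating product.
  The induction step is the recurrence for sines of multiples of an angle; the factor on the left
  avoids a division.\<close>

lemma alt_prod_refl:
  assumes "p \<in> S" "q \<in> S" "p \<noteq> q"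
  shows "sin (pi / real (ord (p \<otimes> q)))
      *\<^sub>R alt_prod GL k (refl p) (refl q) (simple_root (if odd k then q else p))
    = sin (real (Suc k) * (pi / real (ord (p \<otimes> q)))) *\<^sub>R simple_root p
      + sin (real k * (pi / real (ord (p \<otimes> q)))) *\<^sub>R simple_root q"
  using assms
proof (induction k arbitrary: p q)
  case 0
  then show ?case by simp
next
  case (Suc k)
  let ?t = "pi / real (ord (p \<otimes> q))" and ?o = "if odd k then p else q"
  have t: "pi / real (ord (q \<otimes> p)) = ?t"
    using ord_swap[OF Suc(2,3)] by simp
  have IH: "sin ?t *\<^sub>R alt_prod GL k (refl q) (refl p) (simple_root ?o)
    = sin (real (Suc k) * ?t) *\<^sub>R simple_root q + sin (real k * ?t) *\<^sub>R simple_root p"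
    using Suc(1)[OF Suc(3,2) not_sym[OF Suc(4)]] unfolding t .
  have q: "refl p (simple_root q) = simple_root q + (2 * cos ?t) *\<^sub>R simple_root p"
    using Suc(2-) by (simp add: refl_def cox_b_def)
  have "sin ?t *\<^sub>R alt_prod GL (Suc k) (refl p) (refl q) (simple_root ?o)
    = refl p (sin ?t *\<^sub>R alt_prod GL k (refl q) (refl p) (simple_root ?o))"
    by (simp add: refl_scale)
  also have "\<dots> = sin (real (Suc k) * ?t) *\<^sub>R (simple_root q + (2 * cos ?t) *\<^sub>R simple_root p)
      - sin (real k * ?t) *\<^sub>R simple_root p"
    unfolding IH refl_add refl_scale q refl_self[OF Suc(2)] by simp
  also have "\<dots> = (2 * cos ?t * sin (real (Suc k) * ?t) - sin (real k * ?t)) *\<^sub>R simple_root p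
      + sin (real (Suc k) * ?t) *\<^sub>R simple_root q"
    by (simp add: algebra_simps)
  also have "2 * cos ?t * sin (real (Suc k) * ?t) - sin (real k * ?t) = sin (real (Suc (Suc k)) * ?t)"
  proof -
    have "2 * cos a * sin b - sin (b - a) = sin (b + a)" for a b :: real
      by (simp add: sin_add sin_diff)
    from this[of ?t "real (Suc k) * ?t"] show ?thesis
      by (simp add: distrib_right add_divide_distrib)
  qed
  finally show ?case by (cases "odd k") simp_all
qed

lemma sin_angle_pos:
  assumes "p \<in> S" "q \<in> S" "p \<noteq> q"
  shows "sin (pi / real (ord (p \<otimes> q))) > 0"
proof -
  have "real (ord (p \<otimes> q)) \<ge> 2" using ord_ge_2[OF assms] by simp
  then have "pi / real (ord (p \<otimes> q)) < pi / 1" by (intro divide_strict_left_mono) auto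
  moreover have "pi / real (ord (p \<otimes> q)) > 0" using \<open>2 \<le> real _\<close> by auto
  ultimately show ?thesis by (intro sin_gt_zero) auto
qed

lemma refl_power_self:
  assumes "p \<in> S" "q \<in> S" "p \<noteq> q"
  shows "((refl p \<circ> refl q) ^^ ord (p \<otimes> q)) (simple_root p) = simple_root p"
proof -
  let ?m = "ord (p \<otimes> q)" and ?t = "pi / real (ord (p \<otimes> q))"
  have m: "?m > 0" using ord_ge_2[OF assms] by simp
  have "alt_prod GL (2 * k) (refl p) (refl q) = (refl p \<circ> refl q) ^^ k" for k
    by (induction k) (simp_all add: comp_assoc)
  then have "sin ?t *\<^sub>R ((refl p \<circ> refl q) ^^ ?m) (simple_root p)
    = sin (real (Suc (2 * ?m)) * ?t) *\<^sub>R simple_root p + sin (real (2 * ?m) * ?t) *\<^sub>R simple_root q"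
    using alt_prod_refl[OF assms, of "2 * ?m"] by simp
  moreover have "real (2 * ?m) * ?t = 2 * pi" "real (Suc (2 * ?m)) * ?t = ?t + 2 * pi"
    using m by (simp_all add: field_simps)
  ultimately have "sin ?t *\<^sub>R ((refl p \<circ> refl q) ^^ ?m) (simple_root p) = sin ?t *\<^sub>R simple_root p"
    by (simp add: sin_periodic)
  then show ?thesis using sin_angle_pos[OF assms] by simp
qed

text \<open>The two simple roots have a nonsingular Gram matrix, so every vector is a combination of
  them plus a vector orthogonal to both, which the product fixes. The roots themselves are treated
  by \<open>refl_power_self\<close>; for \<open>q\<close> it concerns the reversed product, whose
  powers are inverse to those wanted.\<close>

lemma refl_power:
  assumes "p \<in> S" "q \<in> S" "p \<noteq> q"
  shows "(refl p \<circ> refl q) ^^ ord (p \<otimes> q) = id"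
proof -
  let ?m = "ord (p \<otimes> q)" and ?f = "refl p \<circ> refl q" and ?g = "refl q \<circ> refl p"
  have fg: "(?f ^^ k) ((?g ^^ k) v) = v" for k v
  proof (induction k arbitrary: v)
    case (Suc k)
    have "(?f ^^ Suc k) ((?g ^^ Suc k) v) = (?f ^^ k) (?f (?g ((?g ^^ k) v)))"
      by (simp add: funpow_swap1)
    also have "?f (?g ((?g ^^ k) v)) = (?g ^^ k) v" using assms by (simp add: refl_refl)
    finally show ?case unfolding Suc.IH .
  qed simp
  have lin: "linear (?f ^^ k)" for k
  proof (induction k)
    case (Suc k)
    then have "linear (?f \<circ> (?f ^^ k))"
      by (rule linear_compose[OF _ linear_compose[OF linear_refl linear_refl]])
    then show ?case by (simp only: funpow.simps)
  qed (simp add: linear_id[unfolded id_def] id_def)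
  have p: "(?f ^^ ?m) (simple_root p) = simple_root p"
    by (rule refl_power_self[OF assms])
  have "(?g ^^ ?m) (simple_root q) = simple_root q"
    using refl_power_self[of q p] assms ord_swap[OF assms(1,2)] by simp
  then have q: "(?f ^^ ?m) (simple_root q) = simple_root q"
    using fg[of ?m "simple_root q"] by simp
  have fix0: "(?f ^^ k) v = v" if "pair p v = 0" "pair q v = 0" for k v
    using that by (induction k) (simp_all add: refl_def)
  show ?thesis
  proof
    fix v
    let ?b = "cox_b p q"
    have "?b\<^sup>2 \<noteq> 1"
    proof -
      have "?b\<^sup>2 = 1 - (sin (pi / real ?m))\<^sup>2" by (simp add: cox_b_def cos_squared_eq)
      then show ?thesis using sin_angle_pos[OF assms] by simp
    qed
    then have d: "1 - ?b\<^sup>2 \<noteq> 0" by simp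
    \<comment> \<open>Cramer's rule for the coefficients that make \<open>u\<close> orthogonal to
      both roots; the determinant is a squared sine.\<close>
    define x where "x = (pair p v - ?b * pair q v) / (1 - ?b\<^sup>2)"
    define y where "y = (pair q v - ?b * pair p v) / (1 - ?b\<^sup>2)"
    define u where "u = v - x *\<^sub>R simple_root p - y *\<^sub>R simple_root q"
    have solve: "(P - ?b * Q) / (1 - ?b\<^sup>2) + ?b * ((Q - ?b * P) / (1 - ?b\<^sup>2)) = P" for P Q
    proof -
      have "(P - ?b * Q) + ?b * (Q - ?b * P) = P * (1 - ?b\<^sup>2)"
        by (simp add: algebra_simps power2_eq_square)
      then show ?thesis using d by (simp flip: add_divide_distrib)
    qed
    have "x + ?b * y = pair p v" "?b * x + y = pair q v"
      using solve[of "pair p v" "pair q v"] solve[of "pair q v" "pair p v"]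
      unfolding x_def y_def by (simp_all add: add.commute)
    then have "pair p u = 0" "pair q u = 0"
      using assms by (simp_all add: u_def cox_b_sym[of q p] algebra_simps)
    then have u: "(?f ^^ ?m) u = u" by (rule fix0)
    have v: "v = u + x *\<^sub>R simple_root p + y *\<^sub>R simple_root q" by (simp add: u_def)
    show "(?f ^^ ?m) v = id v"
      by (simp only: v linear_add[OF lin] linear_scale[OF lin] p q u id_apply)
  qed
qed

lemma GL_pow: "f [^]\<^bsub>GL\<^esub> (n::nat) = f ^^ n"
  by (induction n) (simp_all add: funpow_swap1 fun_eq_iff)

lemma ex_action:
  "\<exists>\<sigma>. \<sigma> \<in> hom W (GL :: (('a \<Rightarrow> real) \<Rightarrow> 'a \<Rightarrow> real) monoid) \<and> (\<forall>s\<in>S. \<sigma> s = refl s)"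
proof (rule hom_extend[of "GL :: (('a \<Rightarrow> real) \<Rightarrow> 'a \<Rightarrow> real) monoid" refl])
  show "refl ` S \<subseteq> carrier GL" using refl_GL by blast
  fix s t assume st: "s \<in> S" "t \<in> S"
  show "(refl s \<otimes>\<^bsub>GL\<^esub> refl t) [^]\<^bsub>GL\<^esub> ord (s \<otimes> t) = \<one>\<^bsub>GL\<^esub>"
  proof (cases "s = t")
    case True
    then have "refl s \<circ> refl t = id" using st by (auto simp: fun_eq_iff refl_refl)
    then have "(refl s \<circ> refl t) ^^ n = id" for n by (induction n) auto
    then show ?thesis by (simp add: GL_pow)
  qed (use refl_power st in \<open>simp add: GL_pow\<close>)
qed (use group_GL in auto)

definition act :: "'a \<Rightarrow> ('a \<Rightarrow> real) \<Rightarrow> 'a \<Rightarrow> real" where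
  "act = (SOME \<sigma>. \<sigma> \<in> hom W GL \<and> (\<forall>s\<in>S. \<sigma> s = refl s))"

lemma act_hom: "act \<in> hom W GL" and act_S: "s \<in> S \<Longrightarrow> act s = refl s"
  using someI_ex[OF ex_action] unfolding act_def by auto

lemma act_mult: "x \<in> carrier W \<Longrightarrow> y \<in> carrier W \<Longrightarrow> act (x \<otimes> y) v = act x (act y v)"
  using hom_mult[OF act_hom] by simp

lemma act_one [simp]: "act \<one> v = v"
  using hom_one[OF act_hom is_group group_GL] by simp

lemma linear_act: "x \<in> carrier W \<Longrightarrow> linear (act x)"
  using act_hom by (auto simp: hom_def Pi_iff)

lemma act_simps:
  assumes "x \<in> carrier W"
  shows "act x (u + v) = act x u + act x v" "act x (u - v) = act x u - act x v"
    "act x (r *\<^sub>R v) = r *\<^sub>R act x v" "act x (- v) = - act x v" "act x 0 = 0"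
    "act x (\<Sum>i\<in>A. f i) = (\<Sum>i\<in>A. act x (f i))"
  using linear_act[OF assms] by (simp_all add: linear_add linear_diff linear_scale linear_neg linear_0 linear_sum)

lemma act_inv [simp]:
  assumes "x \<in> carrier W"
  shows "act (inv x) (act x v) = v" "act x (act (inv x) v) = v"
  using assms by (simp_all flip: act_mult)

lemma act_simple_self: "s \<in> S \<Longrightarrow> act s (simple_root s) = - simple_root s"
  by (simp add: act_S refl_self)

lemma act_alt_prod:
  assumes "s \<in> S" "t \<in> S"
  shows "act (alt_prod W k s t) = alt_prod GL k (refl s) (refl t)"
  using assms
proof (induction k arbitrary: s t)
  case (Suc k)
  show ?case
  proof
    fix v
    show "act (alt_prod W (Suc k) s t) v = alt_prod GL (Suc k) (refl s) (refl t) v"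
      using Suc.prems Suc.IH[of t s] by (simp add: act_mult act_S)
  qed
qed (auto simp: fun_eq_iff)

end

subsection \<open>Positive and negative roots\<close>

lemma nonneg_add: "nonneg u \<Longrightarrow> nonneg v \<Longrightarrow> nonneg (u + v)"
  by (simp add: nonneg_def)

lemma nonneg_scale: "0 \<le> r \<Longrightarrow> nonneg v \<Longrightarrow> nonneg (r *\<^sub>R v)"
  by (simp add: nonneg_def)

lemma nonneg_scale_cancel: "0 < r \<Longrightarrow> nonneg (r *\<^sub>R v) \<Longrightarrow> nonneg v"
  by (simp add: nonneg_def zero_le_mult_iff)

lemma nonneg_sum: "(\<And>i. i \<in> A \<Longrightarrow> nonneg (f i)) \<Longrightarrow> nonneg (\<Sum>i\<in>A. f i)"
  by (induction A rule: infinite_finite_induct) (auto simp: nonneg_def)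

lemma nonneg_antisym: "nonneg v \<Longrightarrow> nonneg (- v) \<Longrightarrow> v = 0"
  by (auto simp: nonneg_def fun_eq_iff intro: antisym)

lemma nonneg_simple [simp]: "nonneg (simple_root s)"
  by (simp add: nonneg_def)

lemma simple_root_nonzero: "simple_root s \<noteq> 0"
  by (metis simple_root_apply zero_fun_apply zero_neq_one)

context finite_coxeter
begin

lemma braid_W:
  assumes "s \<in> S" "t \<in> S"
  shows "alt_prod W (ord (s \<otimes> t)) s t = alt_prod W (ord (s \<otimes> t)) t s"
  using eval_word_braid[of s t "ord (s \<otimes> t)"] assms
  by (simp add: S_square eval_word_alternating pow_ord_eq_1)

lemma len_alt_prod: "s \<in> S \<Longrightarrow> t \<in> S \<Longrightarrow> len (alt_prod W n s t) \<le> n"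
proof (induction n arbitrary: s t)
  case (Suc n)
  then show ?case
    using Suc.IH[of t s] len_step(3)[of s "alt_prod W n t s"] by force
qed simp

text \<open>Among the factorizations of \<open>w\<close> with adding lengths whose right factor is
  an alternating word in \<open>s\<close> and \<open>t\<close> ending in \<open>s\<close>, a longest
  one is taken. The letter \<open>p\<close> cannot shorten \<open>v\<close>, because
  \<open>w\<close> would be too short, and a letter \<open>q\<close> that shortens \<open>v\<close>
  could be moved into the alternating word; only at the full length
  \<open>ord (s \<otimes> t)\<close> is there no room for it.\<close>

lemma dihedral_chain:
  assumes w: "w \<in> carrier W" and s: "s \<in> S" and t: "t \<in> S" and st: "s \<noteq> t"
    and desc: "len (w \<otimes> s) < len w"
  obtains k v p q where "1 \<le> k" "k \<le> ord (s \<otimes> t)" "{p, q} = {s, t}" "v \<in> carrier W"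
    "w = v \<otimes> alt_prod W k p q" "len w = len v + k" "(if odd k then p else q) = s"
    "len v \<le> len (v \<otimes> p)" "k < ord (s \<otimes> t) \<Longrightarrow> len v \<le> len (v \<otimes> q)"
proof -
  let ?m = "ord (s \<otimes> t)"
  define P where "P k v p q \<longleftrightarrow> 1 \<le> k \<and> k \<le> ?m \<and> {p, q} = {s, t} \<and> v \<in> carrier W
    \<and> w = v \<otimes> alt_prod W k p q \<and> len w = len v + k \<and> (if odd k then p else q) = s" for k v p q
  have ws: "len w = len (w \<otimes> s) + 1" using len_step(2)[OF s w] desc by simp
  have "P 1 (w \<otimes> s) s t"
    using w s t ws ord_ge_2[OF s t st] by (simp add: P_def)
  then have ex: "\<exists>k v p q. P k v p q" by blast
  define k where "k = (GREATEST k. \<exists>v p q. P k v p q)"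
  have bd: "\<And>y. \<exists>v p q. P y v p q \<Longrightarrow> y \<le> ?m" by (auto simp: P_def)
  have "\<exists>v p q. P k v p q"
    unfolding k_def by (rule GreatestI_ex_nat[where b = ?m]) (use ex bd in auto)
  then obtain v p q where P: "P k v p q" by blast
  have max: "j \<le> k" if "P j v' p' q'" for j v' p' q'
    unfolding k_def by (rule Greatest_le_nat[where b = ?m]) (use that bd in auto)
  have pq: "p \<in> S" "q \<in> S" "v \<in> carrier W" "w = v \<otimes> alt_prod W k p q" "len w = len v + k" "1 \<le> k"
    using P s t by (auto simp: P_def doubleton_eq_iff)
  obtain j where j: "k = Suc j" using pq(6) by (cases k) auto
  have "w = (v \<otimes> p) \<otimes> alt_prod W j q p" using pq j by (simp add: m_assoc)
  then have "len w \<le> len (v \<otimes> p) + j"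
    using len_mult[of "v \<otimes> p" "alt_prod W j q p"] len_alt_prod[of q p j] pq by auto
  then have 1: "len v \<le> len (v \<otimes> p)" using pq(5) j by simp
  have 2: "len v \<le> len (v \<otimes> q)" if km: "k < ?m"
  proof (rule ccontr)
    assume "\<not> len v \<le> len (v \<otimes> q)"
    then have l: "len v = len (v \<otimes> q) + 1" using len_step(2)[OF pq(2,3)] by simp
    have "w = v \<otimes> q \<otimes> alt_prod W (Suc k) q p"
      using pq X_cancel(2)[OF pq(2,3)] by (simp flip: m_assoc)
    then have "P (Suc k) (v \<otimes> q) q p"
      using P km pq l by (auto simp: P_def insert_commute split: if_splits)
    then show False using max by fastforce
  qed
  show thesis using that[of k p q v] P 1 2 by (auto simp: P_def)
qed

text \<open>The sine formula expresses the image through the images of the two simple roots; below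
  the order of \<open>p \<otimes> q\<close> both angles stay between 0 and pi.\<close>

lemma dihedral_nonneg:
  assumes p: "p \<in> S" and q: "q \<in> S" and pq: "p \<noteq> q" and k: "k < ord (p \<otimes> q)" and v: "v \<in> carrier W"
    and np: "nonneg (act v (simple_root p))" and nq: "nonneg (act v (simple_root q))"
  shows "nonneg (act (v \<otimes> alt_prod W k p q) (simple_root (if odd k then q else p)))" (is "nonneg ?u")
proof -
  let ?m = "ord (p \<otimes> q)"
  let ?t = "pi / real ?m"
  have pos: "sin ?t > 0" using sin_angle_pos[OF p q pq] .
  have sin: "sin (real j * ?t) \<ge> 0" if "j \<le> ?m" for j
  proof -
    have m: "real ?m > 0" using k by simp
    have "real j * ?t \<le> real ?m * ?t" using that m by (intro mult_right_mono) auto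
    then have "real j * ?t \<le> pi" using m by simp
    then show ?thesis by (intro sin_ge_zero) auto
  qed
  have "sin ?t *\<^sub>R ?u
    = act v (sin ?t *\<^sub>R alt_prod GL k (refl p) (refl q) (simple_root (if odd k then q else p)))"
    using p q v by (simp only: act_mult alt_prod_closed X_closed act_alt_prod act_simps(3))
  also have "\<dots> = sin (real (Suc k) * ?t) *\<^sub>R act v (simple_root p)
      + sin (real k * ?t) *\<^sub>R act v (simple_root q)"
    unfolding alt_prod_refl[OF p q pq] using v by (simp only: act_simps)
  finally have "nonneg (sin ?t *\<^sub>R ?u)"
    using sin[of "Suc k"] sin[of k] k np nq by (simp only: nonneg_add nonneg_scale Suc_leI less_imp_le)
  then show ?thesis using nonneg_scale_cancel pos by blast
qed

text \<open>Induction on the length. A descent \<open>t\<close> of \<open>w\<close> differs from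
  \<open>s\<close>, and \<open>w\<close> is stripped of its dihedral part in \<open>s\<close> and
  \<open>t\<close>. The rest \<open>v\<close> is shorter and keeps both simple roots positive, which
  \<open>dihedral_nonneg\<close> carries back to \<open>w\<close>.\<close>

lemma act_nonneg:
  assumes "w \<in> carrier W" "s \<in> S" "len w \<le> len (w \<otimes> s)"
  shows "nonneg (act w (simple_root s))"
  using assms
proof (induction "len w" arbitrary: w s rule: less_induct)
  case less
  show ?case
  proof (cases "w = \<one>")
    case False
    then obtain t where t: "t \<in> S" "len (w \<otimes> t) < len w"
      using len_last less.prems(1) by blast
    then have ts: "t \<noteq> s" using less.prems by auto
    from dihedral_chain[OF less.prems(1) t(1) less.prems(2) ts t(2)]
    obtain k v p q where c: "1 \<le> k" "k \<le> ord (t \<otimes> s)" "{p, q} = {t, s}" "v \<in> carrier W"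
      "w = v \<otimes> alt_prod W k p q" "len w = len v + k" "(if odd k then p else q) = t"
      "len v \<le> len (v \<otimes> p)" "k < ord (t \<otimes> s) \<Longrightarrow> len v \<le> len (v \<otimes> q)" by metis
    have pq: "p \<in> S" "q \<in> S" "p \<noteq> q" using c(3) t less.prems ts by (auto simp: doubleton_eq_iff)
    have m: "ord (p \<otimes> q) = ord (t \<otimes> s)"
      using c(3) ord_swap[OF t(1) less.prems(2)] by (auto simp: doubleton_eq_iff)
    have o: "(if odd k then q else p) = s" using c(3,7) ts by (auto simp: doubleton_eq_iff)
    \<comment> \<open>At full length the braid relation rewrites the alternating word so that it
      ends in \<open>s\<close>, and \<open>s\<close> would shorten \<open>w\<close>.\<close>
    have "k \<noteq> ord (t \<otimes> s)"
    proof
      assume k: "k = ord (t \<otimes> s)"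
      obtain j where j: "k = Suc j" using c(1) by (cases k) auto
      have s_in: "s \<in> carrier W" using less.prems(2) by simp
      have "w = v \<otimes> alt_prod W (Suc j) q p"
        using c(5) k j braid_W[OF pq(1,2)] m by metis
      also have "\<dots> = v \<otimes> alt_prod W j q p \<otimes> s"
        unfolding alt_prod_Suc_right[OF X_closed[OF pq(2)] X_closed[OF pq(1)]]
        using o j c(4) pq s_in by (simp add: m_assoc)
      finally have "w \<otimes> s = v \<otimes> alt_prod W j q p"
        using less.prems c(4) pq by simp
      then have "len (w \<otimes> s) \<le> len v + j"
        using len_mult[of v "alt_prod W j q p"] len_alt_prod[of q p j] pq c(4) by auto
      then show False using c(6) j less.prems(3) by simp
    qed
    then have k: "k < ord (t \<otimes> s)" using c(2) by simp
    have "nonneg (act v (simple_root p))" "nonneg (act v (simple_root q))"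
      using less.hyps[of v] c pq k by auto
    from dihedral_nonneg[OF pq _ c(4) this, of k] show ?thesis
      using k m o c(5) by simp
  qed simp
qed

lemma act_nonpos:
  assumes "w \<in> carrier W" "s \<in> S" "len (w \<otimes> s) \<le> len w"
  shows "nonneg (- act w (simple_root s))"
proof -
  have "nonneg (act (w \<otimes> s) (simple_root s))"
    using assms by (intro act_nonneg) auto
  then show ?thesis using assms by (simp add: act_mult act_simple_self act_simps)
qed

lemma act_nonzero: "w \<in> carrier W \<Longrightarrow> v \<noteq> 0 \<Longrightarrow> act w v \<noteq> 0"
  by (metis act_inv(1) act_simps(5) inv_closed)

lemma len_lt_iff:
  assumes "w \<in> carrier W" "s \<in> S"
  shows "len w < len (w \<otimes> s) \<longleftrightarrow> nonneg (act w (simple_root s))"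
    and "len (w \<otimes> s) < len w \<longleftrightarrow> nonneg (- act w (simple_root s))"
  using act_nonneg[OF assms] act_nonpos[OF assms] act_nonzero[OF assms(1) simple_root_nonzero[of s]]
    nonneg_antisym[of "act w (simple_root s)"]
  by (metis linorder_not_less nat_le_linear)+

lemma len_up:
  assumes "w \<in> carrier W" "s \<in> S" "nonneg (act w (simple_root s))"
  shows "len (w \<otimes> s) = Suc (len w)"
  using len_lt_iff(1)[OF assms(1,2)] len_step(1)[of s w] assms by simp

lemma len_down:
  assumes "w \<in> carrier W" "s \<in> S" "nonneg (- act w (simple_root s))"
  shows "len w = Suc (len (w \<otimes> s))"
  using len_lt_iff(2)[OF assms(1,2)] len_step(2)[of s w] assms by simp

lemma len_left: "w \<in> carrier W \<Longrightarrow> s \<in> S \<Longrightarrow> len (s \<otimes> w) = len (inv w \<otimes> s)"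
  using len_inv[of "s \<otimes> w"] by (simp add: inv_mult_group)

lemma len_up_left:
  assumes "w \<in> carrier W" "s \<in> S" "nonneg (act (inv w) (simple_root s))"
  shows "len (s \<otimes> w) = Suc (len w)"
  using len_up[of "inv w" s] assms by (simp add: len_left len_inv)

section \<open>Roots, supports and the invariant form\<close>

definition roots :: "('a \<Rightarrow> real) set" where
  "roots = {act w (simple_root s) |w s. w \<in> carrier W \<and> s \<in> S}"

definition coords :: "'a set \<Rightarrow> ('a \<Rightarrow> real) set" where
  "coords I = {v. \<forall>x. x \<notin> I \<longrightarrow> v x = 0}"

text \<open>Support in \<open>I\<close> is required instead of membership in the root system of the
  subgroup generated by \<open>I\<close>. That every such root comes from this subgroup follows from
  \<open>ex_good\<close> when \<open>I\<close> carries a height function.\<close>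

definition pos_roots :: "'a set \<Rightarrow> ('a \<Rightarrow> real) set" where
  "pos_roots I = {\<beta> \<in> roots. nonneg \<beta> \<and> \<beta> \<in> coords I}"

lemma simple_root_roots [simp, intro]: "s \<in> S \<Longrightarrow> simple_root s \<in> roots"
  unfolding roots_def by (metis (mono_tags, lifting) act_one mem_Collect_eq one_closed)

lemma act_roots: "w \<in> carrier W \<Longrightarrow> \<beta> \<in> roots \<Longrightarrow> act w \<beta> \<in> roots"
  unfolding roots_def by clarsimp (metis act_mult m_closed)

lemma uminus_roots: "\<beta> \<in> roots \<Longrightarrow> - \<beta> \<in> roots"
proof -
  assume "\<beta> \<in> roots"
  then obtain w s where ws: "w \<in> carrier W" "s \<in> S" "\<beta> = act w (simple_root s)"
    by (auto simp: roots_def)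
  then have "- \<beta> = act (w \<otimes> s) (simple_root s)"
    by (simp add: act_mult act_simple_self act_simps)
  moreover have "w \<otimes> s \<in> carrier W" using ws by simp
  ultimately show ?thesis using ws(2) unfolding roots_def
    by (intro CollectI exI[of _ "w \<otimes> s"] exI[of _ s]) simp
qed

lemma root_nonzero: "\<beta> \<in> roots \<Longrightarrow> \<beta> \<noteq> 0"
  by (auto simp: roots_def dest: act_nonzero[OF _ simple_root_nonzero])

lemma root_cases: "\<beta> \<in> roots \<Longrightarrow> nonneg \<beta> \<or> nonneg (- \<beta>)"
  unfolding roots_def using act_nonneg act_nonpos by clarsimp (metis nat_le_linear)

lemma root_not_both: "\<beta> \<in> roots \<Longrightarrow> nonneg (- \<beta>) \<longleftrightarrow> \<not> nonneg \<beta>"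
  using root_cases nonneg_antisym root_nonzero by blast

lemma act_apply: "s \<in> S \<Longrightarrow> act s v x = v x - (if x = s then 2 * pair s v else 0)"
  by (simp add: act_S refl_def)

lemma generate_closed: "I \<subseteq> S \<Longrightarrow> w \<in> generate W I \<Longrightarrow> w \<in> carrier W"
  using generate_incl[of I] S_carrier by blast

lemma act_generate_outside:
  assumes I: "I \<subseteq> S" and w: "w \<in> generate W I" and x: "x \<notin> I"
  shows "act w v x = v x"
proof -
  have "list_prod W ys \<in> carrier W \<and> act (list_prod W ys) v x = v x" if "set ys \<subseteq> I" for ys
    using that
  proof (induction ys)
    case (Cons a ys)
    then have a: "a \<in> S" "a \<in> I" "list_prod W ys \<in> carrier W" using I by auto
    then show ?case using Cons x by (auto simp: act_mult act_apply)
  qed simp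
  moreover obtain ys where "set ys \<subseteq> I" "list_prod W ys = w"
    using generate_words[OF I w] by blast
  ultimately show ?thesis by blast
qed

lemma act_coords:
  "I \<subseteq> S \<Longrightarrow> w \<in> generate W I \<Longrightarrow> v \<in> coords I \<Longrightarrow> act w v \<in> coords I"
  by (simp add: coords_def act_generate_outside)

lemma simple_root_coords [simp]: "simple_root s \<in> coords I \<longleftrightarrow> s \<in> I"
  by (auto simp: coords_def)

lemma coords_mono: "I \<subseteq> J \<Longrightarrow> coords I \<subseteq> coords J"
  by (auto simp: coords_def)

lemma roots_coords: "roots \<subseteq> coords S"
  using act_coords[of S] generate_S by (auto simp: roots_def)

lemma coords_expand: "I \<subseteq> S \<Longrightarrow> v \<in> coords I \<Longrightarrow> v = (\<Sum>s\<in>I. v s *\<^sub>R simple_root s)"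
proof
  fix x assume I: "I \<subseteq> S" and v: "v \<in> coords I"
  have fin: "finite I" using I finite_S finite_subset by blast
  have "(\<Sum>s\<in>A. v s *\<^sub>R simple_root s) x = (\<Sum>s\<in>A. (v s *\<^sub>R simple_root s) x)" for A
    by (induction A rule: infinite_finite_induct) auto
  then show "v x = (\<Sum>s\<in>I. v s *\<^sub>R simple_root s) x"
    using v fin by (simp add: coords_def if_distrib sum.delta' cong: if_cong)
qed

definition bil :: "('a \<Rightarrow> real) \<Rightarrow> ('a \<Rightarrow> real) \<Rightarrow> real" where
  "bil u v = (\<Sum>s\<in>S. u s * pair s v)"

lemma bil_sym: "bil u v = bil v u"
proof -
  have "bil u v = (\<Sum>s\<in>S. \<Sum>t\<in>S. u s * (cox_b s t * v t))"
    by (simp add: bil_def pair_def sum_distrib_left)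
  also have "\<dots> = (\<Sum>t\<in>S. \<Sum>s\<in>S. u s * (cox_b s t * v t))" by (rule sum.swap)
  also have "\<dots> = (\<Sum>t\<in>S. \<Sum>s\<in>S. v t * (cox_b t s * u s))"
    by (intro sum.cong) (auto simp: cox_b_sym)
  also have "\<dots> = bil v u" by (simp add: bil_def pair_def sum_distrib_left)
  finally show ?thesis .
qed

lemma bil_right [simp]:
  "bil u (v + w) = bil u v + bil u w" "bil u (v - w) = bil u v - bil u w"
  "bil u (r *\<^sub>R v) = r * bil u v" "bil u (- v) = - bil u v" "bil u 0 = 0"
  by (simp_all add: bil_def algebra_simps sum.distrib sum_subtractf sum_distrib_left sum_negf)

lemma bil_left [simp]:
  "bil (v + w) u = bil v u + bil w u" "bil (v - w) u = bil v u - bil w u"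
  "bil (r *\<^sub>R v) u = r * bil v u" "bil (- v) u = - bil v u" "bil 0 u = 0"
  by (simp_all add: bil_sym[of _ u])

lemma bil_simple [simp]: "s \<in> S \<Longrightarrow> bil (simple_root s) v = pair s v"
  by (simp add: bil_def if_distrib[of "\<lambda>x. x * _"] sum.delta' cong: if_cong)

lemma bil_simple_right [simp]: "s \<in> S \<Longrightarrow> bil v (simple_root s) = pair s v"
  by (simp add: bil_sym[of v])

lemma act_S_eq: "s \<in> S \<Longrightarrow> act s v = v - (2 * pair s v) *\<^sub>R simple_root s"
  by (simp add: act_S refl_def)

lemma bil_act:
  assumes "w \<in> carrier W"
  shows "bil (act w u) (act w v) = bil u v"
proof -
  have "bil (act (list_prod W ys) u) (act (list_prod W ys) v) = bil u v" if "set ys \<subseteq> S" for ys u v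
    using that
  proof (induction ys)
    case (Cons a ys)
    then have a: "a \<in> S" by simp
    have "bil (act a x) (act a y) = bil x y" for x y
      using a by (simp add: act_S_eq algebra_simps)
    then show ?case using Cons by (simp add: act_mult)
  qed simp
  then show ?thesis using len_word[OF assms] by blast
qed

lemma bil_root: "\<beta> \<in> roots \<Longrightarrow> bil \<beta> \<beta> = 1"
  by (auto simp: roots_def bil_act)

text \<open>The action of \<open>s\<close> changes the coordinate at \<open>s\<close> only. If the
  image were negative, all other coordinates would vanish, and a positive multiple of a simple root
  that has norm 1 is this simple root.\<close>

lemma act_simple_nonneg:
  assumes s: "s \<in> S" and b: "\<beta> \<in> roots" "nonneg \<beta>" "\<beta> \<noteq> simple_root s"
  shows "nonneg (act s \<beta>)"
proof (rule ccontr)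
  assume "\<not> nonneg (act s \<beta>)"
  then have "nonneg (- act s \<beta>)" using root_cases[OF act_roots[OF X_closed[OF s] b(1)]] by blast
  then have "\<beta> x = 0" if "x \<noteq> s" for x
    using that b(2) s act_apply[of s \<beta> x] by (auto simp: nonneg_def intro: antisym dest!: spec[of _ x])
  then have eq: "\<beta> = \<beta> s *\<^sub>R simple_root s" by (auto simp: fun_eq_iff)
  then have "bil \<beta> \<beta> = \<beta> s * \<beta> s" using s
    by (metis X_closed bil_left(3) bil_right(3) bil_simple cox_b_diag mult.right_neutral pair_simple)
  then have "\<beta> s * \<beta> s = 1" using bil_root[OF b(1)] by simp
  then have "\<beta> s = 1" using b(2) by (simp add: nonneg_def square_eq_1_iff) (metis neg_0_le_iff_le not_one_le_zero)
  then show False using eq b(3) by simp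
qed

lemma act_faithful:
  assumes w: "w \<in> carrier W" and "\<And>s. s \<in> S \<Longrightarrow> nonneg (act w (simple_root s))"
  shows "w = \<one>"
  using len_last[OF w] len_lt_iff(1)[OF w] assms(2) by (metis not_less_iff_gr_or_eq)

text \<open>If \<open>s\<close> is outside \<open>I\<close>, elements of the subgroup keep the
  coordinate at \<open>s\<close> of its simple root equal to 1, so this root cannot become
  negative.\<close>

lemma descent_in:
  assumes I: "I \<subseteq> S" and w: "w \<in> generate W I" and s: "s \<in> S" "\<not> nonneg (act w (simple_root s))"
  shows "s \<in> I"
proof (rule ccontr)
  assume "s \<notin> I"
  then have "act w (simple_root s) s = 1" using act_generate_outside[OF I w] by simp
  moreover have "nonneg (- act w (simple_root s))"
    using root_cases[OF act_roots[OF generate_closed[OF I w] simple_root_roots[OF s(1)]]] s by auto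
  ultimately show False by (auto simp: nonneg_def dest: spec[of _ s])
qed

lemma generate_descent:
  assumes I: "I \<subseteq> S" and w: "w \<in> generate W I" "w \<noteq> \<one>"
  obtains s where "s \<in> I" "\<not> nonneg (act w (simple_root s))"
  using act_faithful[OF generate_closed[OF I w(1)]] w(2) descent_in[OF I w(1)] by blast

text \<open>Averaging the standard inner product over the group gives an invariant definite form, for
  which a vector fixed by the reflections in \<open>I\<close> is orthogonal to \<open>coords I\<close>.\<close>

lemma fixed_coords_zero:
  assumes I: "I \<subseteq> S" and v: "v \<in> coords I" and fixed: "\<And>s. s \<in> I \<Longrightarrow> act s v = v"
  shows "v = 0"
proof -
  define inner where "inner u u' = (\<Sum>w\<in>carrier W. \<Sum>x\<in>S. act w u x * act w u' x)" for u u'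
  have inv: "inner (act g u) (act g u') = inner u u'" if g: "g \<in> carrier W" for g u u'
  proof -
    have "inner (act g u) (act g u') = (\<Sum>w\<in>carrier W. \<Sum>x\<in>S. act (w \<otimes> g) u x * act (w \<otimes> g) u' x)"
      unfolding inner_def using g by (intro sum.cong) (simp_all add: act_mult)
    also have "\<dots> = inner u u'"
      unfolding inner_def
      by (rule sum.reindex_bij_witness[of _ "\<lambda>w. w \<otimes> inv g" "\<lambda>w. w \<otimes> g"]) (simp_all add: g m_assoc)
    finally show ?thesis .
  qed
  have add: "inner (u + u') u'' = inner u u'' + inner u' u''" for u u' u''
    unfolding inner_def sum.distrib[symmetric]
    by (intro sum.cong) (simp_all only: act_simps plus_fun_apply distrib_right)
  have scale: "inner (r *\<^sub>R u) u' = r * inner u u'" for r u u'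
    unfolding inner_def sum_distrib_left
    by (intro sum.cong) (simp_all only: act_simps scaleR_fun_apply real_scaleR_def mult.assoc)
  have zero: "inner 0 u = 0" for u
    using scale[of 0 0 u] by (simp only: scaleR_zero_left mult_zero_left)
  have lin: "inner (\<Sum>i\<in>A. f i) u = (\<Sum>i\<in>A. inner (f i) u)" for A and f :: "'a \<Rightarrow> 'a \<Rightarrow> real" and u
  proof (induction A rule: infinite_finite_induct)
    case (insert a A)
    then show ?case
      unfolding sum.insert[OF insert(1,2)] add by simp
  qed (simp_all only: sum.infinite sum.empty zero simp_thms)
  have "inner (simple_root s) v = 0" if s: "s \<in> I" for s
  proof -
    have sS: "s \<in> S" using s I by blast
    have "inner (simple_root s) v = inner (act s (simple_root s)) (act s v)"
      using inv[of s] sS by simp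
    also have "\<dots> = - inner (simple_root s) v"
      using fixed[OF s] act_simple_self[OF sS] scale[of "-1" "simple_root s" v] by simp
    finally show ?thesis by simp
  qed
  then have "inner v v = 0"
    using coords_expand[OF I v] lin scale by (metis (no_types, lifting) mult_zero_right sum.neutral)
  \<comment> \<open>The summand of the identity element is the standard inner product.\<close>
  moreover have "(\<Sum>x\<in>S. (v x)\<^sup>2) \<le> inner v v"
  proof -
    have "(\<Sum>x\<in>S. act \<one> v x * act \<one> v x) \<le> inner v v"
      unfolding inner_def by (rule member_le_sum) (auto simp: finite_W intro: sum_nonneg)
    then show ?thesis by (simp add: power2_eq_square)
  qed
  ultimately have "(\<Sum>x\<in>S. (v x)\<^sup>2) = 0" by (simp add: antisym sum_nonneg)
  then have "\<forall>x\<in>S. v x = 0" by (subst (asm) sum_nonneg_eq_0_iff) auto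
  then show ?thesis using v I by (auto simp: coords_def fun_eq_iff)
qed

end

subsection \<open>Lifting reduced words\<close>

locale braid_target = finite_coxeter W S + A: group A
  for W (structure) and S :: "'a set" and A :: "('c, 'd) monoid_scheme" +
  fixes \<theta> :: "'a \<Rightarrow> 'c"
  assumes \<theta>_closed [simp]: "s \<in> S \<Longrightarrow> \<theta> s \<in> carrier A"
    and \<theta>_braid: "s \<in> S \<Longrightarrow> t \<in> S
      \<Longrightarrow> alt_prod A (ord (s \<otimes> t)) (\<theta> s) (\<theta> t) = alt_prod A (ord (s \<otimes> t)) (\<theta> t) (\<theta> s)"
begin

definition word_lift :: "'a list \<Rightarrow> 'c" where
  "word_lift xs = list_prod A (map \<theta> xs)"

definition reduced :: "'a list \<Rightarrow> bool" where
  "reduced xs \<longleftrightarrow> set xs \<subseteq> S \<and> length xs = len (list_prod W xs)"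

lemma word_lift_closed [simp]: "set xs \<subseteq> S \<Longrightarrow> word_lift xs \<in> carrier A"
  unfolding word_lift_def by (rule A.list_prod_closed) auto

lemma word_lift_append:
  "set xs \<subseteq> S \<Longrightarrow> set ys \<subseteq> S \<Longrightarrow> word_lift (xs @ ys) = word_lift xs \<otimes>\<^bsub>A\<^esub> word_lift ys"
  unfolding word_lift_def map_append by (rule A.list_prod_append) auto

lemma word_lift_snoc:
  "set xs \<subseteq> S \<Longrightarrow> s \<in> S \<Longrightarrow> word_lift (xs @ [s]) = word_lift xs \<otimes>\<^bsub>A\<^esub> \<theta> s"
  by (simp add: word_lift_append) (simp add: word_lift_def)

lemma ex_reduced: "w \<in> carrier W \<Longrightarrow> \<exists>xs. reduced xs \<and> list_prod W xs = w"
  using len_word unfolding reduced_def by metis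

lemma reduced_butlast:
  assumes "reduced (xs @ [s])"
  shows "reduced xs" "len (list_prod W (xs @ [s])) = Suc (len (list_prod W xs))"
    "list_prod W (xs @ [s]) \<otimes> s = list_prod W xs"
proof -
  have S: "set xs \<subseteq> S" "s \<in> S" and l: "Suc (length xs) = len (list_prod W xs \<otimes> s)"
    using assms by (auto simp: reduced_def X_words_append)
  have "len (list_prod W xs) \<le> length xs" using S by (intro len_le)
  moreover have "len (list_prod W xs \<otimes> s) \<le> Suc (len (list_prod W xs))"
    using S by (intro len_step) auto
  ultimately show "reduced xs" "len (list_prod W (xs @ [s])) = Suc (len (list_prod W xs))"
    "list_prod W (xs @ [s]) \<otimes> s = list_prod W xs"
    using S l by (auto simp: reduced_def X_words_append)
qed

fun alt_list :: "nat \<Rightarrow> 'a \<Rightarrow> 'a \<Rightarrow> 'a list" where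
  "alt_list 0 s t = []"
| "alt_list (Suc n) s t = s # alt_list n t s"

lemma set_alt_list: "set (alt_list n s t) \<subseteq> {s, t}"
  by (induction n arbitrary: s t) (simp, fastforce)

lemma alt_list_simps:
  "length (alt_list n s t) = n"
  "list_prod W (alt_list n s t) = alt_prod W n s t"
  "word_lift (alt_list n s t) = alt_prod A n (\<theta> s) (\<theta> t)"
  by (induction n arbitrary: s t) (auto simp: word_lift_def)

lemma alt_list_last:
  "n \<noteq> 0 \<Longrightarrow> \<exists>us. alt_list n s t = us @ [if odd n then s else t]"
proof (induction n arbitrary: s t)
  case (Suc n)
  show ?case
  proof (cases "n = 0")
    case False
    then obtain us where "alt_list n t s = us @ [if odd n then t else s]"
      using Suc.IH by blast
    then have "alt_list (Suc n) s t = (s # us) @ [if odd (Suc n) then s else t]" by simp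
    then show ?thesis by blast
  qed simp
qed simp

text \<open>If the alternating part were shorter than \<open>ord (s \<otimes> t)\<close>,
  \<open>dihedral_nonneg\<close> would keep the simple root of \<open>t\<close> positive under
  \<open>w\<close>, although \<open>t\<close> is a descent.\<close>

lemma dihedral_descents:
  assumes w: "w \<in> carrier W" and s: "s \<in> S" and t: "t \<in> S" and st: "s \<noteq> t"
    and desc: "len (w \<otimes> s) < len w" "len (w \<otimes> t) < len w"
  obtains v p q where "{p, q} = {s, t}" "v \<in> carrier W"
    "w = v \<otimes> alt_prod W (ord (s \<otimes> t)) p q" "len w = len v + ord (s \<otimes> t)"
    "(if odd (ord (s \<otimes> t)) then p else q) = s"
proof -
  from dihedral_chain[OF w s t st desc(1)]
  obtain k v p q where c: "1 \<le> k" "k \<le> ord (s \<otimes> t)" "{p, q} = {s, t}" "v \<in> carrier W"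
      "w = v \<otimes> alt_prod W k p q" "len w = len v + k" "(if odd k then p else q) = s"
      "len v \<le> len (v \<otimes> p)" "k < ord (s \<otimes> t) \<Longrightarrow> len v \<le> len (v \<otimes> q)" by metis
  have pq: "p \<in> S" "q \<in> S" "p \<noteq> q" using c(3) s t st by (auto simp: doubleton_eq_iff)
  have m: "ord (p \<otimes> q) = ord (s \<otimes> t)"
    using c(3) ord_swap[OF s t] by (auto simp: doubleton_eq_iff)
  have o: "(if odd k then q else p) = t" using c(3,7) st by (auto simp: doubleton_eq_iff)
  have "k = ord (s \<otimes> t)"
  proof (rule ccontr)
    assume "k \<noteq> ord (s \<otimes> t)"
    then have k: "k < ord (s \<otimes> t)" using c(2) by simp
    have "nonneg (act v (simple_root p))" "nonneg (act v (simple_root q))"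
      using act_nonneg c(4,8) c(9)[OF k] pq by auto
    from dihedral_nonneg[OF pq _ c(4) this, of k] have "nonneg (act w (simple_root t))"
      using k m o c(5) by simp
    then show False using len_lt_iff(1)[OF w t] desc(2) by simp
  qed
  then show thesis using that c by metis
qed

text \<open>The theorem of Matsumoto and Tits, by induction on the length. Words with the same last
  letter are shortened. If the last letters differ, both are descents, so the element ends in the
  longest element of their dihedral subgroup, whose two alternating words, equal under the lift by
  one braid relation, link the given words.\<close>

lemma reduced_word_lift_eq:
  "reduced xs \<Longrightarrow> reduced ys \<Longrightarrow> list_prod W xs = list_prod W ys \<Longrightarrow> word_lift xs = word_lift ys"
proof (induction "length xs" arbitrary: xs ys rule: less_induct)
  case less
  have l: "length xs = length ys" using less.prems by (simp add: reduced_def)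
  show ?case
  proof (cases "xs = []")
    case True
    then show ?thesis using l by simp
  next
    case False
    then obtain xs' s where xs: "xs = xs' @ [s]" by (metis rev_exhaust)
    obtain ys' t where ys: "ys = ys' @ [t]" using False l by (metis length_0_conv rev_exhaust)
    note rx = reduced_butlast[OF less.prems(1)[unfolded xs]]
      and ry = reduced_butlast[OF less.prems(2)[unfolded ys]]
    have S: "s \<in> S" "t \<in> S" "set xs' \<subseteq> S" "set ys' \<subseteq> S"
      using less.prems by (auto simp: reduced_def xs ys)
    have snoc_eq: "word_lift (us @ [a]) = word_lift (vs @ [a])"
      if "reduced (us @ [a])" "reduced (vs @ [a])" "length us < length xs"
        "list_prod W (us @ [a]) = list_prod W (vs @ [a])" for us vs a
    proof -
      have "word_lift us = word_lift vs"
        using that reduced_butlast[OF that(1)] reduced_butlast[OF that(2)]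
        by (intro less.hyps) simp_all
      then show ?thesis using that by (simp add: word_lift_snoc reduced_def)
    qed
    show ?thesis
    proof (cases "s = t")
      case True
      then show ?thesis using snoc_eq[of xs' s ys'] less.prems xs ys by simp
    next
      case st: False
      let ?w = "list_prod W xs" and ?m = "ord (s \<otimes> t)"
      have w: "?w \<in> carrier W" using S xs by simp
      have ws: "?w \<otimes> s = list_prod W xs'" "?w \<otimes> t = list_prod W ys'"
        using rx ry xs ys less.prems(3) by auto
      have "len (?w \<otimes> s) < len ?w" "len (?w \<otimes> t) < len ?w"
        using ws rx(2) ry(2) xs ys less.prems(3) by auto
      from dihedral_descents[OF w S(1,2) st this]
      obtain v p q where c: "{p, q} = {s, t}" "v \<in> carrier W" "?w = v \<otimes> alt_prod W ?m p q"
        "len ?w = len v + ?m" "(if odd ?m then p else q) = s" by metis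
      have pq: "p \<in> S" "q \<in> S" "p \<noteq> q" using c(1) S st by (auto simp: doubleton_eq_iff)
      have m: "ord (p \<otimes> q) = ?m"
        using c(1) ord_swap[OF S(1,2)] by (auto simp: doubleton_eq_iff)
      have o: "(if odd ?m then q else p) = t" using c(1,5) st by (auto simp: doubleton_eq_iff)
      have m0: "?m \<noteq> 0" using ord_ge_2[OF S(1,2) st] by simp
      obtain zs where zs: "reduced zs" "list_prod W zs = v" using ex_reduced c(2) by blast
      obtain us where us: "alt_list ?m p q = us @ [s]" using alt_list_last[OF m0, of p q] c(5) by auto
      obtain vs where vs: "alt_list ?m q p = vs @ [t]" using alt_list_last[OF m0, of q p] o by auto
      have S': "set zs \<subseteq> S" "set (alt_list ?m p q) \<subseteq> S" "set (alt_list ?m q p) \<subseteq> S"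
        using zs pq set_alt_list by (auto simp: reduced_def)
      have "list_prod W (zs @ alt_list ?m p q) = ?w" "list_prod W (zs @ alt_list ?m q p) = ?w"
        using S' zs c(3) braid_W[OF pq(1,2)] m by (simp_all add: X_words_append alt_list_simps)
      then have red: "reduced (zs @ alt_list ?m p q)" "reduced (zs @ alt_list ?m q p)"
          "list_prod W (zs @ alt_list ?m p q) = ?w" "list_prod W (zs @ alt_list ?m q p) = ?w"
        using S' zs c(4) by (auto simp: reduced_def alt_list_simps)
      have len: "length (zs @ alt_list ?m p q) = length xs" "length (zs @ alt_list ?m q p) = length xs"
        using red less.prems(1) by (auto simp: reduced_def)
      have "word_lift xs = word_lift (zs @ alt_list ?m p q)"
        using snoc_eq[of xs' s "zs @ us"] less.prems red us xs by simp
      also have "\<dots> = word_lift (zs @ alt_list ?m q p)"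
        using S' \<theta>_braid[OF pq(1,2)] m by (simp add: word_lift_append alt_list_simps)
      also have "\<dots> = word_lift ys"
        using snoc_eq[of "zs @ vs" t ys'] less.prems red vs ys len l by simp
      finally show ?thesis .
    qed
  qed
qed

text \<open>Not a homomorphism: by \<open>lift_mult\<close> it respects products whose lengths add.
  The chosen reduced word is immaterial by \<open>reduced_word_lift_eq\<close>.\<close>

definition lift :: "'a \<Rightarrow> 'c" where
  "lift w = word_lift (SOME xs. reduced xs \<and> list_prod W xs = w)"

lemma lift_eq:
  assumes "reduced xs"
  shows "lift (list_prod W xs) = word_lift xs"
proof -
  have "list_prod W xs \<in> carrier W" using assms by (simp add: reduced_def)
  from someI_ex[OF ex_reduced[OF this]] show ?thesis
    unfolding lift_def using reduced_word_lift_eq[OF _ assms] by blast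
qed

lemma lift_closed [simp]: "w \<in> carrier W \<Longrightarrow> lift w \<in> carrier A"
  using ex_reduced lift_eq word_lift_closed by (metis reduced_def)

lemma lift_one [simp]: "lift \<one> = \<one>\<^bsub>A\<^esub>"
  using lift_eq[of "[]"] by (simp add: reduced_def word_lift_def)

lemma lift_right:
  assumes w: "w \<in> carrier W" and s: "s \<in> S" and "nonneg (act w (simple_root s))"
  shows "lift (w \<otimes> s) = lift w \<otimes>\<^bsub>A\<^esub> \<theta> s"
proof -
  obtain xs where xs: "reduced xs" "list_prod W xs = w" using ex_reduced[OF w] by blast
  have "reduced (xs @ [s])"
    using xs s len_up[OF assms] by (simp add: reduced_def X_words_append)
  from lift_eq[OF this] show ?thesis
    using xs s lift_eq[OF xs(1)] by (simp add: reduced_def X_words_append word_lift_snoc)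
qed

lemma lift_mult:
  assumes "v \<in> carrier W" "w \<in> carrier W" "len (v \<otimes> w) = len v + len w"
  shows "lift (v \<otimes> w) = lift v \<otimes>\<^bsub>A\<^esub> lift w"
proof -
  obtain xs ys where xs: "reduced xs" "list_prod W xs = v" and ys: "reduced ys" "list_prod W ys = w"
    using ex_reduced assms by metis
  have "reduced (xs @ ys)" using xs ys assms by (simp add: reduced_def X_words_append)
  from lift_eq[OF this] show ?thesis
    using xs ys lift_eq[OF xs(1)] lift_eq[OF ys(1)]
    by (simp add: reduced_def X_words_append word_lift_append)
qed

lemma lift_S: "s \<in> S \<Longrightarrow> lift s = \<theta> s"
  using lift_right[of \<one> s] by simp

lemma len_S: "s \<in> S \<Longrightarrow> len s = 1"
  using len_up[of \<one> s] by simp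

lemma lift_left:
  assumes "w \<in> carrier W" "s \<in> S" "nonneg (act (inv w) (simple_root s))"
  shows "lift (s \<otimes> w) = \<theta> s \<otimes>\<^bsub>A\<^esub> lift w"
  using lift_mult[of s w] len_up_left[OF assms] assms by (simp add: len_S lift_S)

end

subsection \<open>Height functions and the order on reflections they induce\<close>

context finite_coxeter
begin

definition height_on :: "'a set \<Rightarrow> ('a \<Rightarrow> int) \<Rightarrow> bool" where
  "height_on I h \<longleftrightarrow> (\<forall>s\<in>I. \<forall>t\<in>I. s \<noteq> t \<and> cox_b s t \<noteq> 0 \<longrightarrow> \<bar>h s - h t\<bar> = 1)"

definition source :: "'a set \<Rightarrow> ('a \<Rightarrow> int) \<Rightarrow> 'a \<Rightarrow> bool" where
  "source I h s \<longleftrightarrow> s \<in> I \<and> (\<forall>t\<in>I. t \<noteq> s \<and> cox_b s t \<noteq> 0 \<longrightarrow> h t = h s + 1)"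

text \<open>The increment is 2 because a source lies one below its neighbours and becomes a sink one
  above them, so that differences along edges keep absolute value 1.\<close>

definition fire :: "('a \<Rightarrow> int) \<Rightarrow> 'a \<Rightarrow> 'a \<Rightarrow> int" where
  "fire h s = h(s := h s + 2)"

definition twist :: "('a \<Rightarrow> int) \<Rightarrow> ('a \<Rightarrow> real) \<Rightarrow> 'a \<Rightarrow> real" where
  "twist h v = (\<lambda>x. of_int (h x) * v x)"

text \<open>A height function orients the edges of the Coxeter graph; \<open>skew h\<close> is the skew form that
  takes the value \<open>\<plusminus> cox_b s t\<close> on two adjacent simple roots, with the sign given by the
  orientation.\<close>

definition skew :: "('a \<Rightarrow> int) \<Rightarrow> ('a \<Rightarrow> real) \<Rightarrow> ('a \<Rightarrow> real) \<Rightarrow> real" where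
  "skew h u v = bil (twist h u) v - bil u (twist h v)"

lemma twist_simps:
  "twist h (u + v) = twist h u + twist h v" "twist h (u - v) = twist h u - twist h v"
  "twist h (r *\<^sub>R v) = r *\<^sub>R twist h v" "twist h (- v) = - twist h v"
  "twist h (simple_root s) = of_int (h s) *\<^sub>R simple_root s"
  by (simp_all add: twist_def fun_eq_iff algebra_simps)

lemma skew_simps:
  "skew h (u + v) w = skew h u w + skew h v w" "skew h (u - v) w = skew h u w - skew h v w"
  "skew h (r *\<^sub>R u) w = r * skew h u w" "skew h (- u) w = - skew h u w"
  "skew h w (u + v) = skew h w u + skew h w v" "skew h w (u - v) = skew h w u - skew h w v"
  "skew h w (r *\<^sub>R u) = r * skew h w u" "skew h w (- u) = - skew h w u"
  by (simp_all add: skew_def twist_simps algebra_simps)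

lemma skew_swap: "skew h u v = - skew h v u"
  by (simp add: skew_def bil_sym)

lemma skew_self [simp]: "skew h u u = 0"
  by (simp add: skew_def bil_sym)

lemma skew_simple: "s \<in> S \<Longrightarrow> t \<in> S \<Longrightarrow>
    skew h (simple_root s) (simple_root t) = of_int (h s - h t) * cox_b s t"
  using cox_b_sym[of t s] by (simp add: skew_def twist_simps algebra_simps)

text \<open>All neighbours of a source are one higher, so the sum that defines the form is minus the
  off-diagonal part of \<open>pair s v\<close>. By \<open>pair_le\<close> it is nonnegative if
  \<open>v\<close> is; the later sign statements rest on this.\<close>

lemma skew_source:
  assumes I: "I \<subseteq> S" and s: "source I h s" and v: "v \<in> coords I"
  shows "skew h (simple_root s) v = v s - pair s v"
proof -
  have sS: "s \<in> S" using s I by (auto simp: source_def)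
  have "skew h (simple_root s) v = of_int (h s) * pair s v - pair s (twist h v)"
    using sS by (simp add: skew_def twist_simps)
  also have "\<dots> = (\<Sum>t\<in>S. of_int (h s - h t) * (cox_b s t * v t))"
    by (simp add: pair_def twist_def sum_distrib_left algebra_simps flip: sum_subtractf)
  also have "\<dots> = (\<Sum>t\<in>S. (if t = s then v s else 0) - cox_b s t * v t)"
  proof (intro sum.cong)
    fix t assume t: "t \<in> S"
    consider "t = s" | "t \<noteq> s" "cox_b s t = 0" | "t \<noteq> s" "v t = 0" | "t \<noteq> s" "h t = h s + 1"
      using s v by (auto simp: source_def coords_def)
    then show "of_int (h s - h t) * (cox_b s t * v t) = (if t = s then v s else 0) - cox_b s t * v t"
      by cases (use sS in auto)
  qed simp
  also have "\<dots> = v s - pair s v"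
    using sS by (simp add: sum_subtractf pair_def)
  finally show ?thesis .
qed

lemma pair_le:
  assumes s: "s \<in> S" and v: "nonneg v"
  shows "pair s v \<le> v s"
proof -
  have "pair s v = v s + (\<Sum>t\<in>S - {s}. cox_b s t * v t)"
    using s by (simp add: pair_def sum.remove[of S s])
  moreover have "(\<Sum>t\<in>S - {s}. cox_b s t * v t) \<le> 0"
    using v cox_b_nonpos[OF s] by (intro sum_nonpos) (auto simp: nonneg_def mult_nonpos_nonneg)
  ultimately show ?thesis by simp
qed

lemma skew_fire:
  assumes s: "s \<in> S"
  shows "skew (fire h s) u v = skew h u v + 2 * u s * pair s v - 2 * v s * pair s u"
proof -
  have "twist (fire h s) u = twist h u + (2 * u s) *\<^sub>R simple_root s" for u
    by (simp add: twist_def fire_def fun_eq_iff algebra_simps)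
  then show ?thesis using s by (simp add: skew_def)
qed

text \<open>The counterpart of a reflection functor: the simple reflection at a source is an
  isometry onto the skew form of the orientation with the arrows at \<open>s\<close>
  reversed.\<close>

lemma skew_fire_act:
  assumes I: "I \<subseteq> S" and s: "source I h s" and u: "u \<in> coords I" and v: "v \<in> coords I"
  shows "skew (fire h s) (act s u) (act s v) = skew h u v"
proof -
  have sS: "s \<in> S" using s I by (auto simp: source_def)
  have e: "skew h u (simple_root s) = pair s u - u s"
    using skew_swap[of h u "simple_root s"] skew_source[OF I s u] by simp
  then show ?thesis
    unfolding skew_fire[OF sS] act_S_eq[OF sS]
    using sS by (simp add: skew_simps skew_source[OF I s v] e algebra_simps)
qed

text \<open>Firing sequences: \<open>x\<close> is the product of the sources fired so far, and the
  last index is the current height function. The positivity condition makes each new letter lengthen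
  \<open>x\<close>, so that the sequence is a reduced word.\<close>

inductive reach :: "'a set \<Rightarrow> ('a \<Rightarrow> int) \<Rightarrow> 'a \<Rightarrow> ('a \<Rightarrow> int) \<Rightarrow> bool" for I h where
  reach_one: "reach I h \<one> h"
| reach_step: "reach I h x k \<Longrightarrow> source I k s \<Longrightarrow> nonneg (act x (simple_root s))
    \<Longrightarrow> reach I h (x \<otimes> s) (fire k s)"

lemma pos_roots_D:
  "\<beta> \<in> pos_roots I \<Longrightarrow> \<beta> \<in> roots" "\<beta> \<in> pos_roots I \<Longrightarrow> nonneg \<beta>"
  "\<beta> \<in> pos_roots I \<Longrightarrow> \<beta> \<in> coords I"
  by (auto simp: pos_roots_def)

lemma simple_pos_roots: "s \<in> I \<Longrightarrow> I \<subseteq> S \<Longrightarrow> simple_root s \<in> pos_roots I"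
  by (auto simp: pos_roots_def)

lemma height_fire:
  assumes h: "height_on I h" and I: "I \<subseteq> S" and s: "source I h s"
  shows "height_on I (fire h s)"
proof -
  have "\<bar>fire h s a - fire h s b\<bar> = 1" if ab: "a \<in> I" "b \<in> I" "a \<noteq> b" "cox_b a b \<noteq> 0" for a b
  proof -
    have "cox_b b a \<noteq> 0" using ab I cox_b_sym[of a b] by (metis subsetD)
    then have "a = s \<Longrightarrow> h b = h s + 1" "b = s \<Longrightarrow> h a = h s + 1"
      using s ab by (auto simp: source_def)
    moreover have "\<bar>h a - h b\<bar> = 1" using h ab by (auto simp: height_on_def)
    ultimately show ?thesis using ab(3) by (auto simp: fire_def)
  qed
  then show ?thesis by (auto simp: height_on_def)
qed

lemma reach_generate:
  assumes I: "I \<subseteq> S" and r: "reach I h x k"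
  shows "x \<in> generate W I"
  using r by induction (auto simp: source_def intro: generate.intros)

lemma reach_height: "reach I h x k \<Longrightarrow> I \<subseteq> S \<Longrightarrow> height_on I h \<Longrightarrow> height_on I k"
  by (induction rule: reach.induct) (auto intro: height_fire)

lemma reach_skew:
  assumes I: "I \<subseteq> S" and r: "reach I h x k" and u: "u \<in> coords I" and v: "v \<in> coords I"
  shows "skew h (act x u) (act x v) = skew k u v"
  using r u v
proof (induction arbitrary: u v)
  case (reach_step x k s)
  have s: "s \<in> S" "s \<in> generate W I"
    using reach_step I by (auto simp: source_def intro: generate.incl)
  have x: "x \<in> carrier W" using reach_generate[OF I reach_step(1)] generate_closed I by blast
  have c: "act s u \<in> coords I" "act s v \<in> coords I"
    using act_coords[OF I s(2)] reach_step by auto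
  have "skew h (act (x \<otimes> s) u) (act (x \<otimes> s) v) = skew k (act s u) (act s v)"
    using reach_step.IH[OF c] x s by (simp add: act_mult)
  also have "\<dots> = skew (fire k s) (act s (act s u)) (act s (act s v))"
    using skew_fire_act[OF I reach_step(2) c] by simp
  finally show ?case using s(1) by (simp add: S_square flip: act_mult)
qed simp

lemma act_simple_neg:
  assumes "s \<in> S" "\<beta> \<in> roots" "nonneg \<beta>" "\<not> nonneg (act s \<beta>)"
  shows "\<beta> = simple_root s"
  using act_simple_nonneg assms by blast

lemma act_sign_change:
  assumes s: "s \<in> S" and b: "\<beta> \<in> roots" and ne: "\<beta> \<noteq> simple_root s" "\<beta> \<noteq> - simple_root s"
  shows "nonneg (act s \<beta>) \<longleftrightarrow> nonneg \<beta>"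
proof -
  have "nonneg (act s \<beta>)" if "nonneg \<beta>" using act_simple_nonneg[OF s b that ne(1)] .
  moreover have "nonneg (- act s \<beta>)" if "nonneg (- \<beta>)"
  proof -
    have "- \<beta> \<noteq> simple_root s" using ne(2) by (metis minus_minus)
    from act_simple_nonneg[OF s uminus_roots[OF b] that this] show ?thesis
      using s by (simp add: act_simps)
  qed
  ultimately show ?thesis
    using root_not_both[OF b] root_not_both[OF act_roots[OF X_closed[OF s] b]] by blast
qed

lemma act_inv_step: "x \<in> carrier W \<Longrightarrow> s \<in> S \<Longrightarrow> act (inv (x \<otimes> s)) v = act s (act (inv x) v)"
  by (simp add: inv_mult_group act_mult)

text \<open>The skew form detects the order in which roots become inversions:
  \<open>\<gamma>\<close> has been inverted by \<open>x\<close>, and \<open>\<delta>\<close> has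
  not. At the moment when \<open>\<gamma>\<close> is inverted it is the image of the simple root of
  the fired source, and \<open>reach_skew\<close> reduces the claim to \<open>skew_source\<close>
  and \<open>pair_le\<close>.\<close>

lemma reach_order:
  assumes I: "I \<subseteq> S" and r: "reach I h x k"
    and g: "\<gamma> \<in> pos_roots I" "nonneg (- act (inv x) \<gamma>)"
    and d: "\<delta> \<in> pos_roots I" "nonneg (act (inv x) \<delta>)"
  shows "0 \<le> skew h \<gamma> \<delta> \<and> (skew h \<gamma> \<delta> = 0 \<longrightarrow> bil \<gamma> \<delta> = 0)"
  using r g d
proof (induction)
  case reach_one
  then show ?case
    using root_not_both[OF pos_roots_D(1)] pos_roots_D(2) by (metis act_one inv_one)
next
  case (reach_step x k s)
  have s: "s \<in> S" "s \<in> generate W I"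
    using reach_step I by (auto simp: source_def intro: generate.incl)
  have xI: "x \<in> generate W I" using reach_generate[OF I reach_step(1)] .
  then have x: "x \<in> carrier W" using generate_closed I by blast
  have xI': "inv x \<in> generate W I" using xI I S_carrier generate_m_inv_closed by (meson order_trans)
  let ?g = "act (inv x) \<gamma>" and ?d = "act (inv x) \<delta>"
  have gr: "?g \<in> roots" and dr: "?d \<in> roots"
    using act_roots x reach_step.prems by (auto simp: pos_roots_def)
  have sg: "nonneg (- act s ?g)" and sd: "nonneg (act s ?d)"
    using reach_step.prems by (simp_all only: act_inv_step[OF x s(1)])
  \<comment> \<open>Inverted roots stay inverted: a root that \<open>s\<close> makes positive again
    would be the negative of the image of the simple root of \<open>s\<close> under
    \<open>x\<close>, and that image is positive.\<close>
  have dpos: "nonneg ?d"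
  proof (rule ccontr)
    assume n: "\<not> nonneg ?d"
    have "\<not> nonneg (act s (- ?d))"
      using sd root_not_both[OF act_roots[OF X_closed[OF s(1)] dr]] s by (simp add: act_simps)
    moreover have "nonneg (- ?d)" using n root_cases[OF dr] by blast
    ultimately have "- ?d = simple_root s"
      using act_simple_neg[OF s(1) uminus_roots[OF dr]] by blast
    then have "act x (simple_root s) = - \<delta>" using x by (metis act_inv(2) act_simps(4))
    then have "nonneg (- \<delta>)" using reach_step.hyps(3) by simp
    then show False using reach_step.prems(3) root_not_both by (auto simp: pos_roots_def)
  qed
  show ?case
  proof (cases "nonneg (- ?g)")
    case True
    then show ?thesis using reach_step.IH reach_step.prems dpos by blast
  next
    case False
    then have "nonneg ?g" using root_cases[OF gr] by blast
    moreover have "\<not> nonneg (act s ?g)"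
      using sg root_not_both[OF act_roots[OF X_closed[OF s(1)] gr]] by blast
    ultimately have gs: "?g = simple_root s" using act_simple_neg[OF s(1) gr] by blast
    have dI: "?d \<in> coords I" using act_coords[OF I xI'] reach_step.prems by (auto simp: pos_roots_def)
    have sI: "simple_root s \<in> coords I" using reach_step(2) by (simp add: source_def)
    have gx: "\<gamma> = act x (simple_root s)" and dx: "\<delta> = act x ?d"
      using gs x by (metis act_inv(2))+
    have sk: "skew h \<gamma> \<delta> = ?d s - pair s ?d"
      using reach_skew[OF I reach_step(1) sI dI] skew_source[OF I reach_step(2) dI] gx dx by simp
    have bl: "bil \<gamma> \<delta> = pair s ?d"
      using bil_act[OF x, of "simple_root s" ?d] gx dx s(1) by simp
    \<comment> \<open>If the skew product vanishes, \<open>s\<close> negates the coordinate of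
      \<open>?d\<close> at \<open>s\<close>; both values are nonnegative, hence zero.\<close>
    have "pair s ?d = 0" if "skew h \<gamma> \<delta> = 0"
    proof -
      have "act s ?d s = - ?d s" using that sk s(1) by (simp add: act_apply)
      moreover have "0 \<le> act s ?d s" "0 \<le> ?d s" using sd dpos by (auto simp: nonneg_def)
      ultimately show ?thesis using that sk by simp
    qed
    then show ?thesis using pair_le[OF s(1) dpos] sk bl by auto
  qed
qed

text \<open>The condition refers to inversions and to no firing sequence, so it can be checked after
  a letter is removed or the generators are restricted. Roots orthogonal to the given one are
  exempt, because the order of commuting letters is not determined.\<close>

definition good :: "'a set \<Rightarrow> ('a \<Rightarrow> int) \<Rightarrow> 'a \<Rightarrow> 'a \<Rightarrow> bool" where
  "good I h x s \<longleftrightarrow> x \<in> generate W I \<and> s \<in> I \<and> nonneg (act x (simple_root s)) \<and>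
    (\<forall>\<gamma>\<in>pos_roots I. bil \<gamma> (act x (simple_root s)) \<noteq> 0 \<and> \<gamma> \<noteq> act x (simple_root s) \<longrightarrow>
      (nonneg (- act (inv x) \<gamma>) \<longleftrightarrow> 0 < skew h \<gamma> (act x (simple_root s))))"

lemma act_pos_roots:
  assumes "I \<subseteq> S" "x \<in> generate W I" "\<beta> \<in> roots" "\<beta> \<in> coords I" "nonneg (act x \<beta>)"
  shows "act x \<beta> \<in> pos_roots I"
  using assms act_coords act_roots generate_closed by (auto simp: pos_roots_def)

lemma generate_inv: "I \<subseteq> S \<Longrightarrow> x \<in> generate W I \<Longrightarrow> inv x \<in> generate W I"
  using S_carrier generate_m_inv_closed by (meson order_trans)

text \<open>\<open>reach_order\<close> is applied twice: before \<open>s\<close> is fired, when the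
  root in question is not yet an inversion, and afterwards, when it is one. The second application
  excludes a root with positive skew product that is still not inverted.\<close>

lemma reach_good:
  assumes I: "I \<subseteq> S" and r: "reach I h x k" and s: "source I k s"
    and pos: "nonneg (act x (simple_root s))"
  shows "good I h x s"
proof -
  let ?b = "act x (simple_root s)"
  have sI: "s \<in> I" "s \<in> S" using s I by (auto simp: source_def)
  have xI: "x \<in> generate W I" using reach_generate[OF I r] .
  then have x: "x \<in> carrier W" using generate_closed I by blast
  have b: "?b \<in> pos_roots I" using act_pos_roots[OF I xI _ _ pos] sI by simp
  have "nonneg (- act (inv x) \<gamma>) \<longleftrightarrow> 0 < skew h \<gamma> ?b"
    if g: "\<gamma> \<in> pos_roots I" "bil \<gamma> ?b \<noteq> 0" "\<gamma> \<noteq> ?b" for \<gamma>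
  proof
    assume "nonneg (- act (inv x) \<gamma>)"
    then show "0 < skew h \<gamma> ?b"
      using reach_order[OF I r g(1) _ b] g(2) x by (simp add: less_le)
  next
    assume p: "0 < skew h \<gamma> ?b"
    show "nonneg (- act (inv x) \<gamma>)"
    proof (rule ccontr)
      assume n: "\<not> nonneg (- act (inv x) \<gamma>)"
      have gr: "act (inv x) \<gamma> \<in> roots" using g x act_roots by (auto simp: pos_roots_def)
      have np: "nonneg (act (inv x) \<gamma>)" using n root_cases[OF gr] by blast
      have "act (inv x) \<gamma> \<noteq> simple_root s" using g(3) x by (metis act_inv(2))
      then have 1: "nonneg (act (inv (x \<otimes> s)) \<gamma>)"
        using act_simple_nonneg[OF sI(2) gr np] x sI by (simp add: act_inv_step)
      have 2: "nonneg (- act (inv (x \<otimes> s)) ?b)"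
        using x sI by (simp add: act_inv_step act_simple_self)
      have "0 \<le> skew h ?b \<gamma>"
        using reach_order[OF I reach_step[OF r s pos] b 2 g(1) 1] by simp
      then show False using p skew_swap[of h ?b \<gamma>] by simp
    qed
  qed
  then show ?thesis using xI sI pos by (auto simp: good_def)
qed

text \<open>Firing cannot get stuck before \<open>\<beta>\<close> is inverted. Some simple root
  stays positive under \<open>x\<close>, since otherwise \<open>\<beta>\<close> would be a
  nonnegative combination of negative roots. Among these the lowest vertex is a source: the root of
  a lower neighbour would already be inverted, with a skew product that contradicts
  \<open>reach_order\<close>.\<close>

lemma reach_live_source:
  assumes I: "I \<subseteq> S" and h: "height_on I h" and r: "reach I h x k"
    and b: "\<beta> \<in> pos_roots I" "nonneg (act (inv x) \<beta>)"
  obtains s where "source I k s" "nonneg (act x (simple_root s))"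
proof -
  have xI: "x \<in> generate W I" using reach_generate[OF I r] .
  then have x: "x \<in> carrier W" using generate_closed I by blast
  have k: "height_on I k" using reach_height[OF r I h] .
  let ?live = "\<lambda>s. s \<in> I \<and> nonneg (act x (simple_root s))"
  have rt: "act x (simple_root s) \<in> roots" if "s \<in> I" for s
    using that I x act_roots by auto
  have ex: "\<exists>s. ?live s"
  proof (rule ccontr)
    assume n: "\<not> (\<exists>s. ?live s)"
    let ?v = "act (inv x) \<beta>"
    have v: "?v \<in> coords I" using act_coords[OF I generate_inv[OF I xI]] b by (auto simp: pos_roots_def)
    have "\<beta> = act x ?v" using x by simp
    also have "\<dots> = (\<Sum>s\<in>I. ?v s *\<^sub>R act x (simple_root s))"
      by (subst coords_expand[OF I v]) (simp only: act_simps[OF x])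
    finally have e: "- \<beta> = (\<Sum>s\<in>I. ?v s *\<^sub>R (- act x (simple_root s)))"
      by (simp only: scaleR_minus_right sum_negf)
    have "nonneg (\<Sum>s\<in>I. ?v s *\<^sub>R (- act x (simple_root s)))"
    proof (intro nonneg_sum nonneg_scale)
      fix s assume "s \<in> I"
      then show "nonneg (- act x (simple_root s))" using n root_cases[OF rt] by blast
      show "0 \<le> ?v s" using b(2) by (simp add: nonneg_def)
    qed
    then show False unfolding e[symmetric] using b(1) root_not_both pos_roots_D by blast
  qed
  have fin: "finite {s. ?live s}" using I finite_S by (auto intro: finite_subset[of _ S])
  have ne: "{s. ?live s} \<noteq> {}" using ex by blast
  define m where "m = arg_min_on k {s. ?live s}"
  have m: "?live m" and min: "\<And>s. ?live s \<Longrightarrow> k m \<le> k s"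
    using arg_min_if_finite[OF fin ne, of k] unfolding m_def by (auto simp: not_less)
  have "source I k m"
  proof (rule ccontr)
    assume "\<not> source I k m"
    then obtain p where p: "p \<in> I" "p \<noteq> m" "cox_b m p \<noteq> 0" "k p \<noteq> k m + 1"
      using m by (auto simp: source_def)
    have pS: "p \<in> S" "m \<in> S" using p m I by auto
    have "\<bar>k m - k p\<bar> = 1" using k p m by (auto simp: height_on_def)
    then have kp: "k p = k m - 1" using p(4) by auto
    then have "\<not> ?live p" using min[of p] by auto
    then have neg: "nonneg (- act x (simple_root p))" using p(1) root_cases[OF rt[OF p(1)]] by blast
    let ?g = "- act x (simple_root p)"
    have g: "?g \<in> pos_roots I" "nonneg (- act (inv x) ?g)"
      using neg act_pos_roots[OF I xI, of "- simple_root p"] pS p(1) x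
      by (simp_all add: act_simps uminus_roots) (simp add: coords_def)
    have d: "act x (simple_root m) \<in> pos_roots I" "nonneg (act (inv x) (act x (simple_root m)))"
      using act_pos_roots[OF I xI] m pS x by simp_all
    have "0 \<le> skew h ?g (act x (simple_root m))"
      using reach_order[OF I r g d] by blast
    also have "\<dots> = - skew k (simple_root p) (simple_root m)"
      using reach_skew[OF I r] p(1) m by (simp add: skew_simps)
    also have "\<dots> = cox_b p m" using kp pS by (simp add: skew_simple)
    finally show False using cox_b_nonpos[OF pS p(2)] p(3) cox_b_sym[OF pS] by simp
  qed
  then show thesis using that m by blast
qed

text \<open>Firing goes on until the root of the fired source is \<open>\<beta>\<close>; the length
  grows by one each time and is bounded on a finite group. The clause on the inversions of
  \<open>x0\<close> serves to prescribe the first letter in \<open>root_lift_fire\<close>.\<close>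

lemma reach_root:
  assumes I: "I \<subseteq> S" and h: "height_on I h" and r: "reach I h x0 k0"
    and b: "\<beta> \<in> pos_roots I" "nonneg (act (inv x0) \<beta>)"
  shows "\<exists>x k s. reach I h x k \<and> source I k s \<and> act x (simple_root s) = \<beta> \<and>
    (\<forall>\<gamma>\<in>pos_roots I. nonneg (- act (inv x0) \<gamma>) \<longrightarrow> nonneg (- act (inv x) \<gamma>))"
proof -
  obtain M where M: "\<And>w. w \<in> carrier W \<Longrightarrow> len w \<le> M"
    using len_bounded[OF finite_W] by blast
  show ?thesis
    using r b
  proof (induction "M - len x0" arbitrary: x0 k0 rule: less_induct)
    case less
    have xI: "x0 \<in> generate W I" using reach_generate[OF I less.prems(1)] .
    then have x: "x0 \<in> carrier W" using generate_closed I by blast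
    obtain s where s: "source I k0 s" "nonneg (act x0 (simple_root s))"
      using reach_live_source[OF I h less.prems] .
    have sS: "s \<in> S" using s I by (auto simp: source_def)
    have br: "act (inv x0) \<beta> \<in> roots" using b x act_roots by (auto simp: pos_roots_def)
    show ?case
    proof (cases "act x0 (simple_root s) = \<beta>")
      case True
      then show ?thesis using s less.prems by blast
    next
      case False
      then have "act (inv x0) \<beta> \<noteq> simple_root s" using x by (metis act_inv(2))
      then have p: "nonneg (act (inv (x0 \<otimes> s)) \<beta>)"
        using act_simple_nonneg[OF sS br less.prems(3)] x sS by (simp add: act_inv_step)
      have l: "len (x0 \<otimes> s) = Suc (len x0)" using len_up[OF x sS s(2)] .
      then have "M - len (x0 \<otimes> s) < M - len x0" using M[of "x0 \<otimes> s"] x sS by simp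
      from less.hyps[OF this reach_step[OF less.prems(1) s] b(1) p]
      obtain y k t where y: "reach I h y k" "source I k t" "act y (simple_root t) = \<beta>"
        "\<And>\<gamma>. \<gamma> \<in> pos_roots I \<Longrightarrow> nonneg (- act (inv (x0 \<otimes> s)) \<gamma>) \<Longrightarrow> nonneg (- act (inv y) \<gamma>)"
        by blast
      have "nonneg (- act (inv (x0 \<otimes> s)) \<gamma>)"
        if g: "\<gamma> \<in> pos_roots I" "nonneg (- act (inv x0) \<gamma>)" for \<gamma>
      proof -
        have gr: "- act (inv x0) \<gamma> \<in> roots" using g x act_roots uminus_roots by (auto simp: pos_roots_def)
        have "- act (inv x0) \<gamma> \<noteq> simple_root s"
        proof
          assume "- act (inv x0) \<gamma> = simple_root s"
          then have "act x0 (simple_root s) = - \<gamma>" using x by (metis act_inv(2) act_simps(4))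
          then show False using s(2) g(1) root_not_both by (auto simp: pos_roots_def)
        qed
        from act_simple_nonneg[OF sS gr g(2) this] show ?thesis
          using x sS by (simp add: act_inv_step act_simps)
      qed
      then show ?thesis using y by blast
    qed
  qed
qed

text \<open>Left descents in \<open>J\<close> are stripped off one at a time; what remains is the
  shortest element of its coset of the subgroup generated by \<open>J\<close>.\<close>

lemma coset_decomposition:
  assumes J: "J \<subseteq> S" and w: "w \<in> carrier W"
  shows "\<exists>a b. a \<in> generate W J \<and> b \<in> carrier W \<and> w = a \<otimes> b \<and> len w = len a + len b
    \<and> (\<forall>j\<in>J. nonneg (act (inv b) (simple_root j)))"
  using w
proof (induction "len w" arbitrary: w rule: less_induct)
  case less
  show ?case
  proof (cases "\<forall>j\<in>J. nonneg (act (inv w) (simple_root j))")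
    case True
    then show ?thesis using less.prems
      by (intro exI[of _ \<one>] exI[of _ w]) (auto intro: generate.one)
  next
    case False
    then obtain j where j: "j \<in> J" "\<not> nonneg (act (inv w) (simple_root j))" by blast
    have jS: "j \<in> S" using j J by blast
    have "nonneg (- act (inv w) (simple_root j))"
      using j root_cases[OF act_roots[OF inv_closed[OF less.prems] simple_root_roots[OF jS]]] by blast
    then have l: "len w = Suc (len (j \<otimes> w))"
      using len_down[of "inv w" j] less.prems jS by (simp add: len_left len_inv)
    then obtain a b where ab: "a \<in> generate W J" "b \<in> carrier W" "j \<otimes> w = a \<otimes> b"
      "len (j \<otimes> w) = len a + len b" "\<forall>i\<in>J. nonneg (act (inv b) (simple_root i))"
      using less.hyps[of "j \<otimes> w"] less.prems jS by auto
    have a: "a \<in> carrier W" using generate_closed[OF J ab(1)] .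
    have wj: "w = j \<otimes> a \<otimes> b"
      using ab(3) X_cancel(1)[OF jS less.prems] a ab(2) jS by (simp add: m_assoc)
    have "len w \<le> len (j \<otimes> a) + len b" using len_mult[of "j \<otimes> a" b] wj a ab jS by simp
    then have "len w = len (j \<otimes> a) + len b" using len_step(3)[OF jS a] l ab(4) by simp
    then show ?thesis
      using wj ab j by (intro exI[of _ "j \<otimes> a"] exI[of _ b]) (auto intro: generate.incl generate.eng)
  qed
qed

end

subsection \<open>Lifting reflections\<close>

context finite_coxeter
begin

definition reflect :: "'a \<Rightarrow> 'a \<Rightarrow> 'a" where
  "reflect x s = x \<otimes> s \<otimes> inv x"

lemma act_eq_imp_eq:
  assumes x: "x \<in> carrier W" and y: "y \<in> carrier W"
    and eq: "\<And>s. s \<in> S \<Longrightarrow> act x (simple_root s) = act y (simple_root s)"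
  shows "x = y"
proof -
  have "inv x \<otimes> y = \<one>"
  proof (rule act_faithful)
    fix s assume "s \<in> S"
    then have "act (inv x \<otimes> y) (simple_root s) = simple_root s"
      using x y eq[of s, symmetric] by (simp add: act_mult)
    then show "nonneg (act (inv x \<otimes> y) (simple_root s))" by simp
  qed (use x y in simp)
  then show ?thesis using x y by (metis inv_equality inv_inv inv_closed)
qed

lemma act_reflect:
  assumes x: "x \<in> carrier W" and s: "s \<in> S"
  shows "act (reflect x s) v
    = v - (2 * bil (act x (simple_root s)) v) *\<^sub>R act x (simple_root s)"
proof -
  have "bil (act x (simple_root s)) v = pair s (act (inv x) v)"
    using bil_act[OF x, of "simple_root s" "act (inv x) v"] x s by simp
  then show ?thesis
    using x s by (simp only: reflect_def act_mult m_closed inv_closed X_closed act_S_eq act_simps act_inv)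
qed

lemma reflect_closed [simp]: "x \<in> carrier W \<Longrightarrow> s \<in> S \<Longrightarrow> reflect x s \<in> carrier W"
  by (simp add: reflect_def)

lemma reflect_eq:
  assumes "x \<in> carrier W" "s \<in> S" "y \<in> carrier W" "t \<in> S"
    and "act x (simple_root s) = act y (simple_root t) \<or> act x (simple_root s) = - act y (simple_root t)"
  shows "reflect x s = reflect y t"
  using assms by (intro act_eq_imp_eq) (auto simp only: act_reflect reflect_closed
      bil_left mult_minus_right scaleR_minus_left scaleR_minus_right minus_minus)

text \<open>The eigenvectors for the eigenvalue -1 agree up to a scalar, and both roots have norm
  1.\<close>

lemma reflect_eq_root:
  assumes "x \<in> carrier W" "s \<in> S" "y \<in> carrier W" "t \<in> S" "reflect x s = reflect y t"
  shows "act x (simple_root s) = act y (simple_root t) \<or> act x (simple_root s) = - act y (simple_root t)"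
proof -
  let ?a = "act x (simple_root s)" and ?b = "act y (simple_root t)"
  have r: "?a \<in> roots" "?b \<in> roots" using assms act_roots by auto
  have aa: "bil ?a ?a = 1" and bb: "bil ?b ?b = 1" using bil_root r by auto
  have "act (reflect x s) ?a = - ?a"
    unfolding act_reflect[OF assms(1,2)] aa by (simp add: scaleR_2)
  then have "?a - (2 * bil ?b ?a) *\<^sub>R ?b = - ?a"
    using act_reflect[OF assms(3,4)] assms(5) by metis
  then have "2 *\<^sub>R ?a = 2 *\<^sub>R (bil ?b ?a *\<^sub>R ?b)"
    by (simp add: scaleR_2 algebra_simps)
  then have e: "?a = bil ?b ?a *\<^sub>R ?b"
    by (metis scaleR_left_imp_eq zero_neq_numeral)
  then have "bil ?a ?a = bil ?b ?a * bil ?b ?a * bil ?b ?b"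
    by (metis bil_left(3) bil_right(3) mult.assoc)
  then have "bil ?b ?a * bil ?b ?a = 1" using aa bb by simp
  then have "bil ?b ?a = 1 \<or> bil ?b ?a = - 1" by (simp add: square_eq_1_iff)
  then show ?thesis using e by (metis scaleR_minus1_left scaleR_one)
qed

end

context braid_target
begin

definition conj_lift :: "'a \<Rightarrow> 'a \<Rightarrow> 'c" where
  "conj_lift x s = lift x \<otimes>\<^bsub>A\<^esub> \<theta> s \<otimes>\<^bsub>A\<^esub> inv\<^bsub>A\<^esub> lift x"

lemma conj_lift_closed [simp]: "x \<in> carrier W \<Longrightarrow> s \<in> S \<Longrightarrow> conj_lift x s \<in> carrier A"
  by (simp add: conj_lift_def)

lemma \<theta>_commute:
  assumes "s \<in> S" "t \<in> S" "s \<otimes> t = t \<otimes> s"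
  shows "\<theta> s \<otimes>\<^bsub>A\<^esub> \<theta> t = \<theta> t \<otimes>\<^bsub>A\<^esub> \<theta> s"
proof (cases "s = t")
  case False
  have "(s \<otimes> t) [^] (2::nat) = \<one>" using S_commute_iff assms by blast
  then have "ord (s \<otimes> t) dvd 2" using assms pow_eq_id[of "s \<otimes> t" 2] by simp
  then have "ord (s \<otimes> t) = 2" using ord_ge_2[OF assms(1,2) False] by (auto dest: dvd_imp_le)
  then show ?thesis using \<theta>_braid[OF assms(1,2)] assms by (simp add: numeral_2_eq_2)
qed simp

lemma good_D:
  assumes "good I h x s" "I \<subseteq> S"
  shows "x \<in> generate W I" "x \<in> carrier W" "s \<in> I" "s \<in> S" "nonneg (act x (simple_root s))"
    "act x (simple_root s) \<in> pos_roots I" "act x (simple_root s) \<in> roots"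
proof -
  show 1: "x \<in> generate W I" "s \<in> I" "nonneg (act x (simple_root s))"
    using assms(1) by (auto simp: good_def)
  show 2: "x \<in> carrier W" "s \<in> S" using 1 assms(2) generate_closed by blast+
  show "act x (simple_root s) \<in> pos_roots I"
    using act_pos_roots[OF assms(2) 1(1) _ _ 1(3)] 1 2 by simp
  then show "act x (simple_root s) \<in> roots" by (rule pos_roots_D)
qed

lemma good_iff:
  assumes "good I h x s" "\<gamma> \<in> pos_roots I"
    "bil \<gamma> (act x (simple_root s)) \<noteq> 0" "\<gamma> \<noteq> act x (simple_root s)"
  shows "nonneg (- act (inv x) \<gamma>) \<longleftrightarrow> 0 < skew h \<gamma> (act x (simple_root s))"
  using assms by (auto simp: good_def)

text \<open>A descent \<open>a\<close> of \<open>x\<^sup>-\<^sup>1 y\<close> gives a root on which the two inversion sets differ. Such a root is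
  orthogonal to the common root of the two pairs, so that \<open>a\<close> commutes with \<open>t\<close> and \<open>y\<close> may be
  replaced by \<open>y a\<close>.\<close>

lemma good_unique:
  assumes I: "I \<subseteq> S" and x: "good I h x s" and y: "good I h y t"
    and eq: "act x (simple_root s) = act y (simple_root t)"
  shows "conj_lift x s = conj_lift y t"
  using y eq
proof (induction "len (inv x \<otimes> y)" arbitrary: y rule: less_induct)
  case less
  note X = good_D[OF x I] and Y = good_D[OF less.prems(1) I]
  let ?b = "act x (simple_root s)"
  define g where "g = inv x \<otimes> y"
  have gI: "g \<in> generate W I"
    unfolding g_def using X Y generate_inv[OF I] by (auto intro: generate.eng)
  have g: "g \<in> carrier W" using gI generate_closed I by blast
  show ?case
  proof (cases "g = \<one>")
    case True
    then have xy: "x = y" using X Y unfolding g_def by (metis inv_equality inv_inv inv_closed)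
    then have "simple_root s = simple_root t"
      using less.prems(2) X by (metis act_inv(1))
    then show ?thesis using xy by simp
  next
    case False
    then obtain a where a: "a \<in> I" "\<not> nonneg (act g (simple_root a))"
      using generate_descent[OF I gI] by blast
    have aS: "a \<in> S" using a I by blast
    have gt: "act g (simple_root t) = simple_root s"
      unfolding g_def using less.prems(2)[symmetric] X Y by (simp add: act_mult)
    have at: "a \<noteq> t" using a gt by auto
    let ?r = "act y (simple_root a)"
    have r: "?r \<in> roots" using Y aS act_roots by auto
    have rI: "?r \<in> coords I" using act_coords[OF I Y(1)] a by simp
    have xr: "act (inv x) ?r = act g (simple_root a)" unfolding g_def using X Y aS by (simp add: act_mult)
    have yr: "act (inv y) ?r = simple_root a" using Y by simp
    have xrr: "act (inv x) ?r \<in> roots" using r X act_roots by auto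
    have neg: "nonneg (- act (inv x) ?r)" using a(2) xr root_cases[OF xrr] by auto
    have bil0: "bil ?r ?b = cox_b a t"
      unfolding less.prems(2) using bil_act[OF Y(2), of "simple_root a" "simple_root t"] aS Y cox_b_sym[OF aS Y(4)]
      by simp
    have rb: "?r \<noteq> ?b" "- ?r \<noteq> ?b"
    proof -
      show "?r \<noteq> ?b" using less.prems(2) at Y by (metis act_inv(1) simple_root_eq)
      show "- ?r \<noteq> ?b"
      proof
        assume "- ?r = ?b"
        then have "act y (- simple_root a) = act y (simple_root t)"
          using less.prems(2) Y by (simp only: act_simps)
        then have "- simple_root a = simple_root t" using Y by (metis act_inv(1))
        then have "(- simple_root a) a = simple_root t a" by simp
        then show False by (simp split: if_splits)
      qed
    qed
    have comm: "cox_b a t = 0"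
    proof (rule ccontr)
      assume ne: "cox_b a t \<noteq> 0"
      show False
      proof (cases "nonneg ?r")
        case True
        then have p: "?r \<in> pos_roots I" using r rI by (simp add: pos_roots_def)
        have "nonneg (- act (inv x) ?r) \<longleftrightarrow> nonneg (- act (inv y) ?r)"
          using good_iff[OF x p] good_iff[OF less.prems(1) p] bil0 ne rb less.prems(2) by simp
        then have "nonneg (- simple_root a)" using neg unfolding yr by blast
        then show False using root_not_both[OF simple_root_roots[OF aS]] by simp
      next
        case False
        then have p: "- ?r \<in> pos_roots I"
          using r rI root_cases uminus_roots by (auto simp: pos_roots_def coords_def)
        have m: "act (inv x) (- ?r) = - act (inv x) ?r" "act (inv y) (- ?r) = - act (inv y) ?r"
          using X Y by (simp_all only: act_simps inv_closed)
        have "nonneg (- act (inv x) (- ?r)) \<longleftrightarrow> nonneg (- act (inv y) (- ?r))"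
          using good_iff[OF x p] good_iff[OF less.prems(1) p] bil0 ne rb less.prems(2) by simp
        then have "nonneg (act (inv x) ?r)" unfolding m yr by simp
        then show False using neg root_not_both[OF xrr] by simp
      qed
    qed
    have st: "a \<otimes> t = t \<otimes> a" using cox_b_eq_0_iff[OF aS Y(4) at] comm by simp
    have ya: "y \<otimes> a \<in> carrier W" "y \<otimes> a \<in> generate W I"
      using Y aS a by (auto intro: generate.eng generate.incl)
    have root: "act (y \<otimes> a) (simple_root t) = ?b"
      using Y aS comm less.prems(2) by (simp add: act_mult act_S_eq)
    \<comment> \<open>The inversions of \<open>y\<close> and \<open>y \<otimes> a\<close> differ
      only in \<open>?r\<close> or its negative, which is orthogonal to \<open>?b\<close> and so
      exempt from the condition.\<close>
    have "good I h (y \<otimes> a) t"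
      unfolding good_def
    proof (intro conjI ballI impI)
      fix \<gamma> assume g': "\<gamma> \<in> pos_roots I" and
        ne: "bil \<gamma> (act (y \<otimes> a) (simple_root t)) \<noteq> 0 \<and> \<gamma> \<noteq> act (y \<otimes> a) (simple_root t)"
      have yg: "act (inv y) \<gamma> \<in> roots" using g' Y act_roots pos_roots_D by auto
      have 1: "act (inv y) \<gamma> \<noteq> simple_root a"
      proof
        assume "act (inv y) \<gamma> = simple_root a"
        then have "\<gamma> = ?r" using Y by (metis act_inv(2))
        then show False using ne root bil0 comm by simp
      qed
      have 2: "act (inv y) \<gamma> \<noteq> - simple_root a"
      proof
        assume "act (inv y) \<gamma> = - simple_root a"
        then have "\<gamma> = - ?r" using Y by (metis act_inv(2) act_simps(4))
        then show False using ne root bil0 comm by simp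
      qed
      have "nonneg (- act (inv (y \<otimes> a)) \<gamma>) \<longleftrightarrow> nonneg (- act (inv y) \<gamma>)"
        using act_sign_change[OF aS yg 1 2] root_not_both[OF yg]
          root_not_both[OF act_roots[OF X_closed[OF aS] yg]] act_inv_step[OF Y(2) aS] by metis
      also have "\<dots> \<longleftrightarrow> 0 < skew h \<gamma> ?b"
        using good_iff[OF less.prems(1) g'] ne root less.prems(2) by simp
      finally show "nonneg (- act (inv (y \<otimes> a)) \<gamma>) \<longleftrightarrow> 0 < skew h \<gamma> (act (y \<otimes> a) (simple_root t))"
        unfolding root .
    next
      show "nonneg (act (y \<otimes> a) (simple_root t))" using root X by simp
    qed (use ya Y in auto)
    moreover have "len (inv x \<otimes> (y \<otimes> a)) < len (inv x \<otimes> y)"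
    proof -
      have "nonneg (- act g (simple_root a))"
        using neg xr by simp
      then have "len (g \<otimes> a) < len g" using len_lt_iff(2)[OF g aS] by blast
      then show ?thesis unfolding g_def using X Y aS by (simp add: m_assoc)
    qed
    ultimately have IH: "conj_lift x s = conj_lift (y \<otimes> a) t"
      using less.hyps root by simp
    have "conj_lift (y \<otimes> a) t = conj_lift y t"
    proof (cases "nonneg ?r")
      case True
      then show ?thesis
        using lift_right[OF Y(2) aS True] \<theta>_commute[OF aS Y(4) st] Y aS
        by (simp add: conj_lift_def A.conj_by_commuting)
    next
      case False
      then have "nonneg (act (y \<otimes> a) (simple_root a))"
        using Y aS root_cases[OF r] by (simp add: act_mult act_simple_self act_simps)
      from lift_right[OF ya(1) aS this] have "lift y = lift (y \<otimes> a) \<otimes>\<^bsub>A\<^esub> \<theta> a"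
        using Y aS by simp
      then show ?thesis
        using \<theta>_commute[OF aS Y(4) st] Y aS ya
        by (simp add: conj_lift_def A.conj_by_commuting)
    qed
    then show ?thesis using IH by simp
  qed
qed

text \<open>Independent of the choice by \<open>good_unique\<close>. If \<open>h\<close> is a height
  function on \<open>I\<close>, \<open>ex_good\<close> provides a pair for every positive root
  supported in \<open>I\<close>.\<close>

definition root_lift :: "'a set \<Rightarrow> ('a \<Rightarrow> int) \<Rightarrow> ('a \<Rightarrow> real) \<Rightarrow> 'c" where
  "root_lift I h \<beta> = (SOME z. \<exists>x s. good I h x s \<and> act x (simple_root s) = \<beta> \<and> z = conj_lift x s)"

lemma root_lift_eq:
  assumes "I \<subseteq> S" "good I h x s"
  shows "root_lift I h (act x (simple_root s)) = conj_lift x s"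
proof -
  have "\<exists>z. \<exists>y t. good I h y t \<and> act y (simple_root t) = act x (simple_root s) \<and> z = conj_lift y t"
    using assms(2) by blast
  from someI_ex[OF this] obtain y t where "good I h y t"
    "act y (simple_root t) = act x (simple_root s)"
    "root_lift I h (act x (simple_root s)) = conj_lift y t"
    unfolding root_lift_def by blast
  then show ?thesis using good_unique[OF assms(1) _ assms(2)] by metis
qed

lemma ex_good:
  assumes "I \<subseteq> S" "height_on I h" "\<beta> \<in> pos_roots I"
  obtains x s where "good I h x s" "act x (simple_root s) = \<beta>"
proof -
  have "nonneg (act (inv \<one>) \<beta>)" using pos_roots_D(2)[OF assms(3)] by (metis act_one inv_one)
  from reach_root[OF assms(1,2) reach_one assms(3) this] show thesis
    using that reach_good[OF assms(1)] pos_roots_D(2)[OF assms(3)] by metis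
qed

text \<open>If \<open>x\<close> carries the simple root of \<open>t\<close> to that of
  \<open>s\<close>, then \<open>x \<otimes> t = s \<otimes> x\<close>, and both products are longer
  than \<open>x\<close>. Lifting them shows that the lift of \<open>x\<close> conjugates
  \<open>\<theta> t\<close> to \<open>\<theta> s\<close>.\<close>

lemma root_lift_simple:
  assumes I: "I \<subseteq> S" and h: "height_on I h" and s: "s \<in> I"
  shows "root_lift I h (simple_root s) = \<theta> s"
proof -
  have sS: "s \<in> S" using s I by blast
  obtain x t where x: "good I h x t" "act x (simple_root t) = simple_root s"
    using ex_good[OF I h simple_pos_roots[OF s I]] by blast
  note X = good_D[OF x(1) I]
  have "reflect x t = reflect \<one> s"
    using X x sS by (intro reflect_eq) simp_all
  then have "x \<otimes> t \<otimes> inv x = s" using sS by (simp add: reflect_def)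
  then have sx: "x \<otimes> t = s \<otimes> x" using X sS by (metis X_closed inv_solve_right m_closed)
  have "act (inv x) (simple_root s) = simple_root t" using x(2) X by (metis act_inv(1))
  then have "lift (s \<otimes> x) = \<theta> s \<otimes>\<^bsub>A\<^esub> lift x"
    by (intro lift_left X sS) simp
  then have "lift x \<otimes>\<^bsub>A\<^esub> \<theta> t = \<theta> s \<otimes>\<^bsub>A\<^esub> lift x"
    using lift_right[OF X(2,4,5)] sx by simp
  then have "conj_lift x t = \<theta> s"
    using X sS by (simp add: conj_lift_def A.m_assoc)
  then show ?thesis using root_lift_eq[OF I x(1)] x(2) by simp
qed

text \<open>The element \<open>x\<close> for \<open>\<beta>\<close> is taken from a firing sequence
  that begins with \<open>s\<close>. Then \<open>x = s \<otimes> y\<close> with adding lengths,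
  \<open>y\<close> is good for the fired height function, and the two lifts differ by conjugation
  with \<open>\<theta> s\<close>.\<close>

lemma root_lift_fire:
  assumes I: "I \<subseteq> S" and h: "height_on I h" and s: "source I h s"
    and b: "\<beta> \<in> pos_roots I" and ne: "\<beta> \<noteq> simple_root s"
  shows "root_lift I (fire h s) (act s \<beta>) = inv\<^bsub>A\<^esub> \<theta> s \<otimes>\<^bsub>A\<^esub> root_lift I h \<beta> \<otimes>\<^bsub>A\<^esub> \<theta> s"
proof -
  have sI: "s \<in> I" "s \<in> S" using s I by (auto simp: source_def)
  have r0: "reach I h (\<one> \<otimes> s) (fire h s)"
    by (rule reach_step[OF reach_one s]) simp
  have "act (inv (\<one> \<otimes> s)) \<beta> = act s \<beta>" using sI by simp
  then have "nonneg (act (inv (\<one> \<otimes> s)) \<beta>)"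
    using act_simple_nonneg[OF sI(2) pos_roots_D(1)[OF b] pos_roots_D(2)[OF b] ne] by simp
  from reach_root[OF I h r0 b this] obtain x k t where x: "reach I h x k" "source I k t"
    "act x (simple_root t) = \<beta>"
    and inc: "\<And>\<gamma>. \<gamma> \<in> pos_roots I \<Longrightarrow> nonneg (- act (inv (\<one> \<otimes> s)) \<gamma>) \<Longrightarrow> nonneg (- act (inv x) \<gamma>)"
    by blast
  have g: "good I h x t" using reach_good[OF I x(1,2)] x(3) pos_roots_D(2)[OF b] by simp
  note X = good_D[OF g I]
  have sx: "nonneg (- act (inv x) (simple_root s))"
    using inc[OF simple_pos_roots[OF sI(1) I]] sI by (simp add: act_simple_self)
  define y where "y = s \<otimes> x"
  have y: "y \<in> carrier W" "y \<in> generate W I" "x = s \<otimes> y"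
    using X sI by (auto simp: y_def intro: generate.eng generate.incl)
  have yinv: "act (inv y) v = act (inv x) (act s v)" for v
    unfolding y_def using X sI by (simp add: inv_mult_group act_mult)
  have yt: "act y (simple_root t) = act s \<beta>" unfolding y_def using X sI x(3) by (simp add: act_mult)
  have ypos: "nonneg (act (inv y) (simple_root s))"
    unfolding yinv act_simple_self[OF sI(2)] using sx X by (simp only: act_simps inv_closed)
  have sgood: "good I (fire h s) y t"
    unfolding good_def
  proof (intro conjI ballI impI)
    show "nonneg (act y (simple_root t))"
      unfolding yt using act_simple_nonneg[OF sI(2) pos_roots_D(1)[OF b] pos_roots_D(2)[OF b] ne] .
    fix \<gamma> assume g': "\<gamma> \<in> pos_roots I"
      and n': "bil \<gamma> (act y (simple_root t)) \<noteq> 0 \<and> \<gamma> \<noteq> act y (simple_root t)"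
    have bI: "\<beta> \<in> coords I" "\<gamma> \<in> coords I" using b g' pos_roots_D by auto
    have sG: "s \<in> generate W I" using sI by (simp add: generate.incl)
    have c: "act s \<gamma> \<in> coords I" using act_coords[OF I sG bI(2)] .
    have ss: "act s (act s v) = v" for v using sI act_mult[of s s v] by (simp add: S_square)
    have sk: "skew (fire h s) \<gamma> (act s \<beta>) = skew h (act s \<gamma>) \<beta>"
      using skew_fire_act[OF I s c bI(1)] ss by simp
    show "nonneg (- act (inv y) \<gamma>) \<longleftrightarrow> 0 < skew (fire h s) \<gamma> (act y (simple_root t))"
    proof (cases "\<gamma> = simple_root s")
      \<comment> \<open>This root becomes negative under \<open>s\<close>, so the goodness of
        \<open>x\<close> says nothing about it. Both sides are false: \<open>y\<close> does not
        invert it, and a source has nonnegative skew product with \<open>\<beta>\<close>.\<close>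
      case True
      have "skew h (simple_root s) \<beta> \<ge> 0"
        using skew_source[OF I s bI(1)] pair_le[OF sI(2) pos_roots_D(2)[OF b]] by simp
      then have "\<not> 0 < skew (fire h s) \<gamma> (act y (simple_root t))"
        unfolding yt sk unfolding True act_simple_self[OF sI(2)] by (simp add: skew_simps)
      moreover have "act (inv y) \<gamma> \<in> roots" using g' y act_roots pos_roots_D by auto
      ultimately show ?thesis using ypos root_not_both True by metis
    next
      case False
      have p: "act s \<gamma> \<in> pos_roots I"
        using act_pos_roots[OF I sG pos_roots_D(1)[OF g'] pos_roots_D(3)[OF g']]
          act_simple_nonneg[OF sI(2) pos_roots_D(1)[OF g'] pos_roots_D(2)[OF g'] False] by blast
      have "bil (act s \<gamma>) \<beta> = bil (act s (act s \<gamma>)) (act s \<beta>)"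
        using bil_act sI by simp
      then have "bil (act s \<gamma>) \<beta> \<noteq> 0" using n' yt ss by simp
      moreover have "act s \<gamma> \<noteq> \<beta>" using n' yt ss by metis
      ultimately have "nonneg (- act (inv x) (act s \<gamma>)) \<longleftrightarrow> 0 < skew h (act s \<gamma>) \<beta>"
        using good_iff[OF g p] x(3) by simp
      then show ?thesis unfolding yinv yt sk .
    qed
  qed (use y X in auto)
  have "lift x = \<theta> s \<otimes>\<^bsub>A\<^esub> lift y"
    using lift_left[OF y(1) sI(2) ypos] y(3) by simp
  then have "conj_lift x t = \<theta> s \<otimes>\<^bsub>A\<^esub> conj_lift y t \<otimes>\<^bsub>A\<^esub> inv\<^bsub>A\<^esub> \<theta> s"
    using y X sI by (simp add: conj_lift_def A.inv_mult_group A.m_assoc)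
  then have "inv\<^bsub>A\<^esub> \<theta> s \<otimes>\<^bsub>A\<^esub> conj_lift x t \<otimes>\<^bsub>A\<^esub> \<theta> s = conj_lift y t"
    using y X sI by (simp add: A.m_assoc) (simp flip: A.m_assoc)
  then show ?thesis
    using root_lift_eq[OF I g] root_lift_eq[OF I sgood] x(3) yt by simp
qed

text \<open>Write \<open>x = y \<otimes> z\<close> with \<open>y\<close> in the subgroup of
  \<open>J\<close> and \<open>z\<close> shortest in its coset. The inverse of \<open>z\<close>
  preserves signs on \<open>coords J\<close>, so \<open>y\<close> has the same inversions there as
  \<open>x\<close>, and \<open>z\<close> carries the simple root of \<open>s\<close> to that of some
  \<open>j\<close> in \<open>J\<close>. Hence the lift of \<open>z\<close> conjugates
  \<open>\<theta> s\<close> to \<open>\<theta> j\<close>.\<close>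

lemma root_lift_restrict:
  assumes J: "J \<subseteq> I" and I: "I \<subseteq> S" and h: "height_on I h" and b: "\<beta> \<in> pos_roots J"
  shows "root_lift J h \<beta> = root_lift I h \<beta>"
proof -
  have JS: "J \<subseteq> S" using J I by blast
  have bI: "\<beta> \<in> pos_roots I" using b coords_mono[OF J] by (auto simp: pos_roots_def)
  obtain x s where x: "good I h x s" "act x (simple_root s) = \<beta>" using ex_good[OF I h bI] .
  note X = good_D[OF x(1) I]
  obtain y z where y: "y \<in> generate W J" and z: "z \<in> carrier W" and xyz: "x = y \<otimes> z"
    and l: "len x = len y + len z" and zJ: "\<And>j. j \<in> J \<Longrightarrow> nonneg (act (inv z) (simple_root j))"
    using coset_decomposition[OF JS X(2)] by blast
  have yW: "y \<in> carrier W" using generate_closed JS y by blast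
  have zpos: "nonneg (act (inv z) v)" if v: "v \<in> coords J" "nonneg v" for v
  proof -
    have "act (inv z) v = (\<Sum>j\<in>J. v j *\<^sub>R act (inv z) (simple_root j))"
      by (subst coords_expand[OF JS v(1)]) (simp only: act_simps[OF inv_closed[OF z]])
    then show ?thesis
      using zJ v(2) by (simp only:) (intro nonneg_sum nonneg_scale, auto simp: nonneg_def)
  qed
  define d where "d = act (inv y) \<beta>"
  have dJ: "d \<in> coords J" unfolding d_def
    using act_coords[OF JS generate_inv[OF JS y]] pos_roots_D(3)[OF b] by blast
  have dr: "d \<in> roots" unfolding d_def using act_roots yW pos_roots_D(1)[OF b] by auto
  have zd: "act (inv z) d = simple_root s"
    unfolding d_def x(2)[symmetric] xyz using yW z by (simp add: act_mult)
  have dpos: "nonneg d"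
  proof (rule ccontr)
    assume "\<not> nonneg d"
    then have "nonneg (- d)" "- d \<in> coords J" using root_cases[OF dr] dJ by (auto simp: coords_def)
    then have "nonneg (act (inv z) (- d))" using zpos by blast
    then have "nonneg (- simple_root s)" using zd z by (metis act_simps(4) inv_closed)
    then show False using root_not_both[OF simple_root_roots[OF X(4)]] by simp
  qed
  \<comment> \<open>The inverse of \<open>z\<close> maps the nonnegative vector \<open>d\<close> to
    a simple root. A simple summand of \<open>d\<close> goes to a nonnegative vector below a
    multiple of that root, hence to a multiple of it, and the norm fixes the factor.\<close>
  obtain j where j: "j \<in> J" "act (inv z) (simple_root j) = simple_root s"
  proof -
    have "\<exists>j\<in>J. 0 < d j"
    proof (rule ccontr)
      assume "\<not> (\<exists>j\<in>J. 0 < d j)"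
      then have "d x = 0" for x
        using dpos dJ unfolding nonneg_def coords_def by (metis (mono_tags) less_eq_real_def mem_Collect_eq)
      then have "d = 0" by (simp add: fun_eq_iff)
      then show False using root_nonzero[OF dr] by blast
    qed
    then obtain j where j: "j \<in> J" "0 < d j" by blast
    let ?u = "\<lambda>i. act (inv z) (simple_root i)"
    have jr: "?u j \<in> roots" using j JS z act_roots by auto
    have "?u j i = 0" if i: "i \<noteq> s" for i
    proof -
      have "d j *\<^sub>R simple_root j + (d - d j *\<^sub>R simple_root j) = d" by simp
      have c: "d - d j *\<^sub>R simple_root j \<in> coords J" "nonneg (d - d j *\<^sub>R simple_root j)"
        using dJ dpos j by (auto simp: coords_def nonneg_def)
      have "nonneg (act (inv z) (d - d j *\<^sub>R simple_root j))" using zpos[OF c] .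
      then have "nonneg (simple_root s - d j *\<^sub>R ?u j)"
        using zd by (simp only: act_simps[OF inv_closed[OF z]])
      then have "(simple_root s - d j *\<^sub>R ?u j) i \<ge> 0" unfolding nonneg_def by blast
      then have "d j * ?u j i \<le> 0" using i by simp
      then have "?u j i \<le> 0" using j(2) by (simp add: mult_le_0_iff)
      moreover have "?u j i \<ge> 0" using zJ[OF j(1)] by (simp add: nonneg_def)
      ultimately show ?thesis by simp
    qed
    then have e: "?u j = ?u j s *\<^sub>R simple_root s" by (auto simp: fun_eq_iff)
    have "bil (?u j) (?u j) = ?u j s * ?u j s * bil (simple_root s) (simple_root s)"
      using e by (metis bil_left(3) bil_right(3) mult.assoc)
    then have "?u j s * ?u j s = 1"
      using bil_root[OF jr] bil_root[OF simple_root_roots[OF X(4)]] by simp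
    moreover have "?u j s \<ge> 0" using zJ[OF j(1)] by (simp add: nonneg_def)
    ultimately have "?u j s = 1" by (auto simp: square_eq_1_iff)
    then have "?u j = simple_root s" using e by (metis scaleR_one)
    then show thesis using that j(1) by blast
  qed
  have jS: "j \<in> S" using j JS by blast
  have zs: "act z (simple_root s) = simple_root j" using j(2) z by (metis act_inv(2))
  have yj: "act y (simple_root j) = \<beta>"
    using zs x(2) xyz yW z by (simp add: act_mult)
  have "reflect z s = reflect \<one> j" using z X jS zs by (intro reflect_eq) simp_all
  then have "z \<otimes> s \<otimes> inv z = j" using jS by (simp add: reflect_def)
  then have zsj: "z \<otimes> s = j \<otimes> z" using z X jS by (metis X_closed inv_solve_right m_closed)
  have "lift z \<otimes>\<^bsub>A\<^esub> \<theta> s = lift (z \<otimes> s)" using lift_right[OF z X(4)] zs by simp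
  also have "\<dots> = \<theta> j \<otimes>\<^bsub>A\<^esub> lift z" unfolding zsj using lift_left[OF z jS] j by simp
  finally have c: "lift z \<otimes>\<^bsub>A\<^esub> \<theta> s \<otimes>\<^bsub>A\<^esub> inv\<^bsub>A\<^esub> lift z = \<theta> j"
    using z jS by (simp add: A.m_assoc)
  have "conj_lift x s = lift y \<otimes>\<^bsub>A\<^esub> (lift z \<otimes>\<^bsub>A\<^esub> \<theta> s \<otimes>\<^bsub>A\<^esub> inv\<^bsub>A\<^esub> lift z) \<otimes>\<^bsub>A\<^esub> inv\<^bsub>A\<^esub> lift y"
    using lift_mult[OF yW z] l xyz yW z X by (simp add: conj_lift_def A.inv_mult_group A.m_assoc)
  also have "\<dots> = conj_lift y j" unfolding c conj_lift_def ..
  finally have cl: "conj_lift x s = conj_lift y j" .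
  have "good J h y j"
    unfolding good_def
  proof (intro conjI ballI impI)
    show "nonneg (act y (simple_root j))" unfolding yj by (rule pos_roots_D(2)[OF b])
    fix \<gamma> assume g: "\<gamma> \<in> pos_roots J"
      and n: "bil \<gamma> (act y (simple_root j)) \<noteq> 0 \<and> \<gamma> \<noteq> act y (simple_root j)"
    have gI: "\<gamma> \<in> pos_roots I" using g coords_mono[OF J] by (auto simp: pos_roots_def)
    let ?e = "act (inv y) \<gamma>"
    have e: "?e \<in> roots" "?e \<in> coords J"
      using g act_roots yW act_coords[OF JS generate_inv[OF JS y]] pos_roots_D by auto
    have xe: "act (inv x) \<gamma> = act (inv z) ?e"
      unfolding xyz using yW z by (simp add: inv_mult_group act_mult)
    have ze: "act (inv z) (- ?e) = - act (inv z) ?e" using z by (simp only: act_simps inv_closed)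
    have "nonneg (- ?e) \<longleftrightarrow> nonneg (- act (inv x) \<gamma>)"
    proof
      assume "nonneg (- ?e)"
      moreover have "- ?e \<in> coords J" using e by (auto simp: coords_def)
      ultimately show "nonneg (- act (inv x) \<gamma>)" using zpos[of "- ?e"] ze xe by simp
    next
      assume n: "nonneg (- act (inv x) \<gamma>)"
      show "nonneg (- ?e)"
      proof (rule ccontr)
        assume "\<not> nonneg (- ?e)"
        then have "nonneg ?e" using root_cases[OF e(1)] by blast
        then have "nonneg (act (inv x) \<gamma>)" using zpos[OF e(2)] xe by simp
        moreover have "act (inv x) \<gamma> \<in> roots" using gI X act_roots pos_roots_D by auto
        ultimately show False using n root_not_both by blast
      qed
    qed
    also have "\<dots> \<longleftrightarrow> 0 < skew h \<gamma> \<beta>"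
      using good_iff[OF x(1) gI] n x(2) yj by simp
    finally show "nonneg (- ?e) \<longleftrightarrow> 0 < skew h \<gamma> (act y (simple_root j))" unfolding yj .
  qed (use y j in auto)
  from root_lift_eq[OF JS this] root_lift_eq[OF I x(1)] show ?thesis
    using cl x(2) yj by simp
qed

end

subsection \<open>Reflections and Coxeter elements\<close>

context group
begin

lemma list_prod_commute:
  assumes "x \<in> carrier G" "set ys \<subseteq> carrier G" "\<And>y. y \<in> set ys \<Longrightarrow> x \<otimes> y = y \<otimes> x"
  shows "x \<otimes> list_prod G ys = list_prod G ys \<otimes> x"
  using assms(2,3)
proof (induction ys)
  case (Cons y ys)
  have c: "y \<in> carrier G" "list_prod G ys \<in> carrier G"
    using Cons.prems list_prod_closed by auto
  have IH: "x \<otimes> list_prod G ys = list_prod G ys \<otimes> x" using Cons by simp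
  have "x \<otimes> list_prod G (y # ys) = y \<otimes> (x \<otimes> list_prod G ys)"
    using Cons.prems(2)[of y] c assms(1) by (simp flip: m_assoc)
  also have "\<dots> = list_prod G (y # ys) \<otimes> x"
    unfolding IH using c assms(1) by (simp add: m_assoc)
  finally show ?case .
qed (use assms in simp)

lemma list_prod_remove:
  assumes "f ` set xs \<subseteq> carrier G" "\<And>x y. x \<in> set xs \<Longrightarrow> y \<in> set xs \<Longrightarrow> f x \<otimes> f y = f y \<otimes> f x"
    and "distinct xs" "s \<in> set xs"
  shows "list_prod G (map f xs) = f s \<otimes> list_prod G (map f (filter (\<lambda>x. x \<noteq> s) xs))"
    and "list_prod G (map f xs) = list_prod G (map f (filter (\<lambda>x. x \<noteq> s) xs)) \<otimes> f s"
proof -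
  obtain us vs where xs: "xs = us @ s # vs" using assms(4) by (metis split_list)
  have fl: "filter (\<lambda>x. x \<noteq> s) xs = us @ vs"
    using assms(3) unfolding xs by (auto simp: filter_id_conv intro!: arg_cong2[where f = append])
  have c: "set (map f us) \<subseteq> carrier G" "set (map f vs) \<subseteq> carrier G" "f s \<in> carrier G"
    using assms(1) by (auto simp: xs)
  note d = list_prod_closed[OF c(1)] list_prod_closed[OF c(2)]
  have 1: "f s \<otimes> list_prod G (map f us) = list_prod G (map f us) \<otimes> f s"
    using c assms(2)[of s] by (intro list_prod_commute) (auto simp: xs)
  have 2: "f s \<otimes> list_prod G (map f (us @ vs)) = list_prod G (map f (us @ vs)) \<otimes> f s"
    using c assms(2)[of s] by (intro list_prod_commute) (auto simp: xs)
  have "list_prod G (map f xs) = list_prod G (map f us) \<otimes> (f s \<otimes> list_prod G (map f vs))"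
    unfolding xs using list_prod_append[of "map f us" "map f (s # vs)"] c by simp
  also have "\<dots> = f s \<otimes> list_prod G (map f (us @ vs))"
    using 1 list_prod_append[OF c(1,2)] c d by (simp flip: m_assoc)
  finally show A: "list_prod G (map f xs) = f s \<otimes> list_prod G (map f (filter (\<lambda>x. x \<noteq> s) xs))"
    unfolding fl .
  show "list_prod G (map f xs) = list_prod G (map f (filter (\<lambda>x. x \<noteq> s) xs)) \<otimes> f s"
    unfolding A unfolding fl by (rule 2)
qed

end

lemma ex_separating_functional:
  fixes v :: "'v::real_vector"
  assumes "v \<notin> span U"
  obtains g :: "'v \<Rightarrow> real" where "linear g" "\<And>u. u \<in> U \<Longrightarrow> g u = 0" "g v \<noteq> 0"
proof -
  obtain B where B: "B \<subseteq> U" "independent B" "U \<subseteq> span B"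
    using maximal_independent_subset by blast
  have sp: "span B = span U" using B by (metis span_mono span_span subset_antisym)
  then have i: "independent (insert v B)" using B assms by (simp add: independent_insert)
  from linear_independent_extend[OF i, of "\<lambda>x. if x = v then 1 else 0"]
  obtain g :: "'v \<Rightarrow> real" where g: "linear g" "\<And>x. x \<in> insert v B \<Longrightarrow> g x = (if x = v then 1 else 0)"
    by blast
  have "v \<notin> B" using assms sp span_base by metis
  then have "g x = 0" if "x \<in> B" for x using g(2)[of x] that by auto
  then have "g u = 0" if "u \<in> span B" for u
    using linear_eq_on_span[OF g(1) linear_zero] that by auto
  then show thesis using that[of g] g B(3) by (metis insertI1 subsetD zero_neq_one)
qed

context finite_coxeter
begin

definition reflections :: "'a set" where
  "reflections = {reflect x s |x s. x \<in> carrier W \<and> s \<in> S}"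

text \<open>A reflection has two opposite roots; the positive one depends on the reflection alone by
  \<open>root_of_eq\<close>.\<close>

definition root_of :: "'a \<Rightarrow> 'a \<Rightarrow> real" where
  "root_of t = (SOME \<beta>. nonneg \<beta> \<and>
    (\<exists>x s. x \<in> carrier W \<and> s \<in> S \<and> t = reflect x s \<and> \<beta> = act x (simple_root s)))"

definition reflections_in :: "'a set \<Rightarrow> 'a set" where
  "reflections_in I = {t \<in> reflections. root_of t \<in> coords I}"

lemma reflections_cases:
  assumes "t \<in> reflections"
  obtains x s where "x \<in> carrier W" "s \<in> S" "t = reflect x s" "root_of t = act x (simple_root s)"
    "nonneg (root_of t)"
proof -
  obtain x s where xs: "x \<in> carrier W" "s \<in> S" "t = reflect x s"
    using assms by (auto simp: reflections_def)
  have "\<exists>\<beta>. nonneg \<beta> \<and> (\<exists>x s. x \<in> carrier W \<and> s \<in> S \<and> t = reflect x s \<and> \<beta> = act x (simple_root s))"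
  proof (cases "nonneg (act x (simple_root s))")
    case True
    then show ?thesis using xs by blast
  next
    case False
    have xs': "x \<otimes> s \<in> carrier W" using xs by simp
    have e: "act (x \<otimes> s) (simple_root s) = - act x (simple_root s)"
      using xs by (simp add: act_mult act_simple_self act_simps)
    have "nonneg (act (x \<otimes> s) (simple_root s))"
      unfolding e using False root_cases act_roots xs by blast
    moreover have "reflect (x \<otimes> s) s = reflect x s"
      using e xs by (intro reflect_eq) simp_all
    ultimately show ?thesis using xs xs' by metis
  qed
  from someI_ex[OF this] show thesis
    using that unfolding root_of_def by blast
qed

lemma root_of_eq:
  assumes "x \<in> carrier W" "s \<in> S" "nonneg (act x (simple_root s))"
  shows "root_of (reflect x s) = act x (simple_root s)"
proof -
  have "reflect x s \<in> reflections" using assms by (auto simp: reflections_def)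
  then obtain y t where y: "y \<in> carrier W" "t \<in> S" "reflect x s = reflect y t"
    "root_of (reflect x s) = act y (simple_root t)" "nonneg (root_of (reflect x s))"
    by (rule reflections_cases)
  have "act y (simple_root t) \<in> roots" using y act_roots by simp
  then show ?thesis
    using reflect_eq_root[OF assms(1,2) y(1,2,3)] y(4,5) assms(3) root_not_both by metis
qed

lemma reflections_closed [simp]: "t \<in> reflections \<Longrightarrow> t \<in> carrier W"
  by (auto simp: reflections_def)

lemma root_of_pos: "t \<in> reflections \<Longrightarrow> root_of t \<in> pos_roots S"
  by (erule reflections_cases) (auto simp: pos_roots_def intro!: act_roots subsetD[OF roots_coords])

lemma reflections_in_pos: "t \<in> reflections_in I \<Longrightarrow> root_of t \<in> pos_roots I"
  using root_of_pos by (auto simp: reflections_in_def pos_roots_def)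

lemma reflect_one: "s \<in> S \<Longrightarrow> reflect \<one> s = s"
  by (simp add: reflect_def)

lemma S_reflections: "s \<in> S \<Longrightarrow> s \<in> reflections"
  unfolding reflections_def using reflect_one by force

lemma root_of_S: "s \<in> S \<Longrightarrow> root_of s = simple_root s"
  using root_of_eq[of \<one> s] by (simp add: reflect_one)

lemma reflect_conj:
  assumes "g \<in> carrier W" "x \<in> carrier W" "s \<in> S"
  shows "g \<otimes> reflect x s \<otimes> inv g = reflect (g \<otimes> x) s"
  using assms by (simp add: reflect_def inv_mult_group m_assoc)

lemma reflections_conj: "g \<in> carrier W \<Longrightarrow> t \<in> reflections \<Longrightarrow> g \<otimes> t \<otimes> inv g \<in> reflections"
  unfolding reflections_def using reflect_conj by (auto, metis m_closed)

lemma reflections_conj': "g \<in> carrier W \<Longrightarrow> t \<in> reflections \<Longrightarrow> inv g \<otimes> t \<otimes> g \<in> reflections"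
  using reflections_conj[of "inv g" t] by simp

lemma root_of_conj:
  assumes g: "g \<in> carrier W" and t: "t \<in> reflections"
  shows "root_of (g \<otimes> t \<otimes> inv g)
    = (if nonneg (act g (root_of t)) then act g (root_of t) else - act g (root_of t))"
proof -
  obtain x s where x: "x \<in> carrier W" "s \<in> S" "t = reflect x s" "root_of t = act x (simple_root s)"
    using reflections_cases[OF t] by metis
  have gx: "g \<otimes> x \<in> carrier W" "g \<otimes> x \<otimes> s \<in> carrier W" using g x by auto
  have e: "act (g \<otimes> x) (simple_root s) = act g (root_of t)"
    "act (g \<otimes> x \<otimes> s) (simple_root s) = - act g (root_of t)"
    using g x by (simp_all add: act_mult act_simple_self act_simps)
  have r: "act g (root_of t) \<in> roots" unfolding e(1)[symmetric] using gx x act_roots by auto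
  have c: "g \<otimes> t \<otimes> inv g = reflect (g \<otimes> x) s" unfolding x(3) using reflect_conj g x by simp
  show ?thesis
  proof (cases "nonneg (act g (root_of t))")
    case True
    then show ?thesis using root_of_eq[OF gx(1) x(2)] e c by simp
  next
    case False
    have "reflect (g \<otimes> x) s = reflect (g \<otimes> x \<otimes> s) s"
      using e gx x by (intro reflect_eq) auto
    moreover have "nonneg (- act g (root_of t))" using False root_cases[OF r] by blast
    ultimately show ?thesis using root_of_eq[OF gx(2) x(2)] e c False by simp
  qed
qed

lemma reflections_in_conj:
  assumes I: "I \<subseteq> S" and g: "g \<in> generate W I" and t: "t \<in> reflections_in I"
  shows "g \<otimes> t \<otimes> inv g \<in> reflections_in I"
proof -
  have gW: "g \<in> carrier W" using generate_closed I g by blast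
  have tr: "t \<in> reflections" using t by (simp add: reflections_in_def)
  have "act g (root_of t) \<in> coords I" using act_coords[OF I g] t by (simp add: reflections_in_def)
  moreover from this have "- act g (root_of t) \<in> coords I" by (simp add: coords_def)
  ultimately show ?thesis
    using root_of_conj[OF gW tr] reflections_conj[OF gW tr] by (simp add: reflections_in_def)
qed

lemma root_of_inj:
  assumes "t \<in> reflections" "u \<in> reflections" "root_of t = root_of u"
  shows "t = u"
proof -
  obtain x s where x: "x \<in> carrier W" "s \<in> S" "t = reflect x s" "root_of t = act x (simple_root s)"
    using reflections_cases[OF assms(1)] by metis
  obtain y r where y: "y \<in> carrier W" "r \<in> S" "u = reflect y r" "root_of u = act y (simple_root r)"
    using reflections_cases[OF assms(2)] by metis
  show ?thesis unfolding x(3) y(3) using x y assms(3) by (intro reflect_eq) auto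
qed

lemma reflections_square:
  assumes "t \<in> reflections"
  shows "t \<otimes> t = \<one>"
proof -
  obtain x s where x: "x \<in> carrier W" "s \<in> S" and t: "t = reflect x s"
    using reflections_cases[OF assms] by metis
  have e: "inv x \<otimes> (x \<otimes> y) = y" if "y \<in> carrier W" for y
    using m_assoc[of "inv x" x y] that x(1) by simp
  have "t \<otimes> t = x \<otimes> (s \<otimes> (inv x \<otimes> (x \<otimes> (s \<otimes> inv x))))"
    unfolding t reflect_def by (simp only: m_assoc m_closed inv_closed X_closed x)
  also have "\<dots> = \<one>"
    using x by (simp only: e m_closed inv_closed X_closed X_cancel r_inv)
  finally show ?thesis .
qed

lemma act_reflection:
  assumes "t \<in> reflections"
  shows "act t v = v - (2 * bil (root_of t) v) *\<^sub>R root_of t"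
  using assms by (elim reflections_cases) (metis act_reflect)

section \<open>Coxeter elements: fixed vectors and factorizations into reflections\<close>

lemma fixed_by_coxeter:
  assumes "distinct xs" "set xs \<subseteq> S" "act (list_prod W xs) v = v"
  shows "\<forall>s\<in>set xs. act s v = v"
  using assms
proof (induction xs)
  case (Cons s ys)
  have s: "s \<in> S" and ys: "set ys \<subseteq> S" "list_prod W ys \<in> carrier W" and d: "s \<notin> set ys"
    using Cons.prems by auto
  have "act s (act (list_prod W ys) v) = v" using Cons.prems s ys by (simp add: act_mult)
  then have e: "act (list_prod W ys) v = act s v"
    using s by (metis X_closed X_inv act_inv(1))
  \<comment> \<open>The other letters do not touch the coordinate at \<open>s\<close>, so the first
    letter may not change it either, that is, it fixes \<open>v\<close>.\<close>
  have "list_prod W ys \<in> generate W (set ys)" by (intro list_prod_in_generate) (auto intro: generate.incl)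
  then have "act (list_prod W ys) v s = v s" using act_generate_outside[OF ys(1) _ d] by blast
  then have "pair s v = 0" using e s by (simp add: act_apply)
  then have "act s v = v" using s by (simp add: act_S_eq)
  then show ?case using Cons e by simp
qed simp

text \<open>The support of \<open>w\<close> is the point: in \<open>functional_invariant\<close> it
  separates the last letter from the others.\<close>

lemma functional_expand:
  assumes "set xs \<subseteq> S" "linear (g :: ('a \<Rightarrow> real) \<Rightarrow> real)"
  shows "\<exists>w\<in>coords (set xs). \<forall>v. g (act (list_prod W xs) v) = g v - bil w v"
  using assms(1)
proof (induction xs)
  case Nil
  have "0 \<in> coords (set [])" by (simp add: coords_def)
  moreover have "g (act (list_prod W []) v) = g v - bil 0 v" for v
    by (simp only: list_prod_simps act_one bil_left diff_zero)
  ultimately show ?case by blast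
next
  case (Cons s ys)
  then obtain w where w: "w \<in> coords (set ys)" "\<And>v. g (act (list_prod W ys) v) = g v - bil w v" by auto
  let ?p = "list_prod W ys"
  have s: "s \<in> S" "set (s # ys) \<subseteq> S" and p: "?p \<in> carrier W" using Cons.prems by auto
  have "?p \<in> generate W (set (s # ys))" by (intro list_prod_in_generate) (auto intro: generate.incl)
  then have "inv ?p \<in> generate W (set (s # ys))" using generate_inv s by blast
  from act_coords[OF s(2) this, of "simple_root s"]
  have u: "act (inv ?p) (simple_root s) \<in> coords (set (s # ys))" by simp
  let ?w = "w + (2 * g (simple_root s)) *\<^sub>R act (inv ?p) (simple_root s)"
  have "?w \<in> coords (set (s # ys))" using u w(1) by (auto simp: coords_def)
  moreover have "g (act (list_prod W (s # ys)) v) = g v - bil ?w v" for v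
  proof -
    have "pair s (act ?p v) = bil (act (inv ?p) (simple_root s)) v"
      using bil_act[of "inv ?p" "simple_root s" "act ?p v"] p s by simp
    moreover have "g (act (list_prod W (s # ys)) v) = g (act ?p v) - 2 * pair s (act ?p v) * g (simple_root s)"
      using p s by (simp add: act_mult act_S_eq linear_diff[OF assms(2)] linear_scale[OF assms(2)])
    ultimately show ?thesis using w(2) by simp
  qed
  ultimately show ?case by blast
qed

text \<open>The dual of \<open>fixed_by_coxeter\<close>. The last letter and the remaining word
  change \<open>g\<close> by the same functional, which is represented by a multiple of the simple
  root of \<open>s\<close> and by a vector supported on the other letters. The form is nondegenerate
  by \<open>fixed_coords_zero\<close>, so the two coincide and the multiple is zero.\<close>

lemma functional_invariant:
  assumes "distinct xs" "set xs \<subseteq> S" "linear (g :: ('a \<Rightarrow> real) \<Rightarrow> real)"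
    and "\<And>v. g (act (list_prod W xs) v) = g v"
  shows "\<forall>s\<in>set xs. g (simple_root s) = 0"
  using assms(1,2,4)
proof (induction xs rule: rev_induct)
  case (snoc s ys)
  have s: "s \<in> S" "s \<notin> set ys" and ys: "set ys \<subseteq> S" using snoc.prems by auto
  have e: "g (act (list_prod W ys) v) = g (act s v)" for v
  proof -
    have "g (act (list_prod W (ys @ [s])) (act s v)) = g (act s v)" using snoc.prems(3) .
    moreover have "act (list_prod W (ys @ [s])) (act s v) = act (list_prod W ys) v"
      using s ys by (simp add: X_words_append S_square flip: act_mult)
    ultimately show ?thesis by simp
  qed
  obtain w where w: "w \<in> coords (set ys)" "\<And>v. g (act (list_prod W ys) v) = g v - bil w v"
    using functional_expand[OF ys assms(3)] by blast
  let ?w = "w - (2 * g (simple_root s)) *\<^sub>R simple_root s"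
  have "g (act s v) = g v - 2 * g (simple_root s) * pair s v" for v
    using s by (simp add: act_S_eq linear_diff[OF assms(3)] linear_scale[OF assms(3)])
  then have "bil ?w v = 0" for v using e[of v] w(2)[of v] s by simp
  then have "pair r ?w = 0" if "r \<in> S" for r
    using that bil_simple_right by metis
  moreover have "?w \<in> coords S" using w(1) s ys by (auto simp: coords_def)
  ultimately have "?w = 0"
    by (intro fixed_coords_zero[of S]) (auto simp: act_S_eq)
  then have "?w s = 0" by simp
  then have g0: "g (simple_root s) = 0" using w(1) s by (auto simp: coords_def)
  then have es: "g (act s v) = g v" for v
    using s by (simp add: act_S_eq linear_diff[OF assms(3)] linear_scale[OF assms(3)])
  have "\<forall>r\<in>set ys. g (simple_root r) = 0"
    by (rule snoc.IH) (use snoc.prems e es in auto)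
  then show ?case using g0 by (simp del: simple_root_apply)
qed simp

lemma subspace_coords: "subspace (coords I)"
  by (auto simp: subspace_def coords_def)

lemma independent_simple: "finite (I :: 'a set) \<Longrightarrow> independent (simple_root ` I)"
proof (induction I rule: finite_induct)
  case (insert s I)
  have "span (simple_root ` I) \<subseteq> coords I"
    by (rule span_minimal[OF _ subspace_coords]) auto
  then have "simple_root s \<notin> span (simple_root ` I)" using insert.hyps by auto
  then show ?case using insert by (simp add: independent_insert del: simple_root_apply)
qed (simp add: independent_empty)

text \<open>A functional that vanishes on the roots of all factors is invariant under each factor,
  hence under the Coxeter element, and so vanishes on the simple roots.\<close>

lemma span_factorization:
  assumes xs: "distinct xs" "set xs \<subseteq> S" and ts: "set ts \<subseteq> reflections"
    and eq: "list_prod W xs = list_prod W ts"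
  shows "simple_root ` set xs \<subseteq> span (root_of ` set ts)"
proof (rule ccontr)
  assume "\<not> simple_root ` set xs \<subseteq> span (root_of ` set ts)"
  then obtain s where s: "s \<in> set xs" "simple_root s \<notin> span (root_of ` set ts)" by auto
  obtain g :: "('a \<Rightarrow> real) \<Rightarrow> real" where g: "linear g" "\<And>u. u \<in> root_of ` set ts \<Longrightarrow> g u = 0"
    "g (simple_root s) \<noteq> 0" using ex_separating_functional[OF s(2)] by blast
  have "list_prod W us \<in> carrier W \<and> g (act (list_prod W us) v) = g v" if "set us \<subseteq> set ts" for us v
    using that
  proof (induction us)
    case (Cons t us)
    then have t: "t \<in> reflections" "g (root_of t) = 0" using ts g(2) by auto
    have "g (act t v) = g v" for v
      using t by (simp add: act_reflection linear_diff[OF g(1)] linear_scale[OF g(1)])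
    then show ?case using Cons t by (simp add: act_mult)
  qed simp
  then have "g (act (list_prod W xs) v) = g v" for v using eq by auto
  from functional_invariant[OF xs g(1) this] show False using s g(3) by blast
qed

text \<open>The simple roots are independent, which turns \<open>span_factorization\<close> into a
  dimension count. If the lengths are equal, a root of a factor outside the span of the simple roots
  would make the independent set too large.\<close>

lemma factorization_length:
  assumes xs: "distinct xs" "set xs \<subseteq> S" and ts: "set ts \<subseteq> reflections"
    and eq: "list_prod W xs = list_prod W ts"
  shows "length xs \<le> length ts"
    and "length ts = length xs \<Longrightarrow> set ts \<subseteq> reflections_in (set xs)"
proof -
  let ?U = "root_of ` set ts" and ?B = "simple_root ` set xs"
  have inj: "inj_on simple_root (set xs)" by (auto intro: inj_onI)
  have B: "independent ?B" "card ?B = length xs" "?B \<subseteq> span ?U"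
    using independent_simple span_factorization[OF assms] card_image[OF inj] xs(1)
    by (auto simp: distinct_card)
  have U: "finite ?U" "card ?U \<le> length ts"
    using card_image_le[of "set ts" root_of] card_length[of ts] by auto
  show "length xs \<le> length ts"
    using independent_span_bound[OF U(1) B(1,3)] B(2) U(2) by simp
  assume l: "length ts = length xs"
  have "root_of t \<in> coords (set xs)" if t: "t \<in> set ts" for t
  proof -
    have sub: "span ?B \<subseteq> coords (set xs)"
      by (rule span_minimal[OF _ subspace_coords]) auto
    have "root_of t \<in> span ?B"
    proof (rule ccontr)
      assume n: "root_of t \<notin> span ?B"
      have "root_of t \<notin> ?B" using n span_base by metis
      moreover have "independent (insert (root_of t) ?B)"
        using n B(1) by (simp add: independent_insert)
      moreover have "insert (root_of t) ?B \<subseteq> span ?U" using B(3) t by (auto intro: span_base)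
      ultimately have "card (insert (root_of t) ?B) \<le> card ?U" "root_of t \<notin> ?B"
        using independent_span_bound[OF U(1)] by blast+
      then show False using B(2) U(2) l by simp
    qed
    then show ?thesis using sub by blast
  qed
  then show "set ts \<subseteq> reflections_in (set xs)" using ts by (auto simp: reflections_in_def)
qed

text \<open>While the letters are applied one by one, the sign changes at some letter, and before
  this step the root was the simple root of that letter.\<close>

lemma inversion_of_word:
  assumes "set xs \<subseteq> S" "\<gamma> \<in> roots" "nonneg \<gamma>" "\<not> nonneg (act (inv (list_prod W xs)) \<gamma>)"
  shows "\<exists>ys s zs. xs = ys @ s # zs \<and> \<gamma> = act (list_prod W ys) (simple_root s)"
  using assms
proof (induction xs arbitrary: \<gamma>)
  case (Cons s xs)
  have s: "s \<in> S" and xs: "set xs \<subseteq> S" "list_prod W xs \<in> carrier W" using Cons.prems by auto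
  show ?case
  proof (cases "\<gamma> = simple_root s")
    case True
    then show ?thesis by (intro exI[of _ "[]"]) auto
  next
    case False
    have p: "nonneg (act s \<gamma>)" "act s \<gamma> \<in> roots"
      using act_simple_nonneg[OF s Cons.prems(2,3) False] act_roots s Cons.prems by auto
    have "act (inv (list_prod W (s # xs))) \<gamma> = act (inv (list_prod W xs)) (act s \<gamma>)"
      using s xs by (simp add: inv_mult_group act_mult)
    then have "\<not> nonneg (act (inv (list_prod W xs)) (act s \<gamma>))" using Cons.prems(4) by simp
    from Cons.IH[OF xs(1) p(2,1) this] obtain ys r zs
      where "xs = ys @ r # zs" "act s \<gamma> = act (list_prod W ys) (simple_root r)" by blast
    moreover from this have "\<gamma> = act (list_prod W (s # ys)) (simple_root r)"
      using s xs act_inv(1)[OF X_closed[OF s], of \<gamma>] by (simp add: act_mult)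
    ultimately show ?thesis by (metis append_Cons)
  qed
qed simp

text \<open>If all \<open>c\<^sup>-\<^sup>k \<beta>\<close> were positive, their sum would be a nonzero vector fixed by \<open>c\<close>.\<close>

lemma coxeter_orbit_sign_change:
  assumes xs: "distinct xs" "set xs \<subseteq> S" and b: "\<beta> \<in> roots" "nonneg \<beta>" "\<beta> \<in> coords (set xs)"
  shows "\<exists>k. nonneg (act (inv (list_prod W xs) [^] (k::nat)) \<beta>)
    \<and> \<not> nonneg (act (inv (list_prod W xs) [^] Suc k) \<beta>)"
proof (rule ccontr)
  let ?c = "list_prod W xs"
  define d where "d = inv ?c"
  assume *: "\<not> ?thesis"
  have c: "?c \<in> carrier W" "d \<in> carrier W" using xs by (auto simp: d_def)
  have pos: "nonneg (act (d [^] (k::nat)) \<beta>)" for k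
  proof (induction k)
    case 0
    then show ?case using b by simp
  next
    case (Suc k)
    then show ?case using * unfolding d_def by blast
  qed
  define v where "v = (\<Sum>k<ord d. act (d [^] k) \<beta>)"
  have n: "ord d > 0" using ord_pos c by simp
  have step: "act (d [^] Suc k) \<beta> = act d (act (d [^] k) \<beta>)" for k
    unfolding nat_pow_Suc2[OF c(2)] using c by (simp add: act_mult)
  have "act d v = (\<Sum>k<ord d. act (d [^] Suc k) \<beta>)"
    unfolding v_def act_simps(6)[OF c(2)] step ..
  also have "\<dots> = (\<Sum>k<ord d. act (d [^] k) \<beta>)"
  proof -
    have "(\<Sum>k<ord d. act (d [^] Suc k) \<beta>) + act (d [^] (0::nat)) \<beta> = (\<Sum>k<Suc (ord d). act (d [^] k) \<beta>)"
      by (simp only: sum.lessThan_Suc_shift add.commute)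
    also have "\<dots> = (\<Sum>k<ord d. act (d [^] k) \<beta>) + act (d [^] (0::nat)) \<beta>"
      using c pow_ord_eq_1 by (simp only: sum.lessThan_Suc nat_pow_0)
    finally show ?thesis by (simp only: add_right_cancel)
  qed
  finally have "act d v = v" unfolding v_def .
  then have "act ?c v = v" using c unfolding d_def by (metis act_inv(2))
  then have fixed: "act s v = v" if "s \<in> set xs" for s using fixed_by_coxeter[OF xs] that by blast
  have "?c \<in> generate W (set xs)" by (intro list_prod_in_generate) (auto intro: generate.incl)
  then have dI: "d \<in> generate W (set xs)" unfolding d_def using generate_inv xs by blast
  have "d [^] (k::nat) \<in> generate W (set xs)" for k
    by (induction k) (auto intro: generate.one generate.eng dI)
  then have "v \<in> coords (set xs)"
    unfolding v_def using act_coords[OF xs(2) _ b(3)]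
    by (intro subspace_sum[OF subspace_coords]) blast
  from fixed_coords_zero[OF xs(2) this fixed] have "v = 0" .
  moreover have "v = \<beta> + (\<Sum>k\<in>{..<ord d} - {0}. act (d [^] k) \<beta>)"
    unfolding v_def using n by (subst sum.remove[of _ 0]) simp_all
  ultimately have "- \<beta> = (\<Sum>k\<in>{..<ord d} - {0}. act (d [^] k) \<beta>)"
    by (metis minus_unique)
  moreover have "nonneg (\<Sum>k\<in>{..<ord d} - {0}. act (d [^] k) \<beta>)" using pos by (intro nonneg_sum)
  ultimately have "nonneg (- \<beta>)" by simp
  then show False using root_not_both[OF b(1)] b(2) by blast
qed

end

subsection \<open>Rotation by a bipartite Coxeter element\<close>

lemma prefix_of_left_part: "ys @ s # zs = l @ r \<Longrightarrow> s \<notin> set r \<Longrightarrow> set ys \<subseteq> set l"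
proof (induction l arbitrary: ys)
  case (Cons a l)
  then show ?case by (cases ys) auto
qed auto

lemma suffix_of_right_part: "ys @ s # zs = l @ r \<Longrightarrow> s \<notin> set l \<Longrightarrow> set zs \<subseteq> set r"
proof (induction l arbitrary: ys)
  case (Cons a l)
  then show ?case by (cases ys) auto
qed auto

context group
begin

lemma inv_cancel:
  assumes "x \<in> carrier G" "y \<in> carrier G"
  shows "inv x \<otimes> (x \<otimes> y) = y" "x \<otimes> (inv x \<otimes> y) = y"
  using assms m_assoc[of "inv x" x y] m_assoc[of x "inv x" y] by simp_all

lemma conj_mult:
  assumes "g \<in> carrier G" "h \<in> carrier G" "t \<in> carrier G"
  shows "inv (g \<otimes> h) \<otimes> t \<otimes> (g \<otimes> h) = inv h \<otimes> (inv g \<otimes> t \<otimes> g) \<otimes> h"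
  using assms by (simp add: inv_mult_group m_assoc)

lemma conj_solve:
  assumes "g \<in> carrier G" "t \<in> carrier G" "u \<in> carrier G"
  shows "inv g \<otimes> t \<otimes> g = u \<longleftrightarrow> t = g \<otimes> u \<otimes> inv g"
proof
  assume u: "inv g \<otimes> t \<otimes> g = u"
  have "g \<otimes> u \<otimes> inv g = (g \<otimes> inv g) \<otimes> t \<otimes> (g \<otimes> inv g)"
    unfolding u[symmetric] using assms by (simp only: m_assoc inv_closed m_closed)
  then show "t = g \<otimes> u \<otimes> inv g" using assms by simp
next
  assume "t = g \<otimes> u \<otimes> inv g"
  then have "inv g \<otimes> t \<otimes> g = (inv g \<otimes> g) \<otimes> u \<otimes> (inv g \<otimes> g)"
    using assms by (simp only: m_assoc inv_closed m_closed)
  then show "inv g \<otimes> t \<otimes> g = u" using assms by simp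
qed

end

context finite_coxeter
begin

primrec fire_list :: "('a \<Rightarrow> int) \<Rightarrow> 'a list \<Rightarrow> 'a \<Rightarrow> int" where
  "fire_list h [] = h"
| "fire_list h (s # xs) = fire_list (fire h s) xs"

primrec firable :: "'a set \<Rightarrow> ('a \<Rightarrow> int) \<Rightarrow> 'a list \<Rightarrow> bool" where
  "firable I h [] \<longleftrightarrow> True"
| "firable I h (s # xs) \<longleftrightarrow> source I h s \<and> firable I (fire h s) xs"

lemma fire_list_eq: "distinct xs \<Longrightarrow> fire_list h xs x = h x + (if x \<in> set xs then 2 else 0)"
  by (induction xs arbitrary: h) (auto simp: fire_def)

lemma firable_append: "firable I h (xs @ ys) \<longleftrightarrow> firable I h xs \<and> firable I (fire_list h xs) ys"
  by (induction xs arbitrary: h) auto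

text \<open>Firing one letter of the block does not disturb the others: they are not adjacent to it,
  and all their neighbours lie outside the block.\<close>

lemma firable_block:
  assumes "distinct xs" "set xs \<subseteq> I"
    and "\<And>s t. s \<in> set xs \<Longrightarrow> t \<in> I \<Longrightarrow> t \<noteq> s \<Longrightarrow> cox_b s t \<noteq> 0 \<Longrightarrow> t \<notin> set xs \<and> h t = h s + 1"
  shows "firable I h xs"
  using assms
proof (induction xs arbitrary: h)
  case (Cons s xs)
  have "source I h s" using Cons.prems(2) Cons.prems(3)[of s] by (simp add: source_def)
  moreover have "firable I (fire h s) xs"
  proof (rule Cons.IH)
    fix a t assume at: "a \<in> set xs" "t \<in> I" "t \<noteq> a" "cox_b a t \<noteq> 0"
    then have "t \<notin> set (s # xs) \<and> h t = h a + 1" using Cons.prems(3)[of a t] by simp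
    moreover have "a \<noteq> s" using at Cons.prems(1) by auto
    ultimately show "t \<notin> set xs \<and> fire h s t = fire h s a + 1" by (auto simp: fire_def)
  qed (use Cons.prems(1,2) in auto)
  ultimately show ?case by simp
qed simp

text \<open>A constant summand of the height adds the same multiple of \<open>bil u v\<close> to
  both terms of the difference.\<close>

lemma skew_shift:
  assumes "\<And>s. s \<in> I \<Longrightarrow> h' s = h s + d" "u \<in> coords I" "v \<in> coords I"
  shows "skew h' u v = skew h u v"
proof -
  have "twist h' w = twist h w + of_int d *\<^sub>R w" if "w \<in> coords I" for w
  proof
    fix x show "twist h' w x = (twist h w + of_int d *\<^sub>R w) x"
      using that assms(1)[of x] by (cases "x \<in> I") (simp_all add: twist_def coords_def algebra_simps)
  qed
  then show ?thesis using assms(2,3) by (simp add: skew_def)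
qed

lemma good_shift:
  assumes "I \<subseteq> S" "\<And>s. s \<in> I \<Longrightarrow> h' s = h s + d" "good I h x s"
  shows "good I h' x s"
proof -
  let ?b = "act x (simple_root s)"
  have xs: "x \<in> generate W I" "s \<in> I" "nonneg ?b" using assms(3) by (simp_all only: good_def)
  have b: "?b \<in> coords I" using act_coords[OF assms(1) xs(1)] xs(2) by simp
  show ?thesis
    unfolding good_def
  proof (intro conjI ballI impI xs)
    fix \<gamma> assume g: "\<gamma> \<in> pos_roots I" "bil \<gamma> ?b \<noteq> 0 \<and> \<gamma> \<noteq> ?b"
    have "skew h' \<gamma> ?b = skew h \<gamma> ?b"
      by (rule skew_shift[OF assms(2) pos_roots_D(3)[OF g(1)] b])
    then show "nonneg (- act (inv x) \<gamma>) \<longleftrightarrow> 0 < skew h' \<gamma> ?b"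
      using assms(3) g unfolding good_def by metis
  qed
qed

end

context braid_target
begin

lemma root_lift_shift:
  assumes "I \<subseteq> S" "\<And>s. s \<in> I \<Longrightarrow> h' s = h s + d"
  shows "root_lift I h' \<beta> = root_lift I h \<beta>"
proof -
  have "good I h' x s \<longleftrightarrow> good I h x s" for x s
    using good_shift[OF assms(1), of h' h d] good_shift[OF assms(1), of h h' "- d"] assms(2) by auto
  then show ?thesis by (simp add: root_lift_def)
qed

lemma root_lift_closed:
  assumes "I \<subseteq> S" "height_on I h" "\<beta> \<in> pos_roots I"
  shows "root_lift I h \<beta> \<in> carrier A"
  using ex_good[OF assms] root_lift_eq[OF assms(1)] good_D[OF _ assms(1)] conj_lift_closed by metis

text \<open>Passing from roots to reflections removes the exception in
  \<open>root_lift_fire\<close>: for \<open>t = s\<close> both sides are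
  \<open>\<theta> s\<close>.\<close>

lemma refl_lift_fire:
  assumes I: "I \<subseteq> S" and h: "height_on I h" and s: "source I h s" and t: "t \<in> reflections_in I"
  shows "root_lift I (fire h s) (root_of (s \<otimes> t \<otimes> s))
    = inv\<^bsub>A\<^esub> \<theta> s \<otimes>\<^bsub>A\<^esub> root_lift I h (root_of t) \<otimes>\<^bsub>A\<^esub> \<theta> s"
proof -
  have sI: "s \<in> I" "s \<in> S" using s I by (auto simp: source_def)
  have b: "root_of t \<in> pos_roots I" using reflections_in_pos[OF t] .
  have tr: "t \<in> reflections" using t by (simp add: reflections_in_def)
  show ?thesis
  proof (cases "root_of t = simple_root s")
    case True
    then have ts: "t = s" using root_of_inj[OF tr S_reflections[OF sI(2)]] root_of_S[OF sI(2)] by simp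
    have "s \<otimes> t \<otimes> s = s" using ts sI by simp
    then show ?thesis
      using root_lift_simple[OF I h sI(1)] root_lift_simple[OF I height_fire[OF h I s] sI(1)] sI ts
      by (simp add: root_of_S)
  next
    case False
    have "nonneg (act s (root_of t))"
      using act_simple_nonneg[OF sI(2) pos_roots_D(1)[OF b] pos_roots_D(2)[OF b] False] .
    then have "root_of (s \<otimes> t \<otimes> s) = act s (root_of t)"
      using root_of_conj[of s t] sI tr by simp
    then show ?thesis using root_lift_fire[OF I h s b False] by simp
  qed
qed

lemma refl_lift_fire_list:
  assumes "I \<subseteq> S" "height_on I h" "firable I h xs" "t \<in> reflections_in I"
  shows "root_lift I (fire_list h xs) (root_of (inv (list_prod W xs) \<otimes> t \<otimes> list_prod W xs))
    = inv\<^bsub>A\<^esub> word_lift xs \<otimes>\<^bsub>A\<^esub> root_lift I h (root_of t) \<otimes>\<^bsub>A\<^esub> word_lift xs"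
  using assms(2-)
proof (induction xs arbitrary: h t)
  case Nil
  have t: "t \<in> carrier W" using Nil by (simp add: reflections_in_def)
  have "root_lift I h (root_of t) \<in> carrier A"
    using root_lift_closed[OF assms(1)] reflections_in_pos Nil by blast
  then show ?case using t by (simp add: word_lift_def)
next
  case (Cons s xs)
  have s: "source I h s" "s \<in> I" "s \<in> S" using Cons.prems assms(1) by (auto simp: source_def)
  have f: "firable I (fire h s) xs" using Cons.prems by simp
  have "set xs \<subseteq> I" using f
  proof (induction xs arbitrary: h s)
    case (Cons a xs)
    then show ?case using Cons.IH[of "fire h s" a] by (auto simp: source_def)
  qed simp
  then have xs: "set xs \<subseteq> S" "list_prod W xs \<in> carrier W" using assms(1) by auto
  have t: "t \<in> carrier W" using Cons.prems by (simp add: reflections_in_def)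
  have "s \<otimes> t \<otimes> inv s \<in> reflections_in I"
    using s by (intro reflections_in_conj[OF assms(1) _ Cons.prems(3)] generate.incl)
  then have st: "s \<otimes> t \<otimes> s \<in> reflections_in I" using s by simp
  have w: "word_lift (s # xs) = \<theta> s \<otimes>\<^bsub>A\<^esub> word_lift xs" by (simp add: word_lift_def)
  have cl: "root_lift I h (root_of t) \<in> carrier A"
    using root_lift_closed[OF assms(1) Cons.prems(1)] reflections_in_pos[OF Cons.prems(3)] by blast
  have "root_lift I (fire_list h (s # xs)) (root_of (inv (list_prod W (s # xs)) \<otimes> t \<otimes> list_prod W (s # xs)))
    = root_lift I (fire_list (fire h s) xs) (root_of (inv (list_prod W xs) \<otimes> (s \<otimes> t \<otimes> s) \<otimes> list_prod W xs))"
    using conj_mult[of s "list_prod W xs" t] s xs t by simp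
  also have "\<dots> = inv\<^bsub>A\<^esub> word_lift xs \<otimes>\<^bsub>A\<^esub>
      (inv\<^bsub>A\<^esub> \<theta> s \<otimes>\<^bsub>A\<^esub> root_lift I h (root_of t) \<otimes>\<^bsub>A\<^esub> \<theta> s) \<otimes>\<^bsub>A\<^esub> word_lift xs"
    using Cons.IH[OF height_fire[OF Cons.prems(1) assms(1) s(1)] f st]
      refl_lift_fire[OF assms(1) Cons.prems(1) s(1) Cons.prems(3)] by simp
  also have "\<dots> = inv\<^bsub>A\<^esub> word_lift (s # xs) \<otimes>\<^bsub>A\<^esub> root_lift I h (root_of t) \<otimes>\<^bsub>A\<^esub> word_lift (s # xs)"
    unfolding w using A.conj_mult[of "\<theta> s" "word_lift xs"] s xs cl by simp
  finally show ?case .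
qed

end

text \<open>The two colour classes are kept as lists, which fixes an order for the products in
  \<open>W\<close> and in \<open>A\<close>.\<close>

locale bipartite_target = braid_target W S A \<theta>
  for W (structure) and S :: "'a set" and A :: "('c, 'd) monoid_scheme" and \<theta> +
  fixes lL lR :: "'a list"
  assumes lLR: "distinct (lL @ lR)" "set (lL @ lR) = S"
    and commL: "\<And>s t. s \<in> set lL \<Longrightarrow> t \<in> set lL \<Longrightarrow> s \<otimes> t = t \<otimes> s"
    and commR: "\<And>s t. s \<in> set lR \<Longrightarrow> t \<in> set lR \<Longrightarrow> s \<otimes> t = t \<otimes> s"
begin

definition cox_word :: "'a set \<Rightarrow> 'a list" where
  "cox_word I = filter (\<lambda>s. s \<in> I) (lL @ lR)"

definition cox :: "'a set \<Rightarrow> 'a" where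
  "cox I = list_prod W (cox_word I)"

definition cox_lift :: "'a set \<Rightarrow> 'c" where
  "cox_lift I = word_lift (cox_word I)"

text \<open>All edges point from the left class to the right class, so that \<open>lL @ lR\<close>
  is a firing sequence.\<close>

definition height :: "'a \<Rightarrow> int" where
  "height s = (if s \<in> set lL then 0 else 1)"

definition refl_lift :: "'a \<Rightarrow> 'c" where
  "refl_lift t = root_lift S height (root_of t)"

lemma LR_S: "s \<in> set lL \<Longrightarrow> s \<in> S" "s \<in> set lR \<Longrightarrow> s \<in> S" "s \<in> set lL \<Longrightarrow> s \<notin> set lR"
  using lLR by auto

lemma set_cox_word: "I \<subseteq> S \<Longrightarrow> set (cox_word I) = I"
  using lLR by (auto simp: cox_word_def)

lemma distinct_cox_word: "distinct (cox_word I)"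
  using lLR unfolding cox_word_def by (intro distinct_filter)

lemma length_cox_word: "I \<subseteq> S \<Longrightarrow> length (cox_word I) = card I"
  using set_cox_word distinct_cox_word distinct_card by metis

lemma cox_generate: "I \<subseteq> S \<Longrightarrow> cox I \<in> generate W I"
  unfolding cox_def using set_cox_word by (intro list_prod_in_generate) (auto intro: generate.incl)

lemma cox_closed [simp]: "I \<subseteq> S \<Longrightarrow> cox I \<in> carrier W"
  using cox_generate generate_closed by blast

lemma cox_lift_closed [simp]: "I \<subseteq> S \<Longrightarrow> cox_lift I \<in> carrier A"
  unfolding cox_lift_def using set_cox_word by (intro word_lift_closed) auto

lemma cox_b_same:
  assumes "s \<in> set lL \<and> t \<in> set lL \<or> s \<in> set lR \<and> t \<in> set lR" "s \<noteq> t"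
  shows "cox_b s t = 0"
proof -
  have "s \<in> S" "t \<in> S" "s \<otimes> t = t \<otimes> s" using assms LR_S commL commR by auto
  then show ?thesis using cox_b_eq_0_iff assms(2) by blast
qed

lemma height_on_height: "I \<subseteq> S \<Longrightarrow> height_on I height"
  unfolding height_on_def
proof (intro ballI impI)
  fix s t assume I: "I \<subseteq> S" and s: "s \<in> I" and t: "t \<in> I" and st: "s \<noteq> t \<and> cox_b s t \<noteq> 0"
  have "s \<in> S" "t \<in> S" using s t I by auto
  then have "s \<in> set lL \<longleftrightarrow> t \<notin> set lL" using st cox_b_same[of s t] lLR by auto
  then show "\<bar>height s - height t\<bar> = 1" by (auto simp: height_def)
qed

lemma firable_cox_word:
  assumes I: "I \<subseteq> S"
  shows "firable I height (cox_word I)"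
proof -
  let ?l = "filter (\<lambda>s. s \<in> I) lL" and ?r = "filter (\<lambda>s. s \<in> I) lR"
  have d: "distinct ?l" "distinct ?r" using lLR by auto
  have "firable I height ?l"
  proof (rule firable_block[OF d(1)])
    fix s t assume s: "s \<in> set ?l" and t: "t \<in> I" "t \<noteq> s" "cox_b s t \<noteq> 0"
    then have "t \<notin> set lL" using cox_b_same[of s t] by auto
    then show "t \<notin> set ?l \<and> height t = height s + 1" using s by (auto simp: height_def)
  qed auto
  \<comment> \<open>The fired left letters now have height 2, and the right letters, at height 1,
    have become sources.\<close>
  moreover have "firable I (fire_list height ?l) ?r"
  proof (rule firable_block[OF d(2)])
    fix s t assume s: "s \<in> set ?r" and t: "t \<in> I" "t \<noteq> s" "cox_b s t \<noteq> 0"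
    then have "t \<notin> set lR" using cox_b_same[of s t] by auto
    moreover from this have "t \<in> set lL" using t I lLR by auto
    ultimately show "t \<notin> set ?r \<and> fire_list height ?l t = fire_list height ?l s + 1"
      using s t LR_S(3)[of s] unfolding fire_list_eq[OF d(1)] by (auto simp: height_def)
  qed auto
  ultimately show ?thesis by (simp add: cox_word_def firable_append)
qed

lemma refl_lift_restrict:
  assumes "I \<subseteq> S" "t \<in> reflections_in I"
  shows "refl_lift t = root_lift I height (root_of t)"
  unfolding refl_lift_def
  using root_lift_restrict[OF assms(1) order.refl height_on_height[OF order.refl]] reflections_in_pos[OF assms(2)]
  by simp

text \<open>Each letter of \<open>I\<close> is fired once. This conjugates by the Coxeter element of
  \<open>I\<close> and raises all heights on \<open>I\<close> by 2, which does not matter by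
  \<open>root_lift_shift\<close>; \<open>refl_lift_restrict\<close> allows the lift, defined with
  all of \<open>S\<close>, to be computed inside \<open>I\<close>.\<close>

lemma refl_lift_rotate:
  assumes I: "I \<subseteq> S" and t: "t \<in> reflections_in I"
  shows "refl_lift (inv (cox I) \<otimes> t \<otimes> cox I) = inv\<^bsub>A\<^esub> cox_lift I \<otimes>\<^bsub>A\<^esub> refl_lift t \<otimes>\<^bsub>A\<^esub> cox_lift I"
proof -
  let ?h = "fire_list height (cox_word I)"
  have "inv (cox I) \<in> generate W I" using generate_inv[OF I cox_generate[OF I]] .
  from reflections_in_conj[OF I this t]
  have t': "inv (cox I) \<otimes> t \<otimes> cox I \<in> reflections_in I" using I by simp
  have "?h s = height s + 2" if "s \<in> I" for s
    using that fire_list_eq[OF distinct_cox_word] set_cox_word[OF I] by simp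
  from root_lift_shift[OF I this]
  have "refl_lift (inv (cox I) \<otimes> t \<otimes> cox I) = root_lift I ?h (root_of (inv (cox I) \<otimes> t \<otimes> cox I))"
    using refl_lift_restrict[OF I t'] by simp
  also have "\<dots> = inv\<^bsub>A\<^esub> cox_lift I \<otimes>\<^bsub>A\<^esub> root_lift I height (root_of t) \<otimes>\<^bsub>A\<^esub> cox_lift I"
    unfolding cox_def cox_lift_def
    by (rule refl_lift_fire_list[OF I height_on_height[OF I] firable_cox_word[OF I] t])
  finally show ?thesis using refl_lift_restrict[OF I t] by simp
qed

lemma refl_lift_S: "s \<in> S \<Longrightarrow> refl_lift s = \<theta> s"
  using root_lift_simple[OF order.refl height_on_height[OF order.refl]] by (simp add: refl_lift_def root_of_S)

lemma refl_lift_closed [simp]: "t \<in> reflections \<Longrightarrow> refl_lift t \<in> carrier A"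
  unfolding refl_lift_def
  using root_lift_closed[OF order.refl height_on_height[OF order.refl]] root_of_pos by blast

lemma refl_lift_rotate_pow:
  assumes I: "I \<subseteq> S" and t: "t \<in> reflections_in I"
  shows "refl_lift (inv (cox I [^] k) \<otimes> t \<otimes> cox I [^] (k::nat))
    = inv\<^bsub>A\<^esub> (cox_lift I [^]\<^bsub>A\<^esub> k) \<otimes>\<^bsub>A\<^esub> refl_lift t \<otimes>\<^bsub>A\<^esub> cox_lift I [^]\<^bsub>A\<^esub> k
    \<and> inv (cox I [^] k) \<otimes> t \<otimes> cox I [^] k \<in> reflections_in I"
proof (induction k)
  case 0
  then show ?case using t by (simp add: reflections_in_def)
next
  case (Suc k)
  let ?u = "inv (cox I [^] k) \<otimes> t \<otimes> cox I [^] k"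
  have tr: "t \<in> reflections" using t by (simp add: reflections_in_def)
  have e: "inv (cox I [^] Suc k) \<otimes> t \<otimes> cox I [^] Suc k = inv (cox I) \<otimes> ?u \<otimes> cox I"
    using conj_mult[of "cox I [^] k" "cox I" t] I tr by simp
  have eA: "inv\<^bsub>A\<^esub> (cox_lift I [^]\<^bsub>A\<^esub> Suc k) \<otimes>\<^bsub>A\<^esub> refl_lift t \<otimes>\<^bsub>A\<^esub> cox_lift I [^]\<^bsub>A\<^esub> Suc k
    = inv\<^bsub>A\<^esub> cox_lift I \<otimes>\<^bsub>A\<^esub> (inv\<^bsub>A\<^esub> (cox_lift I [^]\<^bsub>A\<^esub> k) \<otimes>\<^bsub>A\<^esub> refl_lift t \<otimes>\<^bsub>A\<^esub> cox_lift I [^]\<^bsub>A\<^esub> k) \<otimes>\<^bsub>A\<^esub> cox_lift I"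
    using A.conj_mult[of "cox_lift I [^]\<^bsub>A\<^esub> k" "cox_lift I" "refl_lift t"] I tr by simp
  have "inv (cox I) \<in> generate W I" using generate_inv[OF I cox_generate[OF I]] .
  from reflections_in_conj[OF I this, of ?u] Suc
  have "inv (cox I) \<otimes> ?u \<otimes> cox I \<in> reflections_in I" using I by simp
  then show ?case unfolding e eA using refl_lift_rotate[OF I, of ?u] Suc by simp
qed

text \<open>Some rotate of the root of \<open>t\<close> is positive while the next one is negative,
  so it is an inversion of \<open>cox I\<close> and belongs to a letter \<open>s\<close> of
  \<open>cox_word I\<close>. If \<open>s\<close> is a left letter, the letters before it commute
  with it, and the rotated reflection is \<open>s\<close>; if it is a right letter, those after it
  do, and the reflection is the conjugate of \<open>s\<close> by \<open>cox I\<close>.\<close>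

lemma reflection_coxeter_conj:
  assumes I: "I \<subseteq> S" and t: "t \<in> reflections_in I"
  obtains k s where "s \<in> I" "t = cox I [^] (k::nat) \<otimes> s \<otimes> inv (cox I [^] k)"
proof -
  let ?c = "cox I"
  have tr: "t \<in> reflections" using t by (simp add: reflections_in_def)
  have b: "root_of t \<in> pos_roots I" using reflections_in_pos[OF t] .
  have sub: "set (cox_word I) \<subseteq> S" using set_cox_word I by blast
  have bI: "root_of t \<in> coords (set (cox_word I))" using pos_roots_D(3)[OF b] set_cox_word[OF I] by simp
  obtain k where k: "nonneg (act (inv ?c [^] (k::nat)) (root_of t))"
    "\<not> nonneg (act (inv ?c [^] Suc k) (root_of t))"
    using coxeter_orbit_sign_change[OF distinct_cox_word sub pos_roots_D(1)[OF b] pos_roots_D(2)[OF b] bI]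
    unfolding cox_def by blast
  let ?g = "act (inv ?c [^] k) (root_of t)"
  let ?u = "inv (?c [^] k) \<otimes> t \<otimes> ?c [^] k"
  have cW: "?c \<in> carrier W" using I by simp
  have ck: "?c [^] k \<in> carrier W" "inv ?c [^] k \<in> carrier W"
    by (intro nat_pow_closed inv_closed cW)+
  have cd: "inv ?c [^] k = inv (?c [^] k)" by (rule nat_pow_inv[OF cW])
  have u: "?u \<in> reflections" using reflections_conj'[OF ck(1) tr] .
  have ur: "root_of ?u = ?g"
    unfolding cd using root_of_conj[OF inv_closed[OF ck(1)] tr] k(1)[unfolded cd] inv_inv[OF ck(1)] by metis
  have g: "?g \<in> roots" using act_roots[OF ck(2) pos_roots_D(1)[OF b]] .
  have "\<not> nonneg (act (inv (list_prod W (cox_word I))) ?g)"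
    using k(2) unfolding nat_pow_Suc2[OF inv_closed[OF cW]] act_mult[OF inv_closed[OF cW] ck(2)] cox_def[symmetric] .
  from inversion_of_word[OF sub g k(1) this] obtain ys s zs
    where yz: "cox_word I = ys @ s # zs" "?g = act (list_prod W ys) (simple_root s)" by blast
  have word_split: "ys @ s # zs = filter (\<lambda>s. s \<in> I) lL @ filter (\<lambda>s. s \<in> I) lR"
    using yz(1) by (simp add: cox_word_def)
  have S: "s \<in> I" "s \<in> S" "set ys \<subseteq> S" "set zs \<subseteq> S" "list_prod W ys \<in> carrier W" "list_prod W zs \<in> carrier W"
    using yz(1) sub set_cox_word[OF I] by auto
  have "reflect (list_prod W ys) s = ?u"
  proof (rule root_of_inj[OF _ u])
    show "reflect (list_prod W ys) s \<in> reflections" unfolding reflections_def using S by blast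
    show "root_of (reflect (list_prod W ys) s) = root_of ?u"
      unfolding ur yz(2) using k(1) unfolding yz(2) by (rule root_of_eq[OF S(5,2)])
  qed
  then have ue: "?u = list_prod W ys \<otimes> s \<otimes> inv (list_prod W ys)" by (simp add: reflect_def)
  have "?u = s \<or> ?u = ?c \<otimes> s \<otimes> inv ?c"
  proof (cases "s \<in> set lL")
    case True
    have "set ys \<subseteq> set lL"
      using prefix_of_left_part[OF word_split] True LR_S(3) by fastforce
    then have "s \<otimes> list_prod W ys = list_prod W ys \<otimes> s"
      using S commL[OF True] by (intro list_prod_commute) auto
    then have "?u = s \<otimes> list_prod W ys \<otimes> inv (list_prod W ys)" unfolding ue by simp
    also have "\<dots> = s" using S by (simp add: m_assoc)
    finally show ?thesis ..
  next
    case False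
    then have sR: "s \<in> set lR" using S lLR by auto
    have "set zs \<subseteq> set lR"
      using suffix_of_right_part[OF word_split] False by fastforce
    then have zc: "s \<otimes> list_prod W zs = list_prod W zs \<otimes> s"
      using S commR[OF sR] by (intro list_prod_commute) auto
    have ce: "?c = list_prod W ys \<otimes> (s \<otimes> list_prod W zs)"
      unfolding cox_def yz(1) using S by (simp add: X_words_append)
    have "?c \<otimes> s = list_prod W ys \<otimes> list_prod W zs"
      unfolding ce zc using S by (simp add: m_assoc S_square)
    moreover have "list_prod W ys \<otimes> s \<otimes> inv (list_prod W ys) \<otimes> ?c = list_prod W ys \<otimes> list_prod W zs"
      unfolding ce using S by (simp add: m_assoc inv_cancel)
    ultimately have "?c \<otimes> s = list_prod W ys \<otimes> s \<otimes> inv (list_prod W ys) \<otimes> ?c" by simp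
    then have "?c \<otimes> s \<otimes> inv ?c = ?u" unfolding ue using S I by (simp add: m_assoc)
    then show ?thesis by simp
  qed
  then show thesis
  proof
    assume "?u = s"
    then have "t = ?c [^] k \<otimes> s \<otimes> inv (?c [^] k)"
      using conj_solve[OF ck(1) reflections_closed[OF tr] X_closed[OF S(2)]] by (simp only:)
    then show thesis using that S by blast
  next
    assume "?u = ?c \<otimes> s \<otimes> inv ?c"
    then have "t = ?c [^] k \<otimes> (?c \<otimes> s \<otimes> inv ?c) \<otimes> inv (?c [^] k)"
      using conj_solve[OF ck(1) reflections_closed[OF tr], of "?c \<otimes> s \<otimes> inv ?c"] cW S(2)
      by (simp only: m_closed inv_closed X_closed)
    also have "\<dots> = ?c [^] Suc k \<otimes> s \<otimes> inv (?c [^] Suc k)"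
      using ck(1) cW S(2) by (simp add: inv_mult_group m_assoc)
    finally show thesis using that S by blast
  qed
qed

text \<open>Letters of the same side commute, in \<open>A\<close> by
  \<open>\<theta>_commute\<close>, so a left letter can be moved to the front and a right letter to
  the end.\<close>

lemma cox_word_remove:
  assumes "I \<subseteq> S" "s \<in> I"
  shows "s \<in> set lL \<Longrightarrow> cox I = s \<otimes> cox (I - {s})"
    and "s \<in> set lL \<Longrightarrow> cox_lift I = \<theta> s \<otimes>\<^bsub>A\<^esub> cox_lift (I - {s})"
    and "s \<in> set lR \<Longrightarrow> cox I = cox (I - {s}) \<otimes> s"
    and "s \<in> set lR \<Longrightarrow> cox_lift I = cox_lift (I - {s}) \<otimes>\<^bsub>A\<^esub> \<theta> s"
proof -
  let ?l = "\<lambda>J. filter (\<lambda>x. x \<in> J) lL" and ?r = "\<lambda>J. filter (\<lambda>x. x \<in> J) lR"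
  have rm: "filter (\<lambda>x. x \<noteq> s) (?l I) = ?l (I - {s})" "filter (\<lambda>x. x \<noteq> s) (?r I) = ?r (I - {s})"
    by (auto simp: filter_filter intro!: filter_cong)
  have sub: "set (?l J) \<subseteq> S" "set (?r J) \<subseteq> S" for J using LR_S by auto
  have same: "s \<in> set lL \<Longrightarrow> ?r I = ?r (I - {s})" "s \<in> set lR \<Longrightarrow> ?l I = ?l (I - {s})"
    using LR_S(3) by (auto intro!: filter_cong)
  have d: "distinct (?l I)" "distinct (?r I)" using lLR by auto
  have split: "cox J = list_prod W (?l J) \<otimes> list_prod W (?r J)"
    "cox_lift J = word_lift (?l J) \<otimes>\<^bsub>A\<^esub> word_lift (?r J)" for J
    using sub[of J] by (simp_all add: cox_def cox_lift_def cox_word_def X_words_append word_lift_append)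
  have wc: "word_lift (?l J) \<in> carrier A" "word_lift (?r J) \<in> carrier A" for J
    using sub[of J] by simp_all
  have pc: "list_prod W (?l J) \<in> carrier W" "list_prod W (?r J) \<in> carrier W" for J
    using sub[of J] by simp_all
  {
    assume s: "s \<in> set lL"
    have sS: "s \<in> S" using s LR_S by blast
    have "list_prod W (map (\<lambda>x. x) (?l I)) = s \<otimes> list_prod W (map (\<lambda>x. x) (filter (\<lambda>x. x \<noteq> s) (?l I)))"
      using commL sub(1)[of I] s assms(2) by (intro list_prod_remove(1) d) auto
    then have e: "list_prod W (?l I) = s \<otimes> list_prod W (?l (I - {s}))"
      unfolding rm list.map_ident .
    show "cox I = s \<otimes> cox (I - {s})"
      unfolding split(1)[of I] split(1)[of "I - {s}"] same(1)[OF s] e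
      by (rule m_assoc[OF X_closed[OF sS] pc])
    have e: "word_lift (?l I) = \<theta> s \<otimes>\<^bsub>A\<^esub> word_lift (?l (I - {s}))"
      unfolding word_lift_def rm[symmetric] using sub(1)[of I] s assms(2)
      by (intro A.list_prod_remove(1) d) (auto intro: \<theta>_commute commL LR_S)
    show "cox_lift I = \<theta> s \<otimes>\<^bsub>A\<^esub> cox_lift (I - {s})"
      unfolding split(2)[of I] split(2)[of "I - {s}"] same(1)[OF s] e
      by (rule A.m_assoc[OF \<theta>_closed[OF sS] wc])
  next
    assume s: "s \<in> set lR"
    have sS: "s \<in> S" using s LR_S by blast
    have "list_prod W (map (\<lambda>x. x) (?r I)) = list_prod W (map (\<lambda>x. x) (filter (\<lambda>x. x \<noteq> s) (?r I))) \<otimes> s"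
      using commR sub(2)[of I] s assms(2) by (intro list_prod_remove(2) d) auto
    then have e: "list_prod W (?r I) = list_prod W (?r (I - {s})) \<otimes> s"
      unfolding rm list.map_ident .
    show "cox I = cox (I - {s}) \<otimes> s"
      unfolding split(1)[of I] split(1)[of "I - {s}"] same(2)[OF s] e
      by (rule m_assoc[OF pc X_closed[OF sS], symmetric])
    have e: "word_lift (?r I) = word_lift (?r (I - {s})) \<otimes>\<^bsub>A\<^esub> \<theta> s"
      unfolding word_lift_def rm[symmetric] using sub(2)[of I] s assms(2)
      by (intro A.list_prod_remove(2) d) (auto intro: \<theta>_commute commR LR_S)
    show "cox_lift I = cox_lift (I - {s}) \<otimes>\<^bsub>A\<^esub> \<theta> s"
      unfolding split(2)[of I] split(2)[of "I - {s}"] same(2)[OF s] e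
      by (rule A.m_assoc[OF wc \<theta>_closed[OF sS], symmetric])
  }
qed

lemma refl_lift_word_closed: "set ts \<subseteq> reflections \<Longrightarrow> list_prod A (map refl_lift ts) \<in> carrier A"
  by (intro A.list_prod_closed) auto

lemma refl_lift_word_conj:
  assumes I: "I \<subseteq> S" and ts: "set ts \<subseteq> reflections_in I"
  shows "list_prod A (map refl_lift (map (\<lambda>t. inv (cox I [^] (k::nat)) \<otimes> t \<otimes> cox I [^] k) ts))
    = inv\<^bsub>A\<^esub> (cox_lift I [^]\<^bsub>A\<^esub> k) \<otimes>\<^bsub>A\<^esub> list_prod A (map refl_lift ts) \<otimes>\<^bsub>A\<^esub> cox_lift I [^]\<^bsub>A\<^esub> k"
proof -
  let ?C = "inv\<^bsub>A\<^esub> (cox_lift I [^]\<^bsub>A\<^esub> k)"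
  have C: "?C \<in> carrier A" using I by simp
  have eq: "map refl_lift (map (\<lambda>t. inv (cox I [^] k) \<otimes> t \<otimes> cox I [^] k) ts)
    = map (\<lambda>x. ?C \<otimes>\<^bsub>A\<^esub> x \<otimes>\<^bsub>A\<^esub> inv\<^bsub>A\<^esub> ?C) (map refl_lift ts)"
    using ts refl_lift_rotate_pow[OF I] I by auto
  have sub: "set (map refl_lift ts) \<subseteq> carrier A" using ts by (auto simp: reflections_in_def)
  show ?thesis unfolding eq A.list_prod_conj[OF C sub] using I by simp
qed

text \<open>After a conjugation by a power of the Coxeter element the last letter of the factorization is
  simple, and removing it leaves a factorization of a Coxeter element of smaller rank.\<close>

lemma refl_lift_factorization:
  assumes "I \<subseteq> S" "set ts \<subseteq> reflections" "length ts = card I" "list_prod W ts = cox I"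
  shows "list_prod A (map refl_lift ts) = cox_lift I"
  using assms
proof (induction "card I" arbitrary: I ts)
  case 0
  have "finite I" using finite_subset[OF 0(2) finite_S] .
  then have "I = {}" "ts = []" using 0 by auto
  then show ?case by (simp add: cox_lift_def cox_word_def word_lift_def)
next
  case (Suc n)
  let ?c = "cox I" and ?C = "cox_lift I"
  \<comment> \<open>The length is minimal, so the roots of all factors are supported in
    \<open>I\<close>, where the rotation by \<open>cox I\<close> applies.\<close>
  have tsI: "set ts \<subseteq> reflections_in I"
    using factorization_length(2)[OF distinct_cox_word _ Suc.prems(2), of I] Suc.prems
      set_cox_word length_cox_word by (auto simp: cox_def)
  have cI: "?c \<in> carrier W" "?C \<in> carrier A" using Suc.prems by auto
  obtain us t where us: "ts = us @ [t]" using Suc by (cases ts rule: rev_cases) auto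
  have tI: "t \<in> reflections_in I" using tsI us by simp
  obtain k s where s: "s \<in> I" and t: "t = ?c [^] (k::nat) \<otimes> s \<otimes> inv (?c [^] k)"
    using reflection_coxeter_conj[OF Suc.prems(1) tI] by blast
  let ?g = "?c [^] k" and ?G = "?C [^]\<^bsub>A\<^esub> k"
  have g: "?g \<in> carrier W" "?G \<in> carrier A" using cI by auto
  define vs where "vs = map (\<lambda>t. inv ?g \<otimes> t \<otimes> ?g) us"
  have sS: "s \<in> S" using s Suc.prems by blast
  have "inv ?g \<otimes> t \<otimes> ?g = s" using conj_solve[OF g(1), of t s] t g sS by simp
  then have map: "map (\<lambda>t. inv ?g \<otimes> t \<otimes> ?g) ts = vs @ [s]" by (simp add: us vs_def)
  have tsW: "set ts \<subseteq> carrier W" using Suc.prems(2) by auto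
  have "?g \<otimes> ?c = ?c \<otimes> ?g" using cI by (metis nat_pow_Suc nat_pow_Suc2)
  then have "inv ?g \<otimes> ?c \<otimes> ?g = ?c"
    using conj_solve[OF g(1), of ?c ?c] cI g by (metis inv_solve_right m_closed)
  then have prod: "list_prod W (vs @ [s]) = ?c"
    using list_prod_conj'[OF g(1) tsW] map Suc.prems(4) by simp
  have vsI: "set vs \<subseteq> reflections_in I"
    using refl_lift_rotate_pow[OF Suc.prems(1), of _ k] tsI unfolding us vs_def by auto
  then have vsR: "set vs \<subseteq> reflections" and vsW: "set vs \<subseteq> carrier W"
    by (auto simp: reflections_in_def)
  have vW: "list_prod W vs \<in> carrier W" using vsW list_prod_closed by blast
  have vs: "list_prod W vs \<otimes> s = ?c"
    using prod list_prod_append[OF vsW, of "[s]"] sS by simp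
  have card: "card (I - {s}) = n" "length vs = n"
    using Suc.hyps(2) Suc.prems(3) s us finite_subset[OF Suc.prems(1)] by (auto simp: vs_def)
  let ?D = "cox_lift (I - {s})" and ?d = "cox (I - {s})"
  have sub: "I - {s} \<subseteq> S" using Suc.prems(1) by blast
  have dc: "?d \<in> carrier W" "?D \<in> carrier A" using sub by auto
  let ?V = "list_prod A (map refl_lift vs)"
  have V: "?V \<in> carrier A" using refl_lift_word_closed vsR by blast
  have main: "?V \<otimes>\<^bsub>A\<^esub> \<theta> s = ?C"
  proof (cases "s \<in> set lR")
    case True
    have "list_prod W vs = ?d"
      using vs cox_word_remove(3)[OF Suc.prems(1) s True] vW dc sS by (metis X_closed right_cancel)
    then have "?V = ?D" using Suc.hyps(1)[OF _ sub vsR] card by simp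
    then show ?thesis using cox_word_remove(4)[OF Suc.prems(1) s True] by simp
  next
    case False
    then have sL: "s \<in> set lL" using sS lLR by auto
    note rem = cox_word_remove(1)[OF Suc.prems(1) s sL] cox_word_remove(2)[OF Suc.prems(1) s sL]
    \<comment> \<open>Here \<open>s\<close> stands at the front of \<open>cox I\<close> but at the
      end of the factorization, so the other factors multiply to \<open>?c \<otimes> s\<close>. One
      more rotation turns this into \<open>s \<otimes> ?c\<close>, the Coxeter element without
      \<open>s\<close>.\<close>
    define ws where "ws = map (\<lambda>t. inv (?c [^] (1::nat)) \<otimes> t \<otimes> ?c [^] (1::nat)) vs"
    have "list_prod W vs = ?c \<otimes> s" using vs vW sS by (metis X_cancel(2))
    then have "list_prod W ws = inv ?c \<otimes> (?c \<otimes> s) \<otimes> ?c"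
      unfolding ws_def using list_prod_conj'[OF cI(1) vsW] cI by simp
    also have "\<dots> = s \<otimes> ?c" using cI sS by (simp flip: m_assoc)
    also have "\<dots> = ?d" unfolding rem using sS dc by simp
    finally have wsd: "list_prod W ws = ?d" .
    have "set ws \<subseteq> reflections"
      unfolding ws_def using refl_lift_rotate_pow[OF Suc.prems(1), of _ 1] vsI
      by (auto simp: reflections_in_def)
    then have "list_prod A (map refl_lift ws) = ?D"
      using Suc.hyps(1)[OF _ sub _ _ wsd] card by (simp add: ws_def)
    then have "inv\<^bsub>A\<^esub> ?C \<otimes>\<^bsub>A\<^esub> ?V \<otimes>\<^bsub>A\<^esub> ?C = ?D"
      using refl_lift_word_conj[OF Suc.prems(1) vsI, of 1] cI unfolding ws_def by simp
    then have "?V = ?C \<otimes>\<^bsub>A\<^esub> ?D \<otimes>\<^bsub>A\<^esub> inv\<^bsub>A\<^esub> ?C" using A.conj_solve[OF cI(2) V dc(2)] by simp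
    also have "\<dots> = ?C \<otimes>\<^bsub>A\<^esub> inv\<^bsub>A\<^esub> \<theta> s"
      using rem(2) dc sS cI by (simp add: A.inv_mult_group A.m_assoc) (simp flip: A.m_assoc)
    finally show ?thesis using cI sS by (simp add: A.m_assoc)
  qed
  have "list_prod A (map refl_lift (vs @ [s])) = ?C"
  proof -
    have "set (map refl_lift vs) \<subseteq> carrier A" using vsR by auto
    from A.list_prod_append[OF this, of "[\<theta> s]"] show ?thesis
      using sS main by (simp add: refl_lift_S)
  qed
  then have "inv\<^bsub>A\<^esub> ?G \<otimes>\<^bsub>A\<^esub> list_prod A (map refl_lift ts) \<otimes>\<^bsub>A\<^esub> ?G = ?C"
    using refl_lift_word_conj[OF Suc.prems(1) tsI, of k] map by simp
  then have "list_prod A (map refl_lift ts) = ?G \<otimes>\<^bsub>A\<^esub> ?C \<otimes>\<^bsub>A\<^esub> inv\<^bsub>A\<^esub> ?G"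
    using A.conj_solve[OF g(2) refl_lift_word_closed[OF Suc.prems(2)] cI(2)] by simp
  also have "\<dots> = ?C"
    using cI g by (metis A.inv_solve_right A.m_closed A.nat_pow_Suc A.nat_pow_Suc2)
  finally show ?case .
qed

end

subsection \<open>Linear reflections of finite order\<close>

text \<open>A linear reflection described without an inner product: -1 on the line of
  \<open>\<beta>\<close> and the identity on the quotient by this line.\<close>

definition reflects :: "('v::real_vector \<Rightarrow> 'v) \<Rightarrow> 'v \<Rightarrow> bool" where
  "reflects f \<beta> \<longleftrightarrow> \<beta> \<noteq> 0 \<and> f \<beta> = - \<beta> \<and> (\<forall>v. \<exists>a. f v = v + a *\<^sub>R \<beta>)"

lemma independent_finite:
  fixes B C :: "'v::real_vector set"
  assumes "finite B" "span B = UNIV" "independent C"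
  shows "finite C"
  using independent_span_bound[OF assms(1,3)] assms(2) by simp

lemma subspace_fixed: "linear f \<Longrightarrow> subspace {v. f v - v = 0}"
  by (auto simp: subspace_def linear_0 linear_add linear_scale)

lemma codim_reflects:
  fixes f :: "'v::real_vector \<Rightarrow> 'v" and B :: "'v set"
  assumes B: "finite B" "span B = UNIV" and f: "linear f" and r: "reflects f \<beta>"
  shows "codim {v. f v - v = 0} = 1"
proof -
  let ?F = "{v. f v - v = 0}"
  obtain C where C: "C \<subseteq> ?F" "independent C" "?F \<subseteq> span C" "card C = dim ?F"
    using basis_exists by blast
  have FC: "span C = ?F"
    using C subspace_fixed[OF f] by (metis span_minimal subset_antisym)
  have b: "\<beta> \<noteq> 0" "f \<beta> = - \<beta>" using r by (auto simp: reflects_def)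
  have "\<beta> \<notin> ?F"
  proof
    assume "\<beta> \<in> ?F"
    then have "- \<beta> = \<beta>" using b(2) by simp
    then have "\<beta> + \<beta> = 0" by (metis add.right_inverse)
    then show False using b(1) by (simp flip: scaleR_2)
  qed
  then have bn: "\<beta> \<notin> span C" using FC by simp
  have i: "independent (insert \<beta> C)" using C(2) bn by (simp add: independent_insert)
  have "v \<in> span (insert \<beta> C)" for v
  proof -
    obtain a where a: "f v = v + a *\<^sub>R \<beta>" using r by (auto simp: reflects_def)
    have "f (v + (a / 2) *\<^sub>R \<beta>) = v + a *\<^sub>R \<beta> - (a / 2) *\<^sub>R \<beta>"
      using a b(2) by (simp add: linear_add[OF f] linear_scale[OF f])
    also have "\<dots> = v + (a / 2) *\<^sub>R \<beta>"
    proof -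
      have "a *\<^sub>R \<beta> = (a / 2) *\<^sub>R \<beta> + (a / 2) *\<^sub>R \<beta>" by (simp flip: scaleR_add_left)
      then show ?thesis by (simp add: algebra_simps)
    qed
    finally have "v - (- (a / 2)) *\<^sub>R \<beta> \<in> span C" using FC by simp
    then show ?thesis unfolding span_breakdown_eq by blast
  qed
  then have "span (insert \<beta> C) = span UNIV" by auto
  from dim_eq_card[OF this i] have "dim (UNIV :: 'v set) = card (insert \<beta> C)" .
  moreover have "finite C" "\<beta> \<notin> C"
    using independent_finite[OF B C(2)] bn span_base by auto
  ultimately show ?thesis using C(4) by (simp add: codim_def)
qed

text \<open>A basis of the fixed space misses one vector \<open>e\<close>, and
  \<open>\<beta> = f e - e\<close> spans the image of \<open>f - id\<close>. Finite order forces the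
  eigenvalue on \<open>\<beta>\<close> to be 1 or -1; with 1 the map would be a transvection, whose
  powers move \<open>e\<close> further and further.\<close>

lemma reflects_codim:
  fixes f :: "'v::real_vector \<Rightarrow> 'v" and B :: "'v set"
  assumes B: "finite B" "span B = UNIV" and f: "linear f" and n: "0 < n" "f ^^ n = id"
    and c: "codim {v. f v - v = 0} = 1"
  shows "\<exists>\<beta>. reflects f \<beta>"
proof -
  let ?F = "{v. f v - v = 0}"
  obtain C where C: "C \<subseteq> ?F" "independent C" "?F \<subseteq> span C" "card C = dim ?F"
    using basis_exists by blast
  have FC: "span C = ?F"
    using C subspace_fixed[OF f] by (metis span_minimal subset_antisym)
  obtain E where E: "C \<subseteq> E" "E \<subseteq> UNIV" "independent E" "UNIV \<subseteq> span E"
    by (rule maximal_independent_subset_extend[OF subset_UNIV C(2)])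
  have fin: "finite E" using independent_finite[OF B E(3)] .
  have "span E = span UNIV" using E(4) by (simp add: subset_antisym)
  from dim_eq_card[OF this E(3)] have dE: "dim (UNIV :: 'v set) = card E" .
  have "card E - card C = 1" using c unfolding codim_def dE C(4) .
  then have "card (E - C) = 1" using card_Diff_subset[OF finite_subset[OF E(1) fin] E(1)] by simp
  then obtain e where e: "E - C = {e}" by (rule card_1_singletonE)
  then have Ee: "E = insert e C" "e \<notin> C" using E(1) by blast+
  have eF: "e \<notin> span C" using E(3) Ee by (simp add: independent_insert)
  define \<beta> where "\<beta> = f e - e"
  have b0: "\<beta> \<noteq> 0" using eF FC by (simp add: \<beta>_def)
  have v: "\<exists>a. f v = v + a *\<^sub>R \<beta>" for v
  proof -
    have "v \<in> span (insert e C)" using E(4) Ee by auto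
    then obtain k where "v - k *\<^sub>R e \<in> span C" by (auto simp: span_breakdown_eq)
    then have "f (v - k *\<^sub>R e) = v - k *\<^sub>R e" using FC by simp
    then have "f v - k *\<^sub>R f e = v - k *\<^sub>R e"
      unfolding linear_diff[OF f] linear_scale[OF f] .
    then have "f v = v - k *\<^sub>R e + k *\<^sub>R f e" by (rule diff_eq_eq[THEN iffD1])
    then have "f v = v + k *\<^sub>R \<beta>" unfolding \<beta>_def scaleR_diff_right by simp
    then show ?thesis by (rule exI)
  qed
  from v[of \<beta>] obtain k where "f \<beta> = \<beta> + k *\<^sub>R \<beta>" by (rule exE)
  then have "f \<beta> = (1 + k) *\<^sub>R \<beta>" by (simp add: scaleR_add_left)
  then obtain r where r: "f \<beta> = r *\<^sub>R \<beta>" by (rule that)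
  have "(f ^^ m) \<beta> = r ^ m *\<^sub>R \<beta>" for m
    by (induction m) (simp_all add: r linear_scale[OF f] mult.commute)
  from this[of n] have "r ^ n *\<^sub>R \<beta> = 1 *\<^sub>R \<beta>" unfolding n(2) by simp
  then have "r ^ n = 1" using b0 scaleR_cancel_right by blast
  then have "\<bar>r\<bar> ^ n = 1 ^ n" by (simp flip: power_abs)
  from power_eq_imp_eq_base[OF this _ _ n(1)] have "\<bar>r\<bar> = 1" by simp
  then have "r = 1 \<or> r = - 1" by linarith
  moreover have "r \<noteq> 1"
  proof
    assume "r = 1"
    then have fb: "f \<beta> = \<beta>" using r by simp
    have "(f ^^ m) e = e + real m *\<^sub>R \<beta>" for m
    proof (induction m)
      case (Suc m)
      then have "(f ^^ Suc m) e = f e + real m *\<^sub>R \<beta>"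
        by (simp add: linear_add[OF f] linear_scale[OF f] fb)
      also have "f e = e + \<beta>" by (simp add: \<beta>_def)
      finally show ?case by (simp add: algebra_simps)
    qed simp
    from this[of n] have "e = e + real n *\<^sub>R \<beta>" unfolding n(2) by simp
    then show False using b0 n(1) by simp
  qed
  ultimately have "f \<beta> = - \<beta>" using r by simp
  then have "reflects f \<beta>" unfolding reflects_def using b0 v by (intro conjI allI)
  then show ?thesis by (rule exI)
qed

lemma reflects_involution:
  assumes "linear f" "reflects f \<beta>"
  shows "f (f v) = v"
proof -
  obtain a where "f v = v + a *\<^sub>R \<beta>" using assms by (auto simp: reflects_def)
  then show ?thesis using assms by (simp add: linear_add linear_scale reflects_def)
qed

text \<open>As \<open>f\<close> and \<open>g\<close> commute, \<open>g\<close> preserves the line of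
  \<open>\<beta>\<close>. Either \<open>g\<close> fixes \<open>\<beta>\<close>, or the two lines
  coincide; then the product is the identity on that line and modulo it, and such a map of finite
  order is the identity.\<close>

lemma reflects_commute:
  fixes f g :: "'v::real_vector \<Rightarrow> 'v"
  assumes f: "linear f" "reflects f \<beta>" and g: "linear g" "reflects g \<gamma>"
    and comm: "\<And>v. f (g v) = g (f v)" and n: "0 < n" "(f \<circ> g) ^^ n = id"
  shows "g \<beta> = \<beta> \<or> f \<circ> g = id"
proof -
  have b: "\<beta> \<noteq> 0" "f \<beta> = - \<beta>" and c: "\<gamma> \<noteq> 0" "g \<gamma> = - \<gamma>"
    using f(2) g(2) by (auto simp: reflects_def)
  obtain a where a: "f (g \<beta>) = g \<beta> + a *\<^sub>R \<beta>" using f(2) by (auto simp: reflects_def)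
  have "f (g \<beta>) = - g \<beta>" using comm b g(1) by (simp add: linear_neg)
  then have "g \<beta> + a *\<^sub>R \<beta> = - g \<beta>" using a by simp
  then have "(g \<beta> + g \<beta>) + a *\<^sub>R \<beta> = 0" by (metis add.assoc add.right_inverse)
  then have "2 *\<^sub>R g \<beta> = - (a *\<^sub>R \<beta>)" unfolding scaleR_2 by (rule eq_neg_iff_add_eq_0[THEN iffD2])
  then have "(1/2) *\<^sub>R (2 *\<^sub>R g \<beta>) = (1/2) *\<^sub>R (- (a *\<^sub>R \<beta>))" by simp
  then have gb: "g \<beta> = (- a / 2) *\<^sub>R \<beta>" by simp
  obtain d where d: "g \<beta> = \<beta> + d *\<^sub>R \<gamma>" using g(2) by (auto simp: reflects_def)
  show ?thesis
  proof (cases "d = 0")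
    case False
    have "d *\<^sub>R \<gamma> = (- a / 2 - 1) *\<^sub>R \<beta>" using gb d by (simp add: algebra_simps)
    then have "\<gamma> = (inverse d * (- a / 2 - 1)) *\<^sub>R \<beta>"
      using False by (metis scaleR_scaleR left_inverse scaleR_one)
    then obtain q where q: "\<gamma> = q *\<^sub>R \<beta>" by blast
    have q0: "q \<noteq> 0" using q c by auto
    have "q *\<^sub>R g \<beta> = q *\<^sub>R (- \<beta>)" using c(2) q by (simp add: linear_scale[OF g(1)])
    then have gb: "g \<beta> = - \<beta>" using q0 by (metis scaleR_cancel_left)
    have fg: "f (g \<beta>) = \<beta>" using b gb by (simp add: linear_neg[OF f(1)])
    have "f (g v) = v" for v
    proof -
      obtain x where x: "g v = v + x *\<^sub>R \<gamma>" using g(2) by (auto simp: reflects_def)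
      obtain y where y: "f v = v + y *\<^sub>R \<beta>" using f(2) by (auto simp: reflects_def)
      have "f (g v) = v + y *\<^sub>R \<beta> - (x * q) *\<^sub>R \<beta>"
        using x y q b by (simp add: linear_add[OF f(1)] linear_scale[OF f(1)])
      then obtain z where z: "f (g v) = v + z *\<^sub>R \<beta>" by (metis add_diff_eq scaleR_diff_left)
      have "((f \<circ> g) ^^ m) v = v + (real m * z) *\<^sub>R \<beta>" for m
      proof (induction m)
        case (Suc m)
        have "((f \<circ> g) ^^ Suc m) v = f (g (((f \<circ> g) ^^ m) v))" by simp
        also have "\<dots> = f (g v) + (real m * z) *\<^sub>R f (g \<beta>)"
          unfolding Suc linear_add[OF f(1)] linear_scale[OF f(1)] linear_add[OF g(1)] linear_scale[OF g(1)] ..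
        finally have e: "((f \<circ> g) ^^ Suc m) v = f (g v) + (real m * z) *\<^sub>R f (g \<beta>)" .
        show ?case unfolding e z fg by (simp add: algebra_simps)
      qed simp
      from this[of n] have "v = v + (real n * z) *\<^sub>R \<beta>" unfolding n(2) by simp
      then have "z = 0" using b n(1) by simp
      then show ?thesis using z by simp
    qed
    then show ?thesis by auto
  qed (use d in simp)
qed

context finite_coxeter
begin

text \<open>A conjugate of \<open>t\<close> of minimal length commutes with all its descents. If it is not itself one
  of them, it is a product of them, and then it fixes its own root in the given representation.\<close>

lemma reflects_imp_reflection:
  fixes \<rho> :: "'a \<Rightarrow> 'v::real_vector \<Rightarrow> 'v"
  assumes \<rho>: "\<rho> \<in> hom W GL" "inj_on \<rho> (carrier W)" and S: "\<And>s. s \<in> S \<Longrightarrow> \<exists>\<gamma>. reflects (\<rho> s) \<gamma>"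
    and t: "t \<in> carrier W" "reflects (\<rho> t) \<beta>"
  shows "t \<in> reflections"
proof -
  have lin: "linear (\<rho> x)" if "x \<in> carrier W" for x
    using \<rho>(1) that by (auto simp: hom_def Pi_iff)
  have mult: "\<rho> (x \<otimes> y) = \<rho> x \<circ> \<rho> y" if "x \<in> carrier W" "y \<in> carrier W" for x y
    using hom_mult[OF \<rho>(1) that] by simp
  have one: "\<rho> \<one> = id" using hom_one[OF \<rho>(1) is_group group_GL] by simp
  have rinv: "\<rho> x (\<rho> (inv x) v) = v" "\<rho> (inv x) (\<rho> x v) = v" if "x \<in> carrier W" for x v
    using mult[of x "inv x"] mult[of "inv x" x] that one by (simp_all add: fun_eq_iff)
  have pow: "(\<rho> x) ^^ n = \<rho> (x [^] n)" if "x \<in> carrier W" for x and n :: nat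
  proof (induction n)
    case (Suc n)
    then show ?case using mult[OF that, of "x [^] n"] that
      by (metis funpow.simps(2) nat_pow_Suc2 nat_pow_closed)
  qed (simp add: one)
  define conj where "conj = {g \<otimes> t \<otimes> inv g |g. g \<in> carrier W}"
  have conjW: "conj \<subseteq> carrier W" using t by (auto simp: conj_def)
  have "t \<in> conj" unfolding conj_def using t by (intro CollectI exI[of _ \<one>]) simp
  then have "\<exists>u. u \<in> conj \<and> (\<forall>v. v \<in> conj \<longrightarrow> len u \<le> len v)"
    using ex_has_least_nat[of "\<lambda>u. u \<in> conj" t len] by blast
  then obtain u where u: "u \<in> conj" and min: "\<And>v. v \<in> conj \<Longrightarrow> len u \<le> len v" by blast
  obtain g where g: "g \<in> carrier W" "u = g \<otimes> t \<otimes> inv g" using u by (auto simp: conj_def)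
  have uW: "u \<in> carrier W" using g t by simp
  define \<delta> where "\<delta> = \<rho> g \<beta>"
  have ru: "\<rho> u v = \<rho> g (\<rho> t (\<rho> (inv g) v))" for v
    using g t by (simp add: mult)
  have du: "reflects (\<rho> u) \<delta>"
    unfolding reflects_def
  proof (intro conjI allI)
    have b: "\<beta> \<noteq> 0" "\<rho> t \<beta> = - \<beta>" using t(2) by (auto simp: reflects_def)
    show "\<delta> \<noteq> 0"
    proof
      assume "\<delta> = 0"
      then have "\<rho> (inv g) (\<rho> g \<beta>) = 0"
        unfolding \<delta>_def using linear_0[OF lin[OF inv_closed[OF g(1)]]] by simp
      then show False using rinv(2)[OF g(1)] b by simp
    qed
    show "\<rho> u \<delta> = - \<delta>"
      unfolding ru \<delta>_def rinv(2)[OF g(1)] b(2) linear_neg[OF lin[OF g(1)]] ..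
    fix v
    obtain a where "\<rho> t (\<rho> (inv g) v) = \<rho> (inv g) v + a *\<^sub>R \<beta>" using t(2) by (auto simp: reflects_def)
    then have "\<rho> u v = v + a *\<^sub>R \<delta>"
      unfolding ru \<delta>_def using rinv(1)[OF g(1)]
      by (simp add: linear_add[OF lin[OF g(1)]] linear_scale[OF lin[OF g(1)]])
    then show "\<exists>a. \<rho> u v = v + a *\<^sub>R \<delta>" by blast
  qed
  have "\<rho> (u \<otimes> u) = \<rho> \<one>"
    using reflects_involution[OF lin[OF uW] du] mult[OF uW uW] one by (auto simp: fun_eq_iff)
  then have uu: "u \<otimes> u = \<one>" using \<rho>(2) uW by (auto dest: inj_onD)
  then have ui: "inv u = u" using involution_inv uW by blast
  have desc: "act u (simple_root s) = - simple_root s" "u \<otimes> s = s \<otimes> u"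
    if s: "s \<in> S" "\<not> nonneg (act u (simple_root s))" for s
  proof -
    have r: "act u (simple_root s) \<in> roots" using act_roots uW s by auto
    then have neg: "nonneg (- act u (simple_root s))" using root_cases s(2) by blast
    have l: "len u = Suc (len (u \<otimes> s))" using len_down[OF uW s(1) neg] .
    have sW: "s \<in> carrier W" using s by simp
    have "len (s \<otimes> u) = len (u \<otimes> s)" using len_left[OF uW s(1)] ui by simp
    moreover have "s \<otimes> u \<otimes> s \<in> conj"
    proof -
      have "s \<otimes> u \<otimes> s = (s \<otimes> g) \<otimes> t \<otimes> inv (s \<otimes> g)"
        using g t sW s(1) by (simp add: inv_mult_group m_assoc)
      then show ?thesis using g sW unfolding conj_def by blast
    qed
    \<comment> \<open>The conjugate by \<open>s\<close> is not shorter than \<open>u\<close>, so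
      \<open>s\<close> is not a right descent of \<open>s \<otimes> u\<close>. Its root is made
      negative by \<open>u\<close> and positive again by \<open>s\<close>, hence \<open>u\<close>
      sends it to its negative.\<close>
    ultimately have "len (s \<otimes> u) \<le> len (s \<otimes> u \<otimes> s)" using min l by fastforce
    then have "nonneg (act (s \<otimes> u) (simple_root s))" using act_nonneg s uW by simp
    then have p: "nonneg (act s (act u (simple_root s)))" using s uW by (simp add: act_mult)
    show e: "act u (simple_root s) = - simple_root s"
    proof (rule ccontr)
      assume n: "act u (simple_root s) \<noteq> - simple_root s"
      then have "- act u (simple_root s) \<noteq> simple_root s" by (metis minus_minus)
      from act_simple_nonneg[OF s(1) uminus_roots[OF r] neg this]
      have "nonneg (- act s (act u (simple_root s)))" using act_simps(4)[OF sW] by simp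
      then show False using p root_not_both[OF act_roots[OF sW r]] by blast
    qed
    have "reflect u s = reflect \<one> s" using e s uW by (intro reflect_eq) auto
    then have "u \<otimes> s \<otimes> inv u = s" using s by (simp add: reflect_def)
    then show "u \<otimes> s = s \<otimes> u" using uW sW by (metis inv_solve_right m_closed)
  qed
  define I where "I = {s \<in> S. \<not> nonneg (act u (simple_root s))}"
  have IS: "I \<subseteq> S" by (auto simp: I_def)
  \<comment> \<open>A descent \<open>s\<close> of a nontrivial coset part \<open>b\<close> is a
    descent of \<open>u\<close>, so \<open>u\<close> negates its root. Transported through
    \<open>a\<close>, this contradicts the fact that the inverse of \<open>b\<close> keeps
    nonnegative vectors supported in \<open>I\<close> nonnegative.\<close>
  have uI: "u \<in> generate W I"
  proof -
    obtain a b where ab: "a \<in> generate W I" "b \<in> carrier W" "u = a \<otimes> b" "len u = len a + len b"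
      "\<And>i. i \<in> I \<Longrightarrow> nonneg (act (inv b) (simple_root i))"
      using coset_decomposition[OF IS uW] by blast
    have aW: "a \<in> carrier W" using generate_closed[OF IS ab(1)] .
    have "b = \<one>"
    proof (rule ccontr)
      assume "b \<noteq> \<one>"
      then obtain s where s: "s \<in> S" "len (b \<otimes> s) < len b" using len_last[OF ab(2)] by blast
      have "len (u \<otimes> s) \<le> len a + len (b \<otimes> s)"
        using len_mult[of a "b \<otimes> s"] ab(2,3) aW s by (simp add: m_assoc)
      then have "len (u \<otimes> s) < len u" using s(2) ab(4) by simp
      then have "nonneg (- act u (simple_root s))" using len_lt_iff(2)[OF uW s(1)] by blast
      then have sI: "s \<in> I" using s root_not_both[OF act_roots[OF uW]] by (auto simp: I_def)
      have us: "act u (simple_root s) = - simple_root s" using desc(1)[of s] sI by (auto simp: I_def)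
      let ?v = "act (inv a) (simple_root s)"
      have bs: "act b (simple_root s) = - ?v"
      proof -
        have "act a (act b (simple_root s)) = - simple_root s"
          using us ab(2,3) aW by (simp add: act_mult)
        then have "act b (simple_root s) = act (inv a) (- simple_root s)" using aW by (metis act_inv(1))
        then show ?thesis using act_simps(4)[OF inv_closed[OF aW]] by simp
      qed
      have vI: "?v \<in> coords I" using act_coords[OF IS generate_inv[OF IS ab(1)]] sI by simp
      have "nonneg (- act b (simple_root s))" using len_lt_iff(2)[OF ab(2) s(1)] s(2) by blast
      then have vp: "nonneg ?v" using bs by simp
      have "act (inv b) ?v = (\<Sum>j\<in>I. ?v j *\<^sub>R act (inv b) (simple_root j))"
        by (subst coords_expand[OF IS vI]) (simp only: act_simps[OF inv_closed[OF ab(2)]])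
      also have "nonneg \<dots>"
        using ab(5) vp by (intro nonneg_sum nonneg_scale) (auto simp only: nonneg_def)
      moreover have "act (inv b) ?v = - simple_root s"
      proof -
        have "?v = act b (- simple_root s)" using bs act_simps(4)[OF ab(2)] by simp
        then show ?thesis using act_inv(1)[OF ab(2)] by simp
      qed
      ultimately have "nonneg (- simple_root s)" by (simp only:)
      then show False using root_not_both[OF simple_root_roots[OF s(1)]] by simp
    qed
    then show ?thesis using ab aW by simp
  qed
  have fixed: "\<rho> s \<delta> = \<delta>" if s: "s \<in> I" and uI: "u \<notin> I" for s
  proof -
    have sS: "s \<in> S" "s \<in> carrier W" "u \<otimes> s = s \<otimes> u" using s desc(2) by (auto simp: I_def)
    obtain \<gamma> where "reflects (\<rho> s) \<gamma>" using S sS by blast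
    moreover have "\<rho> u (\<rho> s v) = \<rho> s (\<rho> u v)" for v
      using sS uW mult by (metis comp_apply)
    moreover have "0 < ord (u \<otimes> s)" "(\<rho> u \<circ> \<rho> s) ^^ ord (u \<otimes> s) = id"
      using ord_pos pow[of "u \<otimes> s"] mult[OF uW sS(2)] uW sS one pow_ord_eq_1 by auto
    ultimately have "\<rho> s \<delta> = \<delta> \<or> \<rho> u \<circ> \<rho> s = id"
      using reflects_commute[OF lin[OF uW] du lin[OF sS(2)]] by blast
    moreover have "\<rho> u \<circ> \<rho> s \<noteq> id"
    proof
      assume "\<rho> u \<circ> \<rho> s = id"
      then have "\<rho> (u \<otimes> s) = \<rho> \<one>" using mult[OF uW sS(2)] one by simp
      then have "u \<otimes> s = \<one>" using \<rho>(2) uW sS by (auto dest: inj_onD)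
      then have "u = s" using uW sS(1) by (metis X_cancel(2) X_closed l_one)
      then show False using s uI by simp
    qed
    ultimately show ?thesis by blast
  qed
  \<comment> \<open>If \<open>u\<close> were not in \<open>I\<close>, every element of the subgroup
    generated by \<open>I\<close> would fix \<open>\<delta>\<close>, among them \<open>u\<close>,
    which negates it.\<close>
  have "\<rho> w \<delta> = \<delta>" if "w \<in> generate W I" "u \<notin> I" for w
    using that(1)
  proof (induction rule: generate.induct)
    case one
    then show ?case using \<open>\<rho> \<one> = id\<close> by simp
  next
    case (incl s)
    then show ?case using fixed that(2) by blast
  next
    case (inv s)
    then have "inv s = s" using IS by auto
    then show ?case using fixed[OF inv that(2)] by simp
  next
    case (eng x y)
    then show ?case using mult generate_closed[OF IS] by simp
  qed
  moreover have "\<rho> u \<delta> \<noteq> \<delta>"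
  proof
    assume "\<rho> u \<delta> = \<delta>"
    then have "\<delta> = - \<delta>" "\<delta> \<noteq> 0" using du by (auto simp: reflects_def)
    then have "2 *\<^sub>R \<delta> = 0" by (metis add.right_inverse scaleR_2)
    then show False using \<open>\<delta> \<noteq> 0\<close> by simp
  qed
  ultimately have "u \<in> I" using uI by blast
  then have "u \<in> reflections" using IS S_reflections by blast
  from reflections_conj'[OF g(1) this] show ?thesis using g t by (simp add: m_assoc) (simp flip: m_assoc)
qed

end

subsection \<open>Presented groups and commuting products\<close>

context
  fixes X :: "'g set" and R :: "('g word \<times> 'g word) set"
begin

interpretation P: group "presented_group X R"
  by (rule group_presented_group)

text \<open>Replaces classes of words by products of generators, so that later arguments stay inside
  the group.\<close>

lemma pres_class_eval:
  "u \<in> words X \<Longrightarrow> pres_cong X R `` {u} = eval_word (presented_group X R) (pres_gen X R) u"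
proof (induction u)
  case Nil
  then show ?case by (simp add: eval_word_def presented_group_def)
next
  case (Cons a u)
  have x: "letter_gen a \<in> X" and u: "u \<in> words X" using Cons.prems by auto
  have "pres_cong X R `` {[a]} = eval_letter (presented_group X R) (pres_gen X R) a"
  proof (cases a)
    case (Pos x)
    then show ?thesis by (simp add: pres_gen_def)
  next
    case (Neg x)
    then have xX: "x \<in> X" using x by simp
    have w: "[Neg x] \<in> words X" "[Pos x] \<in> words X" using xX by auto
    have "pres_cong X R `` {[Neg x]} \<otimes>\<^bsub>presented_group X R\<^esub> pres_cong X R `` {[Pos x]}
      = pres_cong X R `` {[Neg x, Pos x]}"
      using presented_group_mult[OF w] by simp
    also have "\<dots> = \<one>\<^bsub>presented_group X R\<^esub>"
      using pres_cong_class_eq[OF pres_cong.inv_left[OF xX]] by (simp add: presented_group_def)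
    finally have "inv\<^bsub>presented_group X R\<^esub> (pres_gen X R x) = pres_cong X R `` {[Neg x]}"
      unfolding pres_gen_def
      by (rule P.inv_equality) (use w in \<open>auto simp: presented_group_def intro: quotientI\<close>)
    then show ?thesis using Neg by simp
  qed
  moreover have "pres_cong X R `` {[a]} \<otimes>\<^bsub>presented_group X R\<^esub> pres_cong X R `` {u}
      = pres_cong X R `` {a # u}"
    using presented_group_mult[of "[a]" X u R] x u by simp
  ultimately show ?case using Cons.IH[OF u] by (simp add: eval_word_def)
qed

lemma pres_gen_rel:
  assumes "(u, v) \<in> R" "u \<in> words X" "v \<in> words X"
  shows "eval_word (presented_group X R) (pres_gen X R) u = eval_word (presented_group X R) (pres_gen X R) v"
  using pres_class_eval[OF assms(2)] pres_class_eval[OF assms(3)] pres_cong_class_eq[OF pres_cong.rel[OF assms]]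
  by simp

lemma pres_hom_eqI:
  assumes H: "group H" and h: "h \<in> hom (presented_group X R) H" "k \<in> hom (presented_group X R) H"
    and eq: "\<And>x. x \<in> X \<Longrightarrow> h (pres_gen X R x) = k (pres_gen X R x)"
    and A: "A \<in> carrier (presented_group X R)"
  shows "h A = k A"
proof -
  interpret H: group H by (rule H)
  interpret h: group_hom "presented_group X R" H h by unfold_locales (rule h)
  interpret k: group_hom "presented_group X R" H k by unfold_locales (rule h)
  let ?e = "eval_word (presented_group X R) (pres_gen X R)"
  obtain u where u: "u \<in> words X" "A = pres_cong X R `` {u}"
    using A by (auto simp: presented_group_def elim: quotientE)
  have "?e u \<in> carrier (presented_group X R) \<and> h (?e u) = k (?e u)" if "u \<in> words X" for u
    using that
  proof (induction u)
    case (Cons a u)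
    have x: "letter_gen a \<in> X" and u: "u \<in> words X" using Cons.prems by auto
    have e: "?e (a # u) = eval_letter (presented_group X R) (pres_gen X R) a \<otimes>\<^bsub>presented_group X R\<^esub> ?e u"
      by (simp add: eval_word_def)
    have "eval_letter (presented_group X R) (pres_gen X R) a \<in> carrier (presented_group X R)
      \<and> h (eval_letter (presented_group X R) (pres_gen X R) a)
        = k (eval_letter (presented_group X R) (pres_gen X R) a)"
      using x eq[OF x] pres_gen_closed[OF x] by (cases a) auto
    then show ?case unfolding e using Cons.IH[OF u] by simp
  qed (simp add: eval_word_def)
  then show ?thesis using u pres_class_eval by metis
qed

end

context group
begin

lemma generate_commute:
  assumes X: "X \<subseteq> carrier G" "\<And>x y. x \<in> X \<Longrightarrow> y \<in> X \<Longrightarrow> x \<otimes> y = y \<otimes> x"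
    and xy: "x \<in> generate G X" "y \<in> generate G X"
  shows "x \<otimes> y = y \<otimes> x"
proof -
  have *: "a \<otimes> y = y \<otimes> a"
    if a: "a \<in> carrier G" and c: "\<And>x. x \<in> X \<Longrightarrow> a \<otimes> x = x \<otimes> a" and y: "y \<in> generate G X" for a y
    using y
  proof (induction rule: generate.induct)
    case one
    then show ?case using a by simp
  next
    case (incl h)
    then show ?case using c by blast
  next
    case (inv h)
    then have h: "h \<in> carrier G" using X by blast
    have "a \<otimes> inv h = inv h \<otimes> (h \<otimes> a) \<otimes> inv h" using h a by (simp flip: m_assoc)
    also have "\<dots> = inv h \<otimes> a" unfolding c[OF inv, symmetric] using h a by (simp add: m_assoc)
    finally show ?case .
  next
    case (eng h1 h2)
    then have h: "h1 \<in> carrier G" "h2 \<in> carrier G" using X generate_incl by blast+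
    have "a \<otimes> (h1 \<otimes> h2) = h1 \<otimes> a \<otimes> h2" using h a eng by (simp flip: m_assoc)
    also have "\<dots> = h1 \<otimes> h2 \<otimes> a" using h a eng by (simp add: m_assoc)
    finally show ?case .
  qed
  have c: "x \<in> carrier G" "y \<in> carrier G" using xy generate_incl[OF X(1)] by auto
  have "z \<otimes> x = x \<otimes> z" if "z \<in> X" for z using *[of z x] that X xy(1) by blast
  then show ?thesis using *[OF c(1) _ xy(2)] by simp
qed

lemma commuting_prod_eq:
  assumes d: "distinct xs" and f: "f ` set xs \<subseteq> carrier G"
    and c: "\<And>x y. x \<in> set xs \<Longrightarrow> y \<in> set xs \<Longrightarrow> f x \<otimes> f y = f y \<otimes> f x"
  shows "commuting_prod G f (set xs) = list_prod G (map f xs)"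
proof -
  let ?H = "G\<lparr>carrier := generate G (f ` set xs)\<rparr>"
  have "group ?H" by (rule subgroup_imp_group[OF generate_is_subgroup[OF f]])
  moreover have "x \<otimes> y = y \<otimes> x" if "x \<in> generate G (f ` set xs)" "y \<in> generate G (f ` set xs)" for x y
    using generate_commute[OF f _ that] c by blast
  ultimately have "comm_group ?H" by (intro group.group_comm_groupI) auto
  then interpret H: comm_group ?H .
  have "finprod ?H f (set ys) = list_prod G (map f ys)" if "distinct ys" "set ys \<subseteq> set xs" for ys
    using that
  proof (induction ys)
    case (Cons y ys)
    have "f \<in> set ys \<rightarrow> carrier ?H" "f y \<in> carrier ?H"
      using Cons.prems by (auto intro: generate.incl)
    then show ?case using Cons by (simp add: H.finprod_insert)
  qed simp
  then show ?thesis unfolding commuting_prod_def using d by blast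
qed

end

text \<open>The representation that defines \<open>T\<close> is unrelated to the geometric one. One
  inclusion rests on \<open>reflects_imp_reflection\<close>; for the other, conjugates of linear
  reflections are linear reflections, and \<open>codim_reflects\<close> recognizes them.\<close>

lemma (in finite_coxeter) reflections_eq:
  assumes "abstract_reflection_group TYPE('v::real_vector) W T" "S \<subseteq> T"
  shows "T = reflections"
proof -
  obtain B :: "'v set" and \<rho> :: "'a \<Rightarrow> 'v \<Rightarrow> 'v" where T: "T \<subseteq> carrier W"
    and B: "finite B" "span B = UNIV"
    and \<rho>: "\<rho> \<in> hom W GL" "inj_on \<rho> (carrier W)"
    and codim: "\<And>w. w \<in> carrier W \<Longrightarrow> codim {v. \<rho> w v - v = 0} = 1 \<longleftrightarrow> w \<in> T"
    using assms(1) unfolding abstract_reflection_group_def by auto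
  have lin: "linear (\<rho> x)" if "x \<in> carrier W" for x
    using \<rho>(1) that by (auto simp: hom_def Pi_iff)
  have mult: "\<rho> (x \<otimes> y) = \<rho> x \<circ> \<rho> y" if "x \<in> carrier W" "y \<in> carrier W" for x y
    using hom_mult[OF \<rho>(1) that] by simp
  have one: "\<rho> \<one> = id" using hom_one[OF \<rho>(1) is_group group_GL] by simp
  have pow: "(\<rho> x) ^^ n = \<rho> (x [^] n)" if "x \<in> carrier W" for x and n :: nat
  proof (induction n)
    case (Suc n)
    then show ?case using mult[OF that, of "x [^] n"] that
      by (metis funpow.simps(2) nat_pow_Suc2 nat_pow_closed)
  qed (simp add: one)
  have refl: "\<exists>\<beta>. reflects (\<rho> t) \<beta>" if t: "t \<in> T" for t
  proof -
    have tW: "t \<in> carrier W" using t T by blast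
    have "\<rho> t ^^ ord t = id" using pow[OF tW] pow_ord_eq_1[OF tW] one by simp
    then show ?thesis using reflects_codim[OF B lin[OF tW] ord_pos[OF tW]] codim[OF tW] t by blast
  qed
  show ?thesis
  proof
    show "T \<subseteq> reflections"
    proof
      fix t assume t: "t \<in> T"
      then obtain \<beta> where "reflects (\<rho> t) \<beta>" using refl by blast
      moreover have "t \<in> carrier W" using t T by blast
      ultimately show "t \<in> reflections"
        using reflects_imp_reflection[OF \<rho>] refl assms(2) by blast
    qed
    show "reflections \<subseteq> T"
    proof
      fix t assume t: "t \<in> reflections"
      obtain x s where x: "x \<in> carrier W" "s \<in> S" "t = reflect x s"
        using reflections_cases[OF t] by metis
      obtain \<gamma> where g: "reflects (\<rho> s) \<gamma>" using refl x(2) assms(2) by blast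
      have tW: "t \<in> carrier W" using x by simp
      have rt: "\<rho> t v = \<rho> x (\<rho> s (\<rho> (inv x) v))" for v using x by (simp add: reflect_def mult)
      have ri: "\<rho> (inv x) (\<rho> x v) = v" "\<rho> x (\<rho> (inv x) v) = v" for v
        using mult[of x "inv x"] mult[of "inv x" x] x one by (simp_all add: fun_eq_iff)
      have "reflects (\<rho> t) (\<rho> x \<gamma>)"
        unfolding reflects_def
      proof (intro conjI allI)
        have b: "\<gamma> \<noteq> 0" "\<rho> s \<gamma> = - \<gamma>" using g by (auto simp: reflects_def)
        show "\<rho> x \<gamma> \<noteq> 0"
          using b(1) ri(1)[of \<gamma>] linear_0[OF lin[OF inv_closed[OF x(1)]]] by metis
        show "\<rho> t (\<rho> x \<gamma>) = - \<rho> x \<gamma>"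
          unfolding rt ri b(2) linear_neg[OF lin[OF x(1)]] ..
        fix v
        obtain a where a: "\<rho> s (\<rho> (inv x) v) = \<rho> (inv x) v + a *\<^sub>R \<gamma>" using g by (auto simp: reflects_def)
        have "\<rho> t v = v + a *\<^sub>R \<rho> x \<gamma>"
          unfolding rt a linear_add[OF lin[OF x(1)]] linear_scale[OF lin[OF x(1)]] ri ..
        then show "\<exists>a. \<rho> t v = v + a *\<^sub>R \<rho> x \<gamma>" ..
      qed
      then show "t \<in> T" using codim_reflects[OF B lin[OF tW]] codim[OF tW] by blast
    qed
  qed
qed

subsection \<open>The interval below a bipartite Coxeter element\<close>

locale bipartite_coxeter = finite_coxeter W S
  for W (structure) and S :: "'a set" +
  fixes lL lR :: "'a list"
  assumes bip_words: "distinct (lL @ lR)" "set (lL @ lR) = S"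
    and bip_commL: "\<And>s t. s \<in> set lL \<Longrightarrow> t \<in> set lL \<Longrightarrow> s \<otimes> t = t \<otimes> s"
    and bip_commR: "\<And>s t. s \<in> set lR \<Longrightarrow> t \<in> set lR \<Longrightarrow> s \<otimes> t = t \<otimes> s"
begin

lemma artin_braid:
  assumes "s \<in> S" "t \<in> S"
  shows "alt_prod (artin_group W S) (ord (s \<otimes> t)) (artin_gen W S s) (artin_gen W S t)
    = alt_prod (artin_group W S) (ord (s \<otimes> t)) (artin_gen W S t) (artin_gen W S s)"
proof -
  let ?m = "ord (s \<otimes> t)"
  have w: "alternating n a b \<in> words S" if "a \<in> S" "b \<in> S" for n a b
    using that by (induction n arbitrary: a b) auto
  have "(alternating ?m s t, alternating ?m t s) \<in> braid_relations W S"
    using assms by (auto simp: braid_relations_def)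
  from pres_gen_rel[OF this w[OF assms] w[OF assms(2,1)]] show ?thesis
    by (simp add: artin_group_def artin_gen_def eval_word_alternating)
qed

sublocale bipartite_target W S "artin_group W S" "artin_gen W S" lL lR
proof -
  interpret A: group "artin_group W S"
    unfolding artin_group_def by (rule group_presented_group)
  have gen: "artin_gen W S s \<in> carrier (artin_group W S)" if "s \<in> S" for s
    unfolding artin_gen_def artin_group_def using that by (rule pres_gen_closed)
  show "bipartite_target W S (artin_group W S) (artin_gen W S) lL lR"
    by unfold_locales (assumption | rule gen bip_words bip_commL bip_commR artin_braid)+
qed

lemma generate_reflections: "generate W reflections = carrier W"
proof
  show "generate W reflections \<subseteq> carrier W" by (rule generate_incl) auto
  have "S \<subseteq> reflections" using S_reflections by blast
  then show "carrier W \<subseteq> generate W reflections"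
    using mono_generate generate_S by blast
qed

text \<open>From here on \<open>T.len\<close> is the reflection length, and plain \<open>len\<close>
  remains the Coxeter length.\<close>

sublocale T: involution_generated W reflections
  by unfold_locales (use reflections_square generate_reflections in auto)

abbreviation c where "c \<equiv> cox S"
abbreviation P where "P \<equiv> interval W reflections c"
abbreviation D where "D \<equiv> interval_group W reflections c"
abbreviation \<gamma> where "\<gamma> \<equiv> interval_gen W reflections c"
abbreviation Art where "Art \<equiv> artin_group W S"

sublocale D: group D
  unfolding interval_group_def by (rule group_presented_group)

lemma c_closed [simp]: "c \<in> carrier W"
  by simp

lemma tlen_conj:
  assumes "g \<in> carrier W" "w \<in> carrier W"
  shows "T.len (g \<otimes> w \<otimes> inv g) = T.len w"
proof (rule antisym)
  show "T.len (g \<otimes> w \<otimes> inv g) \<le> T.len w"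
    using T.len_conj_le[OF assms(1) reflections_conj[OF assms(1)] assms(2)] by blast
  have "T.len (inv g \<otimes> (g \<otimes> w \<otimes> inv g) \<otimes> inv (inv g)) \<le> T.len (g \<otimes> w \<otimes> inv g)"
    using assms by (intro T.len_conj_le reflections_conj) auto
  moreover have "inv g \<otimes> (g \<otimes> w \<otimes> inv g) \<otimes> inv (inv g) = w"
    using assms by (simp add: m_assoc inv_cancel)
  ultimately show "T.len w \<le> T.len (g \<otimes> w \<otimes> inv g)" by simp
qed

lemma tlen_cox: "I \<subseteq> S \<Longrightarrow> T.len (cox I) = card I"
proof (rule antisym)
  assume I: "I \<subseteq> S"
  have "set (cox_word I) \<subseteq> reflections" using set_cox_word[OF I] I S_reflections by blast
  from T.len_le[OF this] show "T.len (cox I) \<le> card I"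
    using length_cox_word[OF I] by (simp add: cox_def)
  obtain ts where "set ts \<subseteq> reflections" "length ts = T.len (cox I)" "list_prod W ts = cox I"
    using T.len_word[OF cox_closed[OF I]] by blast
  then show "card I \<le> T.len (cox I)"
    using factorization_length(1)[OF distinct_cox_word, of I ts] set_cox_word[OF I] length_cox_word[OF I] I
    by (simp add: cox_def)
qed

lemma interval_iff:
  "w \<in> P \<longleftrightarrow> w \<in> carrier W \<and> T.len w + T.len (inv w \<otimes> c) = T.len c"
  by (simp add: interval_def refl_prec_def)

lemma interval_closed: "w \<in> P \<Longrightarrow> w \<in> carrier W"
  by (simp add: interval_iff)

text \<open>Subadditivity of the reflection length applied to the factors \<open>p\<close>,
  \<open>q\<close> and the complement of \<open>p \<otimes> q\<close> in \<open>c\<close>. For the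
  right factor, \<open>p\<close> is moved past \<open>q\<close> by a conjugation, which keeps its
  length.\<close>

lemma interval_factor:
  assumes p: "p \<in> carrier W" and q: "q \<in> carrier W" and pq: "p \<otimes> q \<in> P"
    and l: "T.len (p \<otimes> q) = T.len p + T.len q"
  shows "p \<in> P" "q \<in> P"
proof -
  let ?r = "inv (p \<otimes> q) \<otimes> c"
  have r: "?r \<in> carrier W" using p q by simp
  have lc: "T.len p + T.len q + T.len ?r = T.len c" using pq l by (simp add: interval_iff)
  have e: "inv p \<otimes> c = q \<otimes> ?r" using p q by (simp add: inv_mult_group m_assoc inv_cancel)
  have "T.len (inv p \<otimes> c) \<le> T.len q + T.len ?r" unfolding e by (rule T.len_mult[OF q r])
  moreover have "T.len c \<le> T.len p + T.len (inv p \<otimes> c)"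
    using T.len_mult[OF p, of "inv p \<otimes> c"] p by (simp add: inv_cancel)
  ultimately show "p \<in> P" using lc p by (simp add: interval_iff)
  have e: "inv q \<otimes> c = (inv q \<otimes> p \<otimes> inv (inv q)) \<otimes> ?r"
    using p q by (simp add: inv_mult_group m_assoc inv_cancel)
  have "T.len (inv q \<otimes> c) \<le> T.len p + T.len ?r"
    unfolding e using T.len_mult[OF _ r, of "inv q \<otimes> p \<otimes> inv (inv q)"] tlen_conj[of "inv q" p] p q by simp
  moreover have "T.len c \<le> T.len q + T.len (inv q \<otimes> c)"
    using T.len_mult[OF q, of "inv q \<otimes> c"] q by (simp add: inv_cancel)
  ultimately show "q \<in> P" using lc q by (simp add: interval_iff)
qed

lemma c_in_interval: "c \<in> P"
  by (simp add: interval_iff)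

lemma one_in_interval: "\<one> \<in> P"
  by (simp add: interval_iff)

text \<open>Powers of \<open>c\<close> commute with \<open>c\<close>, so the claim reduces to a
  simple reflection \<open>s\<close>, where \<open>s \<otimes> c\<close> has the length of the
  Coxeter element without \<open>s\<close>.\<close>

lemma reflections_in_interval:
  assumes t: "t \<in> reflections"
  shows "t \<in> P" "T.len t = 1"
proof -
  have tS: "t \<in> reflections_in S"
    using t root_of_pos[OF t] by (simp add: reflections_in_def pos_roots_def)
  obtain k s where s: "s \<in> S" and ts: "t = c [^] (k::nat) \<otimes> s \<otimes> inv (c [^] k)"
    using reflection_coxeter_conj[OF order.refl tS] by blast
  let ?g = "c [^] k"
  have g: "?g \<in> carrier W" and sW: "s \<in> carrier W" using s by auto
  have gc: "c \<otimes> inv ?g = inv ?g \<otimes> c"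
  proof -
    have "?g \<otimes> c = c \<otimes> ?g" by (metis c_closed nat_pow_Suc nat_pow_Suc2)
    then have "inv ?g \<otimes> (?g \<otimes> c) \<otimes> inv ?g = inv ?g \<otimes> (c \<otimes> ?g) \<otimes> inv ?g" by simp
    then show ?thesis using g by (simp add: m_assoc inv_cancel)
  qed
  have "t \<otimes> c = ?g \<otimes> (s \<otimes> c) \<otimes> inv ?g"
    unfolding ts using g sW gc by (simp add: m_assoc)
  then have "T.len (t \<otimes> c) = T.len (s \<otimes> c)" using tlen_conj g sW by simp
  moreover have "T.len (s \<otimes> c) = card (S - {s})"
  proof (cases "s \<in> set lL")
    case True
    have "s \<otimes> c = cox (S - {s})"
      using cox_word_remove(1)[OF order.refl s True] s by simp
    then show ?thesis using tlen_cox[of "S - {s}"] by simp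
  next
    case False
    then have sR: "s \<in> set lR" using s lLR by auto
    have "s \<otimes> c = s \<otimes> cox (S - {s}) \<otimes> inv s"
      using cox_word_remove(3)[OF order.refl s sR] s by (simp add: m_assoc)
    then show ?thesis using tlen_conj[OF sW, of "cox (S - {s})"] tlen_cox[of "S - {s}"] by simp
  qed
  moreover have "T.len c = Suc (card (S - {s}))"
    using tlen_cox[of S] s card_Suc_Diff1[OF finite_S s] by simp
  moreover have "T.len c \<le> T.len t + T.len (t \<otimes> c)"
    using T.len_mult[of t "t \<otimes> c"] t by simp
  moreover have "T.len t \<le> 1" using T.len_gen_le[OF t] .
  ultimately show "t \<in> P" "T.len t = 1" using t by (auto simp: interval_iff)
qed

section \<open>The interval group: conjugation and braid relations\<close>

lemma \<gamma>_closed [simp]: "w \<in> P \<Longrightarrow> \<gamma> w \<in> carrier D"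
  unfolding interval_gen_def interval_group_def by (rule pres_gen_closed)

lemma \<gamma>_mult:
  assumes "p \<in> carrier W" "q \<in> carrier W" "p \<otimes> q \<in> P" "T.len (p \<otimes> q) = T.len p + T.len q"
  shows "\<gamma> p \<otimes>\<^bsub>D\<^esub> \<gamma> q = \<gamma> (p \<otimes> q)"
proof -
  note pq = interval_factor[OF assms]
  have "([Pos p, Pos q], [Pos (p \<otimes> q)]) \<in> interval_relations W reflections c"
    using pq assms unfolding interval_relations_def by blast
  from pres_gen_rel[OF this] have "\<gamma> p \<otimes>\<^bsub>D\<^esub> (\<gamma> q \<otimes>\<^bsub>D\<^esub> \<one>\<^bsub>D\<^esub>) = \<gamma> (p \<otimes> q) \<otimes>\<^bsub>D\<^esub> \<one>\<^bsub>D\<^esub>"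
    using pq assms(3) by (simp add: eval_word_def interval_group_def interval_gen_def)
  then show ?thesis using pq assms(3) by simp
qed

lemma \<gamma>_one: "\<gamma> \<one> = \<one>\<^bsub>D\<^esub>"
  using \<gamma>_mult[of \<one> \<one>] one_in_interval \<gamma>_closed[OF one_in_interval]
  by (simp add: D.l_cancel_one)

text \<open>The order of the reflection length below an arbitrary top element; it is needed for
  \<open>c\<close> and for products of two simple reflections.\<close>

definition below :: "'a \<Rightarrow> 'a \<Rightarrow> bool" where
  "below p u \<longleftrightarrow> p \<in> carrier W \<and> T.len p + T.len (inv p \<otimes> u) = T.len u"

text \<open>With \<open>q = u \<otimes> inv p\<close> there are two factorizations of
  \<open>u\<close> with adding lengths, \<open>q \<otimes> p\<close> and
  \<open>(u \<otimes> p \<otimes> inv u) \<otimes> q\<close>, and both are relations of the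
  presentation.\<close>

lemma \<gamma>_conj:
  assumes u: "u \<in> P" and p: "below p u"
  shows "\<gamma> u \<otimes>\<^bsub>D\<^esub> \<gamma> p = \<gamma> (u \<otimes> p \<otimes> inv u) \<otimes>\<^bsub>D\<^esub> \<gamma> u" "below (u \<otimes> p \<otimes> inv u) u" "p \<in> P"
proof -
  have uW: "u \<in> carrier W" and pW: "p \<in> carrier W" using u p by (auto simp: interval_iff below_def)
  let ?q = "u \<otimes> inv p" and ?p = "u \<otimes> p \<otimes> inv u"
  have qW: "?q \<in> carrier W" "?p \<in> carrier W" using uW pW by auto
  have "?q = p \<otimes> (inv p \<otimes> u) \<otimes> inv p" using uW pW by (simp add: m_assoc inv_cancel)
  then have lq: "T.len ?q = T.len (inv p \<otimes> u)" using tlen_conj[of p "inv p \<otimes> u"] uW pW by simp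
  have lp: "T.len ?p = T.len p" using tlen_conj[OF uW pW] .
  have 1: "?q \<otimes> p = u" using uW pW by (simp add: m_assoc)
  have 2: "?p \<otimes> ?q = u" using uW pW by (simp add: m_assoc inv_cancel)
  have l: "T.len u = T.len ?q + T.len p" "T.len u = T.len ?p + T.len ?q"
    using p lq lp by (auto simp: below_def)
  note f1 = interval_factor[OF qW(1) pW, unfolded 1, OF u l(1)]
    and f2 = interval_factor[OF qW(2,1), unfolded 2, OF u l(2)]
  have g1: "\<gamma> ?q \<otimes>\<^bsub>D\<^esub> \<gamma> p = \<gamma> u" using \<gamma>_mult[OF qW(1) pW] u l 1 by simp
  have g2: "\<gamma> ?p \<otimes>\<^bsub>D\<^esub> \<gamma> ?q = \<gamma> u" using \<gamma>_mult[OF qW(2,1)] u l 2 by simp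
  have "\<gamma> u \<otimes>\<^bsub>D\<^esub> \<gamma> p = \<gamma> ?p \<otimes>\<^bsub>D\<^esub> (\<gamma> ?q \<otimes>\<^bsub>D\<^esub> \<gamma> p)"
    unfolding g2[symmetric] by (rule D.m_assoc) (use f1 f2 in auto)
  then show "\<gamma> u \<otimes>\<^bsub>D\<^esub> \<gamma> p = \<gamma> ?p \<otimes>\<^bsub>D\<^esub> \<gamma> u" unfolding g1 .
  have "inv ?p \<otimes> u = ?q" using uW pW by (simp add: inv_mult_group m_assoc)
  then show "below ?p u" using l qW by (simp add: below_def)
  show "p \<in> P" by (rule f1(2))
qed

lemma \<gamma>_conj_pow:
  assumes u: "u \<in> P" and p: "below p u"
  shows "\<gamma> u [^]\<^bsub>D\<^esub> (k::nat) \<otimes>\<^bsub>D\<^esub> \<gamma> p = \<gamma> (u [^] k \<otimes> p \<otimes> inv (u [^] k)) \<otimes>\<^bsub>D\<^esub> \<gamma> u [^]\<^bsub>D\<^esub> k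
    \<and> below (u [^] k \<otimes> p \<otimes> inv (u [^] k)) u"
proof (induction k)
  case 0
  have "p \<in> carrier W" using p by (simp add: below_def)
  then show ?case using p \<gamma>_conj(3)[OF u p] by simp
next
  case (Suc k)
  have uW: "u \<in> carrier W" and pW: "p \<in> carrier W" using u p by (auto simp: interval_iff below_def)
  let ?p = "u [^] k \<otimes> p \<otimes> inv (u [^] k)" and ?U = "\<gamma> u"
  have b: "below ?p u" using Suc by blast
  have e: "u [^] Suc k \<otimes> p \<otimes> inv (u [^] Suc k) = u \<otimes> ?p \<otimes> inv u"
    unfolding nat_pow_Suc2[OF uW] using uW pW by (simp add: inv_mult_group m_assoc)
  have U: "?U \<in> carrier D" "?U [^]\<^bsub>D\<^esub> k \<in> carrier D" using u by auto
  have pP: "\<gamma> p \<in> carrier D" "\<gamma> ?p \<in> carrier D" using \<gamma>_conj(3)[OF u p] \<gamma>_conj(3)[OF u b] by auto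
  have qP: "\<gamma> (u \<otimes> ?p \<otimes> inv u) \<in> carrier D"
    using \<gamma>_conj(3)[OF u \<gamma>_conj(2)[OF u b]] by simp
  have "?U [^]\<^bsub>D\<^esub> Suc k \<otimes>\<^bsub>D\<^esub> \<gamma> p = ?U \<otimes>\<^bsub>D\<^esub> (?U [^]\<^bsub>D\<^esub> k \<otimes>\<^bsub>D\<^esub> \<gamma> p)"
    unfolding D.nat_pow_Suc2[OF U(1)] by (rule D.m_assoc[OF U pP(1)])
  also have "\<dots> = ?U \<otimes>\<^bsub>D\<^esub> (\<gamma> ?p \<otimes>\<^bsub>D\<^esub> ?U [^]\<^bsub>D\<^esub> k)" using Suc by simp
  also have "\<dots> = (?U \<otimes>\<^bsub>D\<^esub> \<gamma> ?p) \<otimes>\<^bsub>D\<^esub> ?U [^]\<^bsub>D\<^esub> k" by (rule D.m_assoc[OF U(1) pP(2) U(2), symmetric])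
  also have "\<dots> = (\<gamma> (u \<otimes> ?p \<otimes> inv u) \<otimes>\<^bsub>D\<^esub> ?U) \<otimes>\<^bsub>D\<^esub> ?U [^]\<^bsub>D\<^esub> k" unfolding \<gamma>_conj(1)[OF u b] ..
  also have "\<dots> = \<gamma> (u \<otimes> ?p \<otimes> inv u) \<otimes>\<^bsub>D\<^esub> ?U [^]\<^bsub>D\<^esub> Suc k"
    unfolding D.nat_pow_Suc2[OF U(1)] by (rule D.m_assoc[OF qP U])
  finally show ?case unfolding e using \<gamma>_conj(2)[OF u b] by blast
qed

lemma below_c: "p \<in> P \<longleftrightarrow> below p c"
  by (simp add: interval_iff below_def)

lemma \<gamma>_word:
  assumes "set ts \<subseteq> reflections" "list_prod W ts \<in> P" "T.len (list_prod W ts) = length ts"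
  shows "list_prod D (map \<gamma> ts) = \<gamma> (list_prod W ts)"
  using assms
proof (induction ts)
  case Nil
  then show ?case by (simp add: \<gamma>_one)
next
  case (Cons t ts)
  have t: "t \<in> reflections" "t \<in> carrier W" and ts: "set ts \<subseteq> reflections" "list_prod W ts \<in> carrier W"
    using Cons.prems by auto
  have "T.len (list_prod W ts) \<le> length ts" using T.len_le ts by blast
  moreover have "T.len (t \<otimes> list_prod W ts) \<le> Suc (T.len (list_prod W ts))"
    using T.len_step(3)[OF t(1) ts(2)] .
  ultimately have l: "T.len (list_prod W ts) = length ts" using Cons.prems(3) by simp
  have add: "T.len (t \<otimes> list_prod W ts) = T.len t + T.len (list_prod W ts)"
    using Cons.prems(3) l reflections_in_interval(2)[OF t(1)] by simp
  have P: "t \<otimes> list_prod W ts \<in> P" using Cons.prems(2) by simp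
  have "list_prod D (map \<gamma> ts) = \<gamma> (list_prod W ts)"
    using Cons.IH[OF ts(1) interval_factor(2)[OF t(2) ts(2) P add] l] .
  then show ?case using \<gamma>_mult[OF t(2) ts(2) P add] by simp
qed

text \<open>The order of the letters has to agree with \<open>c\<close>: under the assumption on the
  sides, \<open>c\<close> is the product, in one order or the other, of \<open>s \<otimes> t\<close>
  and an element of reflection length two less. For a left \<open>s\<close> and a right
  \<open>t\<close>, which stand at opposite ends of \<open>c\<close>, this takes a
  conjugation.\<close>

lemma pair_in_interval:
  assumes s: "s \<in> S" and t: "t \<in> S" and st: "s \<noteq> t" and LR: "s \<in> set lL \<or> t \<in> set lR"
  shows "s \<otimes> t \<in> P" "T.len (s \<otimes> t) = 2"
proof -
  let ?J = "S - {s} - {t}"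
  let ?d = "cox ?J"
  have J: "?J \<subseteq> S" by auto
  then have d: "?d \<in> carrier W" by (rule cox_closed)
  have n: "card S = card ?J + 2"
    using card_Suc_Diff1[OF finite_S s] card_Suc_Diff1[of "S - {s}" t] s t st by simp
  have sW: "s \<in> carrier W" "t \<in> carrier W" "s \<otimes> t \<in> carrier W" using s t by auto
  have l2: "T.len (s \<otimes> t) \<le> 2"
    using T.len_mult[OF sW(1,2)] T.len_gen_le[OF S_reflections[OF s]] T.len_gen_le[OF S_reflections[OF t]]
    by simp
  have tS: "t \<in> S - {s}" "s \<in> S - {t}" and sub: "S - {s} \<subseteq> S" "S - {t} \<subseteq> S" using s t st by auto
  have J': "S - {t} - {s} = ?J" by auto
  have "\<exists>r\<in>carrier W. T.len r = card ?J \<and> (c = (s \<otimes> t) \<otimes> r \<or> c = r \<otimes> (s \<otimes> t))"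
  proof (cases "s \<in> set lL")
    case True
    have c1: "c = s \<otimes> cox (S - {s})" by (rule cox_word_remove(1)[OF order.refl s True])
    show ?thesis
    proof (cases "t \<in> set lL")
      case tL: True
      have "c = (s \<otimes> t) \<otimes> ?d"
        unfolding c1 cox_word_remove(1)[OF sub(1) tS(1) tL] using sW d by (simp add: m_assoc)
      then show ?thesis using d tlen_cox[OF J] by blast
    next
      case False
      then have tR: "t \<in> set lR" using t lLR by auto
      have "c = (s \<otimes> t) \<otimes> (t \<otimes> ?d \<otimes> inv t)"
        unfolding c1 cox_word_remove(3)[OF sub(1) tS(1) tR] using sW d t by (simp add: m_assoc)
      moreover have "T.len (t \<otimes> ?d \<otimes> inv t) = card ?J" using tlen_conj[OF sW(2) d] tlen_cox[OF J] by simp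
      moreover have "t \<otimes> ?d \<otimes> inv t \<in> carrier W" using sW d by simp
      ultimately show ?thesis by blast
    qed
  next
    case False
    then have sR: "s \<in> set lR" and tR: "t \<in> set lR" using s lLR LR by auto
    have "c = ?d \<otimes> (s \<otimes> t)"
      unfolding cox_word_remove(3)[OF order.refl t tR] cox_word_remove(3)[OF sub(2) tS(2) sR] J'
      using sW d by (simp add: m_assoc)
    then show ?thesis using d tlen_cox[OF J] by blast
  qed
  then obtain r where r: "r \<in> carrier W" "T.len r = card ?J"
    "c = (s \<otimes> t) \<otimes> r \<or> c = r \<otimes> (s \<otimes> t)" by blast
  have lc: "T.len c = card ?J + 2" using tlen_cox[of S] n by simp
  have "T.len c \<le> T.len (s \<otimes> t) + T.len r"
    using r(3) T.len_mult[OF sW(3) r(1)] T.len_mult[OF r(1) sW(3)] by auto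
  then show l: "T.len (s \<otimes> t) = 2" using l2 lc r(2) by simp
  show "s \<otimes> t \<in> P"
    using r(3)
  proof
    assume e: "c = (s \<otimes> t) \<otimes> r"
    show ?thesis
      by (rule interval_factor(1)[OF sW(3) r(1)]) (use e[symmetric] c_in_interval l lc r in auto)
  next
    assume e: "c = r \<otimes> (s \<otimes> t)"
    show ?thesis
      by (rule interval_factor(2)[OF r(1) sW(3)]) (use e[symmetric] c_in_interval l lc r in auto)
  qed
qed

lemma S_interval: "s \<in> S \<Longrightarrow> s \<in> P" "s \<in> S \<Longrightarrow> T.len s = 1"
  using reflections_in_interval S_reflections by auto

text \<open>Conjugation by \<open>(s \<otimes> t) [^] k\<close> fixes \<open>t\<close> if the order
  is \<open>2 * k\<close> and takes \<open>s\<close> to \<open>t\<close> if it is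
  \<open>Suc (2 * k)\<close>; both follow from the braid relation in \<open>W\<close>. As
  \<open>\<gamma> (s \<otimes> t)\<close> is the product of the two generators,
  \<open>\<gamma>_conj_pow\<close> transports this to the interval group.\<close>

lemma braid_interval_of_pair:
  assumes s: "s \<in> S" and t: "t \<in> S" and u: "s \<otimes> t \<in> P" "T.len (s \<otimes> t) = 2"
  shows "alt_prod D (ord (s \<otimes> t)) (\<gamma> s) (\<gamma> t) = alt_prod D (ord (s \<otimes> t)) (\<gamma> t) (\<gamma> s)"
proof -
  let ?u = "s \<otimes> t" and ?a = "\<gamma> s" and ?b = "\<gamma> t" and ?m = "ord (s \<otimes> t)"
  have W: "s \<in> carrier W" "t \<in> carrier W" "?u \<in> carrier W" using s t by auto
  have ab: "?a \<in> carrier D" "?b \<in> carrier D" using S_interval s t by auto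
  have U: "\<gamma> ?u = ?a \<otimes>\<^bsub>D\<^esub> ?b"
    using \<gamma>_mult[OF W(1,2) u(1)] u(2) S_interval(2) s t by simp
  have bs: "below s ?u" using W u(2) S_interval(2) s t by (simp add: below_def)
  have bt: "below t ?u"
  proof -
    have "T.len (inv t \<otimes> ?u) = T.len (t \<otimes> s \<otimes> inv t)" using s t W by (simp add: m_assoc)
    then show ?thesis using tlen_conj[OF W(2,1)] W u(2) S_interval(2) s t by (simp add: below_def)
  qed
  have bW: "alt_prod W ?m s t = alt_prod W ?m t s" by (rule braid_W[OF s t])
  obtain k where "?m = 2 * k \<or> ?m = Suc (2 * k)" by (metis oddE evenE Suc_eq_plus1)
  then show ?thesis
  proof
    assume m: "?m = 2 * k"
    have uk: "alt_prod W (2 * k) s t = ?u [^] k" "alt_prod W (2 * k) t s = ?u [^] k"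
      using alt_prod_double[OF W(1,2)] bW m by auto
    have "alt_prod W (Suc (2 * k)) t s = alt_prod W (2 * k) t s \<otimes> t"
      using alt_prod_Suc_right[OF W(2,1), of "2 * k"] by simp
    then have "t \<otimes> ?u [^] k = ?u [^] k \<otimes> t" using uk by simp
    then have "?u [^] k \<otimes> t \<otimes> inv (?u [^] k) = t \<otimes> ?u [^] k \<otimes> inv (?u [^] k)" by simp
    also have "\<dots> = t" using W by (simp add: m_assoc)
    finally have ut: "?u [^] k \<otimes> t \<otimes> inv (?u [^] k) = t" .
    have UD: "\<gamma> ?u [^]\<^bsub>D\<^esub> k = alt_prod D (2 * k) ?a ?b" unfolding U D.alt_prod_double[OF ab] ..
    have "alt_prod D (2 * k) ?b ?a \<otimes>\<^bsub>D\<^esub> ?b = ?b \<otimes>\<^bsub>D\<^esub> alt_prod D (2 * k) ?a ?b"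
      using D.alt_prod_Suc_right[OF ab(2,1), of "2 * k"] by simp
    also have "\<dots> = alt_prod D (2 * k) ?a ?b \<otimes>\<^bsub>D\<^esub> ?b"
      using \<gamma>_conj_pow[OF u(1) bt, of k] ut UD by simp
    finally have "alt_prod D (2 * k) ?b ?a = alt_prod D (2 * k) ?a ?b"
      using ab D.right_cancel by simp
    then show ?thesis using m by simp
  next
    assume m: "?m = Suc (2 * k)"
    have "?u [^] k \<otimes> s = t \<otimes> ?u [^] k"
      using bW alt_prod_Suc_right[OF W(1,2), of "2 * k"] alt_prod_double[OF W(1,2), of k] unfolding m by simp
    then have "?u [^] k \<otimes> s \<otimes> inv (?u [^] k) = t \<otimes> ?u [^] k \<otimes> inv (?u [^] k)" by simp
    also have "\<dots> = t" using W by (simp add: m_assoc)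
    finally have us: "?u [^] k \<otimes> s \<otimes> inv (?u [^] k) = t" .
    have "alt_prod D (Suc (2 * k)) ?a ?b = \<gamma> ?u [^]\<^bsub>D\<^esub> k \<otimes>\<^bsub>D\<^esub> ?a"
      unfolding D.alt_prod_Suc_right[OF ab] U D.alt_prod_double[OF ab] by simp
    also have "\<dots> = ?b \<otimes>\<^bsub>D\<^esub> \<gamma> ?u [^]\<^bsub>D\<^esub> k" using \<gamma>_conj_pow[OF u(1) bs, of k] us by simp
    also have "\<dots> = alt_prod D (Suc (2 * k)) ?b ?a"
      unfolding U D.alt_prod_double[OF ab, symmetric] by simp
    finally show ?thesis unfolding m .
  qed
qed

lemma braid_interval:
  assumes s: "s \<in> S" and t: "t \<in> S"
  shows "alt_prod D (ord (s \<otimes> t)) (\<gamma> s) (\<gamma> t) = alt_prod D (ord (s \<otimes> t)) (\<gamma> t) (\<gamma> s)"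
proof (cases "s = t")
  case False
  show ?thesis
  proof (cases "s \<in> set lL \<or> t \<in> set lR")
    case True
    then show ?thesis using braid_interval_of_pair[OF s t pair_in_interval[OF s t False]] by simp
  next
    case n: False
    then have "t \<in> set lL \<or> s \<in> set lR" using s lLR by auto
    then show ?thesis
      using braid_interval_of_pair[OF t s pair_in_interval[OF t s not_sym[OF False]]] ord_swap[OF s t] by simp
  qed
qed simp

section \<open>The homomorphisms in both directions\<close>

definition to_interval :: "'a word set \<Rightarrow> 'a word set" where
  "to_interval = pres_lift D \<gamma>"

lemma artin_rel_interval:
  assumes "(u, v) \<in> braid_relations W S"
  shows "eval_word D \<gamma> u = eval_word D \<gamma> v"
proof -
  obtain s t where st: "s \<in> S" "t \<in> S" "u = alternating (ord (s \<otimes> t)) s t" "v = alternating (ord (s \<otimes> t)) t s"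
    using assms by (auto simp: braid_relations_def)
  show ?thesis unfolding st(3,4) eval_word_alternating by (rule braid_interval[OF st(1,2)])
qed

lemma \<gamma>_S_closed: "\<gamma> ` S \<subseteq> carrier D"
  using S_interval by auto

lemma to_interval_hom: "to_interval \<in> hom Art D"
  unfolding to_interval_def artin_group_def
  by (rule D.pres_lift_hom[OF \<gamma>_S_closed artin_rel_interval])

lemma to_interval_gen: "s \<in> S \<Longrightarrow> to_interval (artin_gen W S s) = \<gamma> s"
  unfolding to_interval_def artin_gen_def
  by (rule D.pres_lift_gen[OF \<gamma>_S_closed artin_rel_interval])

sublocale to_int: group_hom Art D to_interval
  by unfold_locales (rule to_interval_hom)

lemma to_interval_cox_lift: "to_interval (cox_lift S) = \<gamma> c"
proof -
  have "to_interval (word_lift xs) = list_prod D (map \<gamma> xs)" if "set xs \<subseteq> S" for xs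
    using that
  proof (induction xs)
    case (Cons x xs)
    have "word_lift (x # xs) = artin_gen W S x \<otimes>\<^bsub>Art\<^esub> word_lift xs" by (simp add: word_lift_def)
    then show ?case using Cons to_interval_gen by simp
  qed (simp add: word_lift_def)
  then have "to_interval (cox_lift S) = list_prod D (map \<gamma> (cox_word S))"
    using set_cox_word[of S] by (simp add: cox_lift_def)
  also have "\<dots> = \<gamma> (list_prod W (cox_word S))"
  proof (rule \<gamma>_word)
    show "set (cox_word S) \<subseteq> reflections" using set_cox_word[of S] S_reflections by auto
    show "list_prod W (cox_word S) \<in> P" using c_in_interval by (simp add: cox_def)
    show "T.len (list_prod W (cox_word S)) = length (cox_word S)"
      using tlen_cox[of S] length_cox_word[of S] by (simp add: cox_def)
  qed
  finally show ?thesis by (simp add: cox_def)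
qed

lemma reflections_in_S: "t \<in> reflections \<Longrightarrow> t \<in> reflections_in S"
  using root_of_pos by (auto simp: reflections_in_def pos_roots_def)

lemma refl_lift_conj_pow:
  assumes t: "t \<in> reflections"
  shows "refl_lift (c [^] (k::nat) \<otimes> t \<otimes> inv (c [^] k))
    = cox_lift S [^]\<^bsub>Art\<^esub> k \<otimes>\<^bsub>Art\<^esub> refl_lift t \<otimes>\<^bsub>Art\<^esub> inv\<^bsub>Art\<^esub> (cox_lift S [^]\<^bsub>Art\<^esub> k)"
proof -
  let ?u = "c [^] k \<otimes> t \<otimes> inv (c [^] k)"
  have g: "c [^] k \<in> carrier W" "cox_lift S [^]\<^bsub>Art\<^esub> k \<in> carrier Art" by auto
  have u: "?u \<in> reflections" using reflections_conj[OF g(1) t] .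
  have "inv (c [^] k) \<otimes> ?u \<otimes> c [^] k = t" using conj_solve[OF g(1), of ?u t] u t by simp
  then have "refl_lift t = inv\<^bsub>Art\<^esub> (cox_lift S [^]\<^bsub>Art\<^esub> k) \<otimes>\<^bsub>Art\<^esub> refl_lift ?u \<otimes>\<^bsub>Art\<^esub> cox_lift S [^]\<^bsub>Art\<^esub> k"
    using refl_lift_rotate_pow[OF order.refl reflections_in_S[OF u], of k] by simp
  then show ?thesis
    using A.conj_solve[OF g(2) refl_lift_closed[OF u] refl_lift_closed[OF t]] by simp
qed

lemma reflections_coxeter_conj:
  assumes "t \<in> reflections"
  obtains k s where "s \<in> S" "t = c [^] (k::nat) \<otimes> s \<otimes> inv (c [^] k)"
  using reflection_coxeter_conj[OF order.refl reflections_in_S[OF assms]] by blast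

text \<open>Both sides are the conjugate of one simple generator by the same power of
  \<open>\<gamma> c\<close>: the left side by equivariance of the lift, the right side by
  \<open>\<gamma>_conj_pow\<close>.\<close>

lemma to_interval_refl_lift:
  assumes t: "t \<in> reflections"
  shows "to_interval (refl_lift t) = \<gamma> t"
proof -
  obtain k s where s: "s \<in> S" and ts: "t = c [^] (k::nat) \<otimes> s \<otimes> inv (c [^] k)"
    using reflections_coxeter_conj[OF t] .
  have cl: "cox_lift S \<in> carrier Art" "artin_gen W S s \<in> carrier Art" using s by auto
  have "refl_lift t = cox_lift S [^]\<^bsub>Art\<^esub> k \<otimes>\<^bsub>Art\<^esub> artin_gen W S s \<otimes>\<^bsub>Art\<^esub> inv\<^bsub>Art\<^esub> (cox_lift S [^]\<^bsub>Art\<^esub> k)"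
    unfolding ts using refl_lift_conj_pow[OF S_reflections[OF s]] refl_lift_S[OF s] by simp
  then have "to_interval (refl_lift t) = \<gamma> c [^]\<^bsub>D\<^esub> k \<otimes>\<^bsub>D\<^esub> \<gamma> s \<otimes>\<^bsub>D\<^esub> inv\<^bsub>D\<^esub> (\<gamma> c [^]\<^bsub>D\<^esub> k)"
    using cl to_interval_cox_lift to_interval_gen[OF s] by (simp add: to_int.hom_nat_pow)
  also have "\<dots> = \<gamma> t \<otimes>\<^bsub>D\<^esub> \<gamma> c [^]\<^bsub>D\<^esub> k \<otimes>\<^bsub>D\<^esub> inv\<^bsub>D\<^esub> (\<gamma> c [^]\<^bsub>D\<^esub> k)"
    using \<gamma>_conj_pow[OF c_in_interval, of s k] below_c S_interval(1)[OF s] ts by simp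
  also have "\<dots> = \<gamma> t"
    using reflections_in_interval(1)[OF t] c_in_interval by (simp add: D.m_assoc)
  finally show ?thesis .
qed

definition factor_word :: "'a \<Rightarrow> 'a list \<Rightarrow> bool" where
  "factor_word w ts \<longleftrightarrow> set ts \<subseteq> reflections \<and> length ts = T.len w \<and> list_prod W ts = w"

definition interval_lift :: "'a \<Rightarrow> 'a word set" where
  "interval_lift w = list_prod Art (map refl_lift (SOME ts. factor_word w ts))"

text \<open>Both factorizations are extended by one shortest factorization of
  \<open>inv w \<otimes> c\<close> to shortest factorizations of \<open>c\<close>. These have equal
  lifts by \<open>refl_lift_factorization\<close>, and the common part cancels.\<close>

lemma factor_word_unique:
  assumes w: "w \<in> P" and ts: "factor_word w ts" and us: "factor_word w us"
  shows "list_prod Art (map refl_lift ts) = list_prod Art (map refl_lift us)"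
proof -
  have wW: "w \<in> carrier W" using interval_closed[OF w] .
  have r: "inv w \<otimes> c \<in> carrier W" using wW by simp
  obtain rs where rs: "set rs \<subseteq> reflections" "length rs = T.len (inv w \<otimes> c)" "list_prod W rs = inv w \<otimes> c"
    using T.len_word[OF r] by blast
  have rA: "set (map refl_lift rs) \<subseteq> carrier Art" using rs(1) by auto
  have *: "list_prod Art (map refl_lift vs) \<otimes>\<^bsub>Art\<^esub> list_prod Art (map refl_lift rs) = cox_lift S
      \<and> list_prod Art (map refl_lift vs) \<in> carrier Art"
    if vs: "factor_word w vs" for vs
  proof -
    have v: "set vs \<subseteq> reflections" "length vs = T.len w" "list_prod W vs = w"
      using vs by (auto simp: factor_word_def)
    have vA: "set (map refl_lift vs) \<subseteq> carrier Art" using v(1) by auto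
    have "list_prod Art (map refl_lift (vs @ rs)) = cox_lift S"
    proof (rule refl_lift_factorization[OF order.refl])
      show "set (vs @ rs) \<subseteq> reflections" using v rs by simp
      show "length (vs @ rs) = card S" using v rs w tlen_cox[of S] by (simp add: interval_iff)
      have "set vs \<subseteq> carrier W" "set rs \<subseteq> carrier W" using v(1) rs(1) by auto
      then show "list_prod W (vs @ rs) = c" using v rs wW by (simp add: list_prod_append inv_cancel)
    qed
    then show ?thesis using A.list_prod_append[OF vA rA] A.list_prod_closed[OF vA] by simp
  qed
  have "list_prod Art (map refl_lift rs) \<in> carrier Art" using A.list_prod_closed[OF rA] .
  then show ?thesis using *[OF ts] *[OF us] A.right_cancel by metis
qed

lemma interval_lift_eq:
  assumes "w \<in> P" "factor_word w ts"
  shows "interval_lift w = list_prod Art (map refl_lift ts)"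
  unfolding interval_lift_def
  using factor_word_unique[OF assms(1) _ assms(2)] someI[of "factor_word w", OF assms(2)] by blast

lemma ex_factor_word: "w \<in> P \<Longrightarrow> \<exists>ts. factor_word w ts"
  unfolding factor_word_def using T.len_word interval_closed by blast

lemma interval_lift_closed: "interval_lift ` P \<subseteq> carrier Art"
proof
  fix x assume "x \<in> interval_lift ` P"
  then obtain w ts where "w \<in> P" "factor_word w ts" "x = interval_lift w" using ex_factor_word by blast
  then show "x \<in> carrier Art"
    using interval_lift_eq refl_lift_word_closed by (simp add: factor_word_def)
qed

text \<open>Where the partial product is defined, shortest factorizations of the two factors
  concatenate to a shortest one of the product.\<close>

lemma interval_lift_rel:
  assumes "(u, v) \<in> interval_relations W reflections c"
  shows "eval_word Art interval_lift u = eval_word Art interval_lift v"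
proof -
  obtain p q where u: "u = [Pos p, Pos q]" and v: "v = [Pos (p \<otimes> q)]" and P: "p \<in> P" "q \<in> P" "p \<otimes> q \<in> P"
    and l: "T.len (p \<otimes> q) = T.len p + T.len q"
    using assms unfolding interval_relations_def by blast
  obtain ts us where ts: "factor_word p ts" and us: "factor_word q us"
    using ex_factor_word P by blast
  have tA: "set (map refl_lift ts) \<subseteq> carrier Art" "set (map refl_lift us) \<subseteq> carrier Art"
    using ts us by (auto simp: factor_word_def)
  have "set ts \<subseteq> carrier W" "set us \<subseteq> carrier W" using ts us by (auto simp: factor_word_def)
  then have "factor_word (p \<otimes> q) (ts @ us)"
    using ts us l by (auto simp: factor_word_def list_prod_append)
  from interval_lift_eq[OF P(3) this]
  have "interval_lift (p \<otimes> q) = interval_lift p \<otimes>\<^bsub>Art\<^esub> interval_lift q"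
    using interval_lift_eq[OF P(1) ts] interval_lift_eq[OF P(2) us] A.list_prod_append[OF tA] by simp
  moreover have "interval_lift p \<in> carrier Art" "interval_lift q \<in> carrier Art" "interval_lift (p \<otimes> q) \<in> carrier Art"
    using interval_lift_closed P by blast+
  ultimately show ?thesis unfolding u v by (simp add: eval_word_def)
qed

definition from_interval :: "'a word set \<Rightarrow> 'a word set" where
  "from_interval = pres_lift Art interval_lift"

lemma from_interval_hom: "from_interval \<in> hom D Art"
  unfolding from_interval_def interval_group_def
  by (rule A.pres_lift_hom[OF interval_lift_closed interval_lift_rel])

lemma from_interval_gen: "w \<in> P \<Longrightarrow> from_interval (\<gamma> w) = interval_lift w"
  unfolding from_interval_def interval_gen_def
  by (rule A.pres_lift_gen[OF interval_lift_closed interval_lift_rel])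

lemma from_interval_reflection:
  assumes "t \<in> reflections"
  shows "from_interval (\<gamma> t) = refl_lift t"
proof -
  have "factor_word t [t]" using assms reflections_in_interval(2)[OF assms] by (simp add: factor_word_def)
  from interval_lift_eq[OF reflections_in_interval(1)[OF assms] this] show ?thesis
    using from_interval_gen[OF reflections_in_interval(1)[OF assms]] assms by simp
qed

lemma to_interval_word:
  "set ts \<subseteq> reflections \<Longrightarrow> to_interval (list_prod Art (map refl_lift ts)) = list_prod D (map \<gamma> ts)"
proof (induction ts)
  case (Cons t ts)
  then have "refl_lift t \<in> carrier Art" "list_prod Art (map refl_lift ts) \<in> carrier Art"
    using refl_lift_word_closed by auto
  then show ?case using Cons to_interval_refl_lift by simp
qed simp

lemma to_from_interval:
  assumes "x \<in> carrier D"
  shows "to_interval (from_interval x) = x"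
proof -
  have "(to_interval \<circ> from_interval) x = id x"
  proof (rule pres_hom_eqI[OF D.is_group[unfolded interval_group_def] _ _ _ assms[unfolded interval_group_def]])
    show "to_interval \<circ> from_interval \<in> hom (presented_group P (interval_relations W reflections c))
        (presented_group P (interval_relations W reflections c))"
      using from_interval_hom to_interval_hom by (auto simp: hom_def Pi_iff interval_group_def)
    show "id \<in> hom (presented_group P (interval_relations W reflections c))
        (presented_group P (interval_relations W reflections c))"
      by (auto simp: hom_def)
    fix w assume w: "w \<in> P"
    obtain ts where ts: "factor_word w ts" using ex_factor_word[OF w] by blast
    have "to_interval (from_interval (\<gamma> w)) = \<gamma> w"
      using from_interval_gen[OF w] interval_lift_eq[OF w ts] to_interval_word[of ts] \<gamma>_word[of ts] ts w
      by (simp add: factor_word_def)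
    then show "(to_interval \<circ> from_interval) (pres_gen P (interval_relations W reflections c) w)
        = id (pres_gen P (interval_relations W reflections c) w)"
      by (simp add: interval_gen_def)
  qed
  then show ?thesis by simp
qed

lemma from_to_interval:
  assumes "x \<in> carrier Art"
  shows "from_interval (to_interval x) = x"
proof -
  have "(from_interval \<circ> to_interval) x = id x"
  proof (rule pres_hom_eqI[OF A.is_group[unfolded artin_group_def] _ _ _ assms[unfolded artin_group_def]])
    show "from_interval \<circ> to_interval \<in> hom (presented_group S (braid_relations W S))
        (presented_group S (braid_relations W S))"
      using from_interval_hom to_interval_hom by (auto simp: hom_def Pi_iff artin_group_def)
    show "id \<in> hom (presented_group S (braid_relations W S)) (presented_group S (braid_relations W S))"
      by (auto simp: hom_def)
    fix s assume s: "s \<in> S"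
    have "from_interval (to_interval (artin_gen W S s)) = artin_gen W S s"
      using to_interval_gen[OF s] from_interval_reflection[OF S_reflections[OF s]] refl_lift_S[OF s] by simp
    then show "(from_interval \<circ> to_interval) (pres_gen S (braid_relations W S) s)
        = id (pres_gen S (braid_relations W S) s)"
      by (simp add: artin_gen_def)
  qed
  then show ?thesis by simp
qed

lemma from_interval_iso: "from_interval \<in> iso D Art"
proof -
  have "bij_betw from_interval (carrier D) (carrier Art)"
    using from_interval_hom to_interval_hom to_from_interval from_to_interval
    by (intro bij_betwI[of _ _ _ to_interval]) (auto simp: hom_def Pi_iff)
  then show ?thesis using from_interval_hom by (simp add: iso_def)
qed

lemma artin_proj_refl_lift:
  assumes t: "t \<in> reflections"
  shows "artin_proj W (refl_lift t) = t"
proof -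
  interpret pr: group_hom Art W "artin_proj W"
    by unfold_locales (rule artin_proj_hom[OF coxeter])
  have gen: "artin_proj W (artin_gen W S s) = s" if "s \<in> S" for s
    by (rule artin_proj_gen[OF coxeter that])
  have "artin_proj W (word_lift xs) = list_prod W xs" if "set xs \<subseteq> S" for xs
    using that
  proof (induction xs)
    case (Cons x xs)
    have "word_lift (x # xs) = artin_gen W S x \<otimes>\<^bsub>Art\<^esub> word_lift xs" by (simp add: word_lift_def)
    then show ?case using Cons gen by simp
  qed (simp add: word_lift_def)
  then have c: "artin_proj W (cox_lift S) = c"
    using set_cox_word[of S] by (simp add: cox_lift_def cox_def)
  obtain k s where s: "s \<in> S" and ts: "t = c [^] (k::nat) \<otimes> s \<otimes> inv (c [^] k)"
    using reflections_coxeter_conj[OF t] .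
  have cl: "cox_lift S \<in> carrier Art" "artin_gen W S s \<in> carrier Art" using s by auto
  have "refl_lift t = cox_lift S [^]\<^bsub>Art\<^esub> k \<otimes>\<^bsub>Art\<^esub> artin_gen W S s \<otimes>\<^bsub>Art\<^esub> inv\<^bsub>Art\<^esub> (cox_lift S [^]\<^bsub>Art\<^esub> k)"
    unfolding ts using refl_lift_conj_pow[OF S_reflections[OF s]] refl_lift_S[OF s] by simp
  then show ?thesis using cl c gen[OF s] ts by (simp add: pr.hom_nat_pow)
qed

text \<open>The Artin reflections allow all integer exponents, while the rotation lemmas concern
  natural powers in the two directions; they cover the two signs.\<close>

lemma conj_int_pow_refl_lift:
  fixes k :: int
  assumes s: "s \<in> S"
  shows "cox_lift S [^]\<^bsub>Art\<^esub> k \<otimes>\<^bsub>Art\<^esub> artin_gen W S s \<otimes>\<^bsub>Art\<^esub> cox_lift S [^]\<^bsub>Art\<^esub> (- k) \<in> refl_lift ` reflections"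
proof -
  have C: "cox_lift S \<in> carrier Art" by simp
  have sr: "s \<in> reflections" using S_reflections[OF s] .
  show ?thesis
  proof (cases "0 \<le> k")
    case True
    then obtain n where n: "k = int n" using nonneg_int_cases by blast
    have "cox_lift S [^]\<^bsub>Art\<^esub> k \<otimes>\<^bsub>Art\<^esub> artin_gen W S s \<otimes>\<^bsub>Art\<^esub> cox_lift S [^]\<^bsub>Art\<^esub> (- k)
      = refl_lift (c [^] n \<otimes> s \<otimes> inv (c [^] n))"
      using refl_lift_conj_pow[OF sr, of n] refl_lift_S[OF s] C
      by (simp add: n A.int_pow_neg int_pow_int)
    moreover have "c [^] n \<otimes> s \<otimes> inv (c [^] n) \<in> reflections"
      using reflections_conj[OF _ sr] by simp
    ultimately show ?thesis by blast
  next
    case False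
    then obtain n where n: "k = - int n" by (metis int_cases2 linear neg_0_le_iff_le of_nat_0_le_iff)
    have "cox_lift S [^]\<^bsub>Art\<^esub> k \<otimes>\<^bsub>Art\<^esub> artin_gen W S s \<otimes>\<^bsub>Art\<^esub> cox_lift S [^]\<^bsub>Art\<^esub> (- k)
      = refl_lift (inv (c [^] n) \<otimes> s \<otimes> c [^] n)"
      using refl_lift_rotate_pow[OF order.refl reflections_in_S[OF sr], of n] refl_lift_S[OF s] C
      by (simp add: n A.int_pow_neg int_pow_int)
    moreover have "inv (c [^] n) \<otimes> s \<otimes> c [^] n \<in> reflections"
      using reflections_conj'[OF _ sr] by simp
    ultimately show ?thesis by blast
  qed
qed

end

text \<open>Bijectivity is part of the conclusion, so that \<open>inv_into\<close> denotes a true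
  inverse of the canonical morphism on the Artin reflections.\<close>

theorem theorem2p2p5:
  fixes W :: "('a, 'b) monoid_scheme" and T L R :: "'a set"
  assumes "abstract_reflection_group TYPE('v::real_vector) W T"
    and "chromatic_pair W T L R"
  shows "bij_betw (artin_proj W) (artin_reflections W L R) T \<and>
    (\<exists>\<phi> \<in> iso (interval_group W T (coxeter_elt W L R)) (artin_group W (L \<union> R)).
      \<forall>t\<in>T. \<phi> (interval_gen W T (coxeter_elt W L R) t)
        = inv_into (artin_reflections W L R) (artin_proj W) t)"
proof -
  have fin: "finite (carrier W)" and gW: "group W"
    using assms(1) by (auto simp: abstract_reflection_group_def)
  have LR: "L \<subseteq> T" "R \<subseteq> T" "L \<inter> R = {}" and cox: "coxeter_system W (L \<union> R)"
    and cL: "comm_group (W\<lparr>carrier := generate W L\<rparr>)" and cR: "comm_group (W\<lparr>carrier := generate W R\<rparr>)"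
    using assms(2) by (auto simp: chromatic_pair_def)
  have C: "finite_coxeter W (L \<union> R)"
    using gW cox fin by (simp add: finite_coxeter_def finite_coxeter_axioms_def)
  have "finite L" "finite R" using finite_coxeter.finite_S[OF C] by auto
  then obtain lL lR where l: "set lL = L" "distinct lL" "set lR = R" "distinct lR"
    using finite_distinct_list by metis
  have comm: "s \<otimes>\<^bsub>W\<^esub> t = t \<otimes>\<^bsub>W\<^esub> s" if "comm_group (W\<lparr>carrier := generate W X\<rparr>)" "s \<in> X" "t \<in> X" for X s t
  proof -
    interpret X: comm_group "W\<lparr>carrier := generate W X\<rparr>" by (rule that)
    show ?thesis using X.m_comm[of s t] that by (simp add: generate.incl)
  qed
  interpret B: bipartite_coxeter W "L \<union> R" lL lR
    using C l LR(3) comm[OF cL] comm[OF cR]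
    by (intro bipartite_coxeter.intro bipartite_coxeter_axioms.intro) auto
  have T: "T = B.reflections" using B.reflections_eq[OF assms(1)] LR by blast
  have words: "B.cox_word (L \<union> R) = lL @ lR"
    using l unfolding B.cox_word_def by (auto simp: filter_id_conv)
  have sub: "set lL \<subseteq> L \<union> R" "set lR \<subseteq> L \<union> R" using l by auto
  have c: "coxeter_elt W L R = B.cox (L \<union> R)"
  proof -
    have "commuting_prod W (\<lambda>s. s) (set lL) = list_prod W (map (\<lambda>s. s) lL)"
      using l sub B.S_carrier comm[OF cL] by (intro B.commuting_prod_eq) auto
    moreover have "commuting_prod W (\<lambda>s. s) (set lR) = list_prod W (map (\<lambda>s. s) lR)"
      using l sub B.S_carrier comm[OF cR] by (intro B.commuting_prod_eq) auto
    ultimately show ?thesis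
      unfolding coxeter_elt_def B.cox_def words using l sub by (simp add: B.X_words_append)
  qed
  have ac: "artin_coxeter_elt W L R = B.cox_lift (L \<union> R)"
  proof -
    let ?A = "artin_group W (L \<union> R)" and ?g = "artin_gen W (L \<union> R)"
    have gc: "?g s \<otimes>\<^bsub>?A\<^esub> ?g t = ?g t \<otimes>\<^bsub>?A\<^esub> ?g s" if "s \<in> L \<and> t \<in> L \<or> s \<in> R \<and> t \<in> R" for s t
      using that comm[OF cL] comm[OF cR] by (intro B.\<theta>_commute) auto
    have gA: "?g ` set lL \<subseteq> carrier ?A" "?g ` set lR \<subseteq> carrier ?A"
      using sub B.\<theta>_closed by blast+
    have "commuting_prod ?A ?g (set lL) = list_prod ?A (map ?g lL)"
      by (rule B.A.commuting_prod_eq[OF l(2) gA(1)]) (use gc l(1) in blast)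
    moreover have "commuting_prod ?A ?g (set lR) = list_prod ?A (map ?g lR)"
      by (rule B.A.commuting_prod_eq[OF l(4) gA(2)]) (use gc l(3) in blast)
    ultimately show ?thesis
      unfolding artin_coxeter_elt_def B.cox_lift_def words using l B.word_lift_append[OF sub]
      by (simp add: B.word_lift_def)
  qed
  have image: "artin_reflections W L R = B.refl_lift ` T"
  proof
    show "artin_reflections W L R \<subseteq> B.refl_lift ` T"
      unfolding artin_reflections_def ac T using B.conj_int_pow_refl_lift by blast
    show "B.refl_lift ` T \<subseteq> artin_reflections W L R"
    proof
      fix x assume "x \<in> B.refl_lift ` T"
      then obtain t where t: "t \<in> B.reflections" "x = B.refl_lift t" using T by blast
      obtain k s where s: "s \<in> L \<union> R"
        and ts: "t = B.cox (L \<union> R) [^]\<^bsub>W\<^esub> (k::nat) \<otimes>\<^bsub>W\<^esub> s \<otimes>\<^bsub>W\<^esub> inv\<^bsub>W\<^esub> (B.cox (L \<union> R) [^]\<^bsub>W\<^esub> k)"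
        using B.reflections_coxeter_conj[OF t(1)] .
      have "x = B.cox_lift (L \<union> R) [^]\<^bsub>artin_group W (L \<union> R)\<^esub> int k
          \<otimes>\<^bsub>artin_group W (L \<union> R)\<^esub> artin_gen W (L \<union> R) s
          \<otimes>\<^bsub>artin_group W (L \<union> R)\<^esub> B.cox_lift (L \<union> R) [^]\<^bsub>artin_group W (L \<union> R)\<^esub> (- int k)"
        unfolding t(2) ts using B.refl_lift_conj_pow[OF B.S_reflections[OF s], of k] B.refl_lift_S[OF s]
        by (simp add: B.A.int_pow_neg int_pow_int)
      then show "x \<in> artin_reflections W L R"
        unfolding artin_reflections_def ac using s by blast
    qed
  qed
  have proj: "artin_proj W (B.refl_lift t) = t" if "t \<in> T" for t
    using B.artin_proj_refl_lift that T by simp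
  \<comment> \<open>The lift is a section of the projection and its image is the whole domain, so
    the two maps are inverse to each other.\<close>
  have bij: "bij_betw (artin_proj W) (artin_reflections W L R) T"
    unfolding image using proj by (intro bij_betwI[of _ _ _ B.refl_lift]) auto
  have "inv_into (artin_reflections W L R) (artin_proj W) t = B.refl_lift t" if "t \<in> T" for t
    using bij proj[OF that] that image
    by (intro inv_into_f_eq) (auto simp: bij_betw_def)
  moreover have "B.from_interval \<in> iso (interval_group W T (coxeter_elt W L R)) (artin_group W (L \<union> R))"
    unfolding T c by (rule B.from_interval_iso)
  moreover have "B.from_interval (interval_gen W T (coxeter_elt W L R) t) = B.refl_lift t" if "t \<in> T" for t
    using B.from_interval_reflection that unfolding T c by blast
  ultimately show ?thesis using bij by (metis (no_types, lifting))
qed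

end
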